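(* Let $\alpha$ be an algebraic number that is not a nonnegative integer, and let $\beta$ be its integral part. Then $$R_+(\alpha)=\mathcal{O}_{\mathbb{Q}(\alpha)}\left[\alpha,\beta_2,\beta_3,\beta_5,\dots\right],$$ where the elements $\beta_p$ are taken over all primes $p$. In particular, if $\alpha$ is an algebraic integer, then $$R_+(\alpha)=\mathcal{O}_{\mathbb{Q}(\alpha)}\left[\alpha_2,\alpha_3,\alpha_5,\dots\right].$$
   Context: For $\alpha\in\mathbb{C}$, $R_+(\alpha)$ denotes the set of all finite sums $\sum_{k\ge 0} a_k\binom{\alpha}{k}$ with $a_k\in\mathbb{Z}_{\ge 0}$, where $\binom{\alpha}{k}=\frac{\alpha(\alpha-1)\cdots(\alpha-k+1)}{k!}$. $\mathcal{O}_{\mathbb{Q}(\alpha)}$ is the ring of integers of $\mathbb{Q}(\alpha)$, and $\mathcal{O}_{\mathbb{Q}(\alpha)}[\dots]$ is the subring of $\mathbb{Q}(\alpha)$ generated by $\mathcal{O}_{\mathbb{Q}(\alpha)}$ and the listed elements. The denominator of an algebraic number $\alpha$ is the smallest positive integer $\delta$ such that $\delta\alpha$ is an algebraic integer; the integral part of $\alpha$ is $\beta=\delta\alpha$. Definition of $\alpha_p$ for an algebraic integer $\alpha$ and a prime $p$ (and, applied to $\beta$, of $\beta_p$). Let $m_\alpha$ be the (monic) minimal polynomial of $\alpha$ over $\mathbb{Q}$ and let $z_1,\dots,z_q$ be its distinct roots in $\mathbb{Z}_p$. Let $v_p$ be the $p$-adic valuation on $\overline{\mathbb{Q}_p}$ with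 $v_p(p)=1$. Let $k$ be the smallest positive integer such that $z_1,\dots,z_q$ are pairwise distinct modulo $p^k$. For each $i$ let $k_i=\sum_{j\ne i}v_p(z_j-z_i)$, let $K=\max_i k_i$ (with $K=0$ if $q=0$), and let $m_i=K-k_i+k$. Let $N=\left\lceil\max_j\max_{z\in\mathbb{Z}_p}v_p(z-y_j)\right\rceil$, where the $y_j$ run over the roots in $\overline{\mathbb{Q}_p}$ of the nonlinear irreducible factors of $m_\alpha$ over $\mathbb{Q}_p$ (with $N=0$ if there are none). For each $i$ choose an integer $r_i$ such that $r_i\equiv z_i$ modulo $p^{m_i+qN}$ but not modulo $p^{m_i+qN+1}$. Then $$\alpha_p=\frac{(\alpha-r_1)(\alpha-r_2)\cdots(\alpha-r_q)}{p^{K+k+qN}}.$$ If $m_\alpha$ has no roots in $\mathbb{Z}_p$ (so $q=0$), then $k=1$ and $\alpha_p=\frac1p$. The statement holds for any choice of the integers $r_i$. *)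

theory Defs
  imports
    Complex_Main
    "HOL-Algebra.Algebraic_Closure_Type"
    "HOL-Algebra.QuotRing"
    "HOL-Algebra.Generated_Rings"
    "HOL-Algebra.Generated_Fields"
begin

section \<open>Algebraic numbers\<close>

definition binomial_semiring :: "complex \<Rightarrow> complex set" where
  "binomial_semiring \<alpha> = {(\<Sum>k\<le>n. of_nat (a k) * (\<alpha> gchoose k)) | (n::nat) (a::nat \<Rightarrow> nat). True}"

abbreviation complex_ring :: "complex ring" where
  "complex_ring \<equiv> ring_of_type_algebra"

definition number_field :: "complex \<Rightarrow> complex set" where
  "number_field \<alpha> = generate_field complex_ring {\<alpha>}"

definition ring_of_integers :: "complex \<Rightarrow> complex set" where
  "ring_of_integers \<alpha> = {x \<in> number_field \<alpha>. algebraic_int x}"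

definition integers_adjoin :: "complex \<Rightarrow> complex set \<Rightarrow> complex set" where
  "integers_adjoin \<alpha> S = generate_ring complex_ring (ring_of_integers \<alpha> \<union> S)"

definition alg_denominator :: "complex \<Rightarrow> nat" where
  "alg_denominator \<alpha> = (LEAST d. d > 0 \<and> algebraic_int (of_nat d * \<alpha>))"

definition integral_part :: "complex \<Rightarrow> complex" where
  "integral_part \<alpha> = of_nat (alg_denominator \<alpha>) * \<alpha>"

definition rat_min_poly :: "complex \<Rightarrow> rat poly" where
  "rat_min_poly \<alpha> = (THE m. Polynomial.lead_coeff m = 1 \<and> Factorial_Ring.irreducible m \<and> poly (map_poly of_rat m) \<alpha> = 0)"


section \<open>The \<open>p\<close>-adic numbers\<close>

text \<open>The field of \<open>p\<close>-adic numbers is the completion of the rationals with respect to the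
  \<open>p\<close>-adic absolute value: the ring of rational Cauchy sequences modulo the ideal of null sequences.
  A \<open>p\<close>-adic number is thus a coset, i.e. a set of sequences. Since the prime has to vary inside the
  theorem, the fields are records depending on \<open>p\<close> rather than types.\<close>

text \<open>Only meaningful for nonzero arguments; the value at zero is irrelevant.\<close>

definition rat_val :: "nat \<Rightarrow> rat \<Rightarrow> int" where
  "rat_val p x = int (multiplicity (int p) (fst (quotient_of x)))
               - int (multiplicity (int p) (snd (quotient_of x)))"

definition rat_abs :: "nat \<Rightarrow> rat \<Rightarrow> real" where
  "rat_abs p x = (if x = 0 then 0 else real p powi (- rat_val p x))"

definition padic_cauchy :: "nat \<Rightarrow> (nat \<Rightarrow> rat) set" where
  "padic_cauchy p = {s. \<forall>e>0. \<exists>M. \<forall>m\<ge>M. \<forall>n\<ge>M. rat_abs p (s m - s n) < e}"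

definition padic_null :: "nat \<Rightarrow> (nat \<Rightarrow> rat) set" where
  "padic_null p = {s. \<forall>e>0. \<exists>M. \<forall>n\<ge>M. rat_abs p (s n) < e}"

definition cauchy_ring :: "nat \<Rightarrow> (nat \<Rightarrow> rat) ring" where
  "cauchy_ring p = \<lparr>
     carrier = padic_cauchy p,
     monoid.mult = (\<lambda>s t n. s n * t n),
     one = (\<lambda>n. 1),
     ring.zero = (\<lambda>n. 0),
     add = (\<lambda>s t n. s n + t n)\<rparr>"

type_synonym padic = "(nat \<Rightarrow> rat) set"

definition Qp :: "nat \<Rightarrow> padic ring" where
  "Qp p = cauchy_ring p Quot padic_null p"

definition Qp_of_rat :: "nat \<Rightarrow> rat \<Rightarrow> padic" where
  "Qp_of_rat p x = padic_null p +>\<^bsub>cauchy_ring p\<^esub> (\<lambda>n. x)"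

text \<open>For a Cauchy sequence that is not a null sequence, the valuation is eventually constant, and
  this constant depends only on the class. As before, the valuation of zero is not used.\<close>

definition Qp_val :: "nat \<Rightarrow> padic \<Rightarrow> int" where
  "Qp_val p A = (THE k. \<forall>s\<in>A. \<exists>M. \<forall>n\<ge>M. s n \<noteq> 0 \<and> rat_val p (s n) = k)"

definition Zp :: "nat \<Rightarrow> padic set" where
  "Zp p = {A \<in> carrier (Qp p). A = \<zero>\<^bsub>Qp p\<^esub> \<or> Qp_val p A \<ge> 0}"

definition Zp_cong :: "nat \<Rightarrow> nat \<Rightarrow> padic \<Rightarrow> padic \<Rightarrow> bool" where
  "Zp_cong p k x y \<longleftrightarrow> (\<exists>w\<in>Zp p. x \<ominus>\<^bsub>Qp p\<^esub> y = Qp_of_rat p (of_nat p ^ k) \<otimes>\<^bsub>Qp p\<^esub> w)"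


section \<open>The algebraic closure of the \<open>p\<close>-adic numbers\<close>

type_synonym padic_bar = "(padic list \<times> nat) multiset \<Rightarrow> padic"

definition Qp_bar :: "nat \<Rightarrow> padic_bar ring" where
  "Qp_bar p = field.alg_closure (Qp p)"

definition Qp_incl :: "nat \<Rightarrow> padic \<Rightarrow> padic_bar" where
  "Qp_incl p = ring.indexed_const (Qp p)"

text \<open>The extension of the \<open>p\<close>-adic valuation to the algebraic closure: if \<open>y\<close> has minimal polynomial
  \<open>P\<close> of degree \<open>d\<close> over the \<open>p\<close>-adic numbers, the norm of \<open>y\<close> is \<open>P(0)\<close> up to sign, and the valuation
  of \<open>y\<close> is that of its norm, divided by \<open>d\<close>. The normalisation is that \<open>p\<close> has valuation 1;
  the value at zero is not used.\<close>

definition Qp_bar_val :: "nat \<Rightarrow> padic_bar \<Rightarrow> real" where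
  "Qp_bar_val p y =
     (let P = ring.Irr (Qp_bar p) (Qp_incl p ` carrier (Qp p)) y;
          c = inv_into (carrier (Qp p)) (Qp_incl p) (ring.const_term (Qp_bar p) P)
      in of_int (Qp_val p c) / of_nat (Polynomials.degree P))"


section \<open>The elements \<open>\<alpha>\<^sub>p\<close>\<close>

text \<open>Polynomials in HOL-Algebra are coefficient lists starting with the leading coefficient.\<close>

definition padic_min_poly :: "nat \<Rightarrow> complex \<Rightarrow> padic list" where
  "padic_min_poly p \<alpha> = map (Qp_of_rat p) (rev (coeffs (rat_min_poly \<alpha>)))"

definition Zp_roots :: "nat \<Rightarrow> complex \<Rightarrow> padic set" where
  "Zp_roots p \<alpha> = {z \<in> Zp p. ring.eval (Qp p) (padic_min_poly p \<alpha>) z = \<zero>\<^bsub>Qp p\<^esub>}"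

definition sep_exp :: "nat \<Rightarrow> complex \<Rightarrow> nat" where
  "sep_exp p \<alpha> = (LEAST k. k > 0 \<and>
     (\<forall>z\<in>Zp_roots p \<alpha>. \<forall>w\<in>Zp_roots p \<alpha>. z \<noteq> w \<longrightarrow> \<not> Zp_cong p k z w))"

definition root_exp :: "nat \<Rightarrow> complex \<Rightarrow> padic \<Rightarrow> int" where
  "root_exp p \<alpha> z = (\<Sum>w\<in>Zp_roots p \<alpha> - {z}. Qp_val p (w \<ominus>\<^bsub>Qp p\<^esub> z))"

definition max_root_exp :: "nat \<Rightarrow> complex \<Rightarrow> int" where
  "max_root_exp p \<alpha> =
     (if Zp_roots p \<alpha> = {} then 0 else Max (root_exp p \<alpha> ` Zp_roots p \<alpha>))"

definition nonlinear_roots :: "nat \<Rightarrow> complex \<Rightarrow> padic_bar set" where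
  "nonlinear_roots p \<alpha> = {y \<in> carrier (Qp_bar p).
     \<exists>g \<in> carrier (poly_ring (Qp p)).
       pirreducible\<^bsub>Qp p\<^esub> (carrier (Qp p)) g \<and> Polynomials.degree g > 1 \<and>
       g pdivides\<^bsub>Qp p\<^esub> padic_min_poly p \<alpha> \<and>
       ring.eval (Qp_bar p) (map (Qp_incl p) g) y = \<zero>\<^bsub>Qp_bar p\<^esub>}"

text \<open>The supremum is a maximum, by compactness of the \<open>p\<close>-adic integers, as none of the \<open>y\<close> lies in
  the \<open>p\<close>-adic numbers. For an algebraic integer it is nonnegative, so \<open>nat\<close> does not truncate.\<close>

definition approx_exp :: "nat \<Rightarrow> complex \<Rightarrow> nat" where
  "approx_exp p \<alpha> = (if nonlinear_roots p \<alpha> = {} then 0 else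
     nat \<lceil>Max ((\<lambda>y. SUP z\<in>Zp p. Qp_bar_val p (Qp_incl p z \<ominus>\<^bsub>Qp_bar p\<^esub> y)) ` nonlinear_roots p \<alpha>)\<rceil>)"

text \<open>The chosen integers are indexed by the roots themselves; values of \<open>r\<close> elsewhere do not matter.\<close>

definition admissible_choice :: "nat \<Rightarrow> complex \<Rightarrow> (padic \<Rightarrow> int) \<Rightarrow> bool" where
  "admissible_choice p \<alpha> r \<longleftrightarrow> (\<forall>z\<in>Zp_roots p \<alpha>.
     let e = nat (max_root_exp p \<alpha> - root_exp p \<alpha> z) + sep_exp p \<alpha>
               + card (Zp_roots p \<alpha>) * approx_exp p \<alpha>
     in Zp_cong p e (Qp_of_rat p (of_int (r z))) z \<and>
        \<not> Zp_cong p (e + 1) (Qp_of_rat p (of_int (r z))) z)"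

definition alpha_p :: "nat \<Rightarrow> complex \<Rightarrow> (padic \<Rightarrow> int) \<Rightarrow> complex" where
  "alpha_p p \<alpha> r = (\<Prod>z\<in>Zp_roots p \<alpha>. \<alpha> - of_int (r z)) /
     of_nat p ^ (nat (max_root_exp p \<alpha>) + sep_exp p \<alpha> + card (Zp_roots p \<alpha>) * approx_exp p \<alpha>)"

end

theory Submission
  imports Defs "Jordan_Normal_Form.Char_Poly" "HOL-Number_Theory.Residues"
begin

hide_const (open) Polynomials.degree Polynomials.lead_coeff Coset.order UnivPoly.deg Divisibility.prime

text \<open>Let \<open>F\<close> be an integer polynomial with positive leading coefficient and \<open>F(\<alpha>) = 0\<close>. As \<open>\<alpha>\<close> is not
  a natural number, \<open>F\<close> may be assumed to have no natural root; for large \<open>k\<close> the expansion of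
  \<open>F(X) (X choose k)\<close> in binomial polynomials has positive coefficients. Hence \<open>-(\<alpha> choose k)\<close> is a nonnegative combination,
  first for large \<open>k\<close> and then, by downward induction, for all \<open>k\<close>: \<open>R\<^sub>+(\<alpha>)\<close> is the ring of all values
  \<open>f(\<alpha>)\<close> of integer-valued polynomials \<open>f\<close>.

  Let \<open>\<beta>\<close> be an algebraic integer with minimal polynomial \<open>m\<close>. If \<open>p\<^sup>s\<close> divides \<open>H(n)\<close> for all integers \<open>n\<close> at
  which \<open>m(n)\<close> is divisible by a high power of \<open>p\<close>, then \<open>H(\<beta>)/p\<^sup>s\<close> is the value of an integer-valued polynomial,
  since residue classes modulo powers of \<open>p\<close> have integer-valued indicator polynomials. Such \<open>n\<close> are
  \<open>p\<close>-adically close to roots of \<open>m\<close>; this gives \<open>\<beta>\<^sub>p \<in> R\<^sub>+(\<beta>)\<close>, and one prime at a time it also gives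
  that the ring of integers is contained in \<open>R\<^sub>+(\<alpha>)\<close>.

  For the converse, regard \<open>\<beta>\<^sub>p\<close> as a polynomial in \<open>\<beta>\<close>. By the choice of the \<open>r\<^sub>i\<close> it is a \<open>p\<close>-adic unit at the roots
  of \<open>m\<close> in \<open>\<int>\<^sub>p\<close>, where \<open>(X choose k)\<close> is integral, and it has negative valuation at all other conjugates.
  So \<open>1/\<beta>\<^sub>p\<close> is \<open>p\<close>-integral, and for large \<open>M\<close> so is \<open>(\<beta> choose k)/\<beta>\<^sub>p\<^sup>M\<close>; multiplying by \<open>\<beta>\<^sub>p\<^sup>M\<close> shows that
  \<open>(\<beta> choose k)\<close> lies in the localization at \<open>p\<close> of the ring generated by the integers and \<open>\<beta>\<^sub>p\<close>.\<close>

section \<open>Integral elements\<close>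

text \<open>Two obstacles shape the converse inclusion. First, \<alpha> itself need not be
  \<open>p\<close>-integral, so (\<alpha> choose k) can have denominators that the element at
  \<open>p\<close> does not control. A Horner sum \<open>c\<close> of a primitive integer equation
  of \<alpha> repairs this: \<open>c\<close> and \<open>c * \<alpha>\<close> are algebraic integers,
  so a power of \<open>c\<close> clears those denominators, while \<open>c\<close> is congruent
  modulo \<open>p\<close> to an integer prime to \<open>p\<close>, so the power can be removed
  again. Second, integrality at \<open>p\<close> must be read off from the conjugates over Q_p.
  Instead of a valuation on the algebraic closure, integrality over Z_p is used: each irreducible
  factor over Q_p yields a monic equation over Z_p, and their product is approximated by an equation
  over Z. The exponents K - k_i + k + qN make the valuation of the product of the z - r_j equal to K
  + k + qN at every root z in Z_p, because k_i cancels. At any other conjugate each of the q factors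
  has valuation at most N, so the denominator wins, strictly because k > 0.\<close>

definition integral_over :: "'a::field set \<Rightarrow> 'a \<Rightarrow> bool" where
  "integral_over S x \<longleftrightarrow> (\<exists>p. lead_coeff p = 1 \<and> (\<forall>i. coeff p i \<in> S) \<and> poly p x = 0)"

text \<open>One notion covers Z, Q, number fields, localizations, the valuation ring and
  \<open>int_valued_image\<close>, so that integrality is developed once for all of them.\<close>

locale coeff_subring =
  fixes S :: "'a::field set"
  assumes one_S [simp, intro]: "1 \<in> S"
    and add_S [intro]: "x \<in> S \<Longrightarrow> y \<in> S \<Longrightarrow> x + y \<in> S"
    and mult_S [intro]: "x \<in> S \<Longrightarrow> y \<in> S \<Longrightarrow> x * y \<in> S"
    and minus_S [intro]: "x \<in> S \<Longrightarrow> - x \<in> S"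
begin

lemma zero_S [simp, intro]: "0 \<in> S"
  using add_S[OF one_S minus_S[OF one_S]] by simp

lemma diff_S [intro]: "x \<in> S \<Longrightarrow> y \<in> S \<Longrightarrow> x - y \<in> S"
  using add_S[OF _ minus_S, of x y] by simp

lemma sum_S: "(\<And>i. i \<in> I \<Longrightarrow> f i \<in> S) \<Longrightarrow> sum f I \<in> S"
  by (induction I rule: infinite_finite_induct) auto

lemma prod_S: "(\<And>i. i \<in> I \<Longrightarrow> f i \<in> S) \<Longrightarrow> prod f I \<in> S"
  by (induction I rule: infinite_finite_induct) auto

lemma power_S: "x \<in> S \<Longrightarrow> x ^ n \<in> S"
  by (induction n) auto

lemma of_nat_S: "of_nat n \<in> S"
  by (induction n) auto

lemma of_int_S: "of_int n \<in> S"
  by (cases n) (auto simp: of_nat_S simp del: of_nat_Suc)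

lemma coeff_mult_S:
  "(\<And>i. coeff p i \<in> S) \<Longrightarrow> (\<And>i. coeff q i \<in> S) \<Longrightarrow> coeff (p * q) i \<in> S"
  by (auto simp: coeff_mult intro!: sum_S)

lemma coeff_prod_S:
  "(\<And>x i. x \<in> I \<Longrightarrow> coeff (f x) i \<in> S) \<Longrightarrow> coeff (prod f I) i \<in> S"
proof (induction I arbitrary: i rule: infinite_finite_induct)
  case (insert x F)
  thus ?case by (simp add: coeff_mult_S)
qed auto

lemma integral_over_base: "x \<in> S \<Longrightarrow> integral_over S x"
  unfolding integral_over_def
  by (rule exI[of _ "[:-x, 1:]"]) (auto simp: coeff_pCons split: nat.splits)

lemma coeff_char_poly_S:
  assumes A: "A \<in> carrier_mat n n" and S: "\<And>i j. i < n \<Longrightarrow> j < n \<Longrightarrow> A $$ (i,j) \<in> S"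
  shows "coeff (char_poly A) k \<in> S"
proof -
  have "coeff (char_poly_matrix A $$ (i,j)) l \<in> S" if "i < n" "j < n" for i j l
    using A that S[OF that] by (auto simp: char_poly_matrix_def coeff_pCons split: nat.splits)
  hence "coeff (\<Prod>i = 0..<n. char_poly_matrix A $$ (i, f i)) l \<in> S"
    if "f permutes {0..<n}" for f l
    using that by (intro coeff_prod_S) (auto simp: permutes_in_image[OF that])
  moreover have "coeff (signof f) l \<in> S" for f :: "nat \<Rightarrow> nat" and l
    by (cases "sign f = 1") (auto simp: sign_def one_pCons coeff_pCons split: nat.splits)
  ultimately show ?thesis
    using A unfolding char_poly_def
    by (subst det_def') (auto simp: char_poly_matrix_def coeff_sum intro!: sum_S coeff_mult_S)
qed

text \<open>By Cayley--Hamilton: multiplication by \<open>z\<close> on the module has an annihilating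
  characteristic polynomial.\<close>

lemma integral_over_stable_module:
  fixes v :: "nat \<Rightarrow> 'a"
  assumes stable: "\<And>i. i < n \<Longrightarrow> \<exists>s. (\<forall>j. s j \<in> S) \<and> z * v i = (\<Sum>j<n. s j * v j)"
    and nonzero: "i0 < n" "v i0 \<noteq> 0"
  shows "integral_over S z"
proof -
  obtain s where s: "\<And>i j. i < n \<Longrightarrow> s i j \<in> S"
    "\<And>i. i < n \<Longrightarrow> z * v i = (\<Sum>j<n. s i j * v j)"
    using stable by metis
  define A where "A = mat n n (\<lambda>(i,j). s i j)"
  have A: "A \<in> carrier_mat n n" by (simp add: A_def)
  have "eigenvector A (vec n v) z"
    unfolding eigenvector_def
  proof (intro conjI)
    show "vec n v \<in> carrier_vec (dim_row A)" by (simp add: A_def)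
    show "vec n v \<noteq> 0\<^sub>v (dim_row A)"
    proof
      assume "vec n v = 0\<^sub>v (dim_row A)"
      hence "vec n v $ i0 = 0\<^sub>v n $ i0" by (simp add: A_def)
      thus False using nonzero by simp
    qed
    show "A *\<^sub>v vec n v = z \<cdot>\<^sub>v vec n v"
      by (rule eq_vecI)
        (auto simp: A_def s scalar_prod_def atLeast0LessThan intro!: sum.cong)
  qed
  hence "poly (char_poly A) z = 0"
    using eigenvalue_root_char_poly[OF A, of z] by (auto simp: eigenvalue_def)
  moreover have "lead_coeff (char_poly A) = 1"
    using degree_monic_char_poly[OF A] by simp
  moreover have "coeff (char_poly A) i \<in> S" for i
    using coeff_char_poly_S[OF A] s by (simp add: A_def)
  ultimately show ?thesis unfolding integral_over_def by blast
qed

section \<open>Finitely generated modules over the subring\<close>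

definition module_span :: "nat \<Rightarrow> (nat \<Rightarrow> 'a) \<Rightarrow> 'a set" where
  "module_span n v = {\<Sum>j<n. s j * v j | s. \<forall>j. s j \<in> S}"

lemma module_span_add:
  assumes "x \<in> module_span n v" "y \<in> module_span n v" shows "x + y \<in> module_span n v"
proof -
  obtain s t where "\<forall>j. s j \<in> S" "x = (\<Sum>j<n. s j * v j)" "\<forall>j. t j \<in> S" "y = (\<Sum>j<n. t j * v j)"
    using assms unfolding module_span_def by auto
  thus ?thesis unfolding module_span_def
    by (auto intro!: exI[of _ "\<lambda>j. s j + t j"] simp: sum.distrib algebra_simps)
qed

lemma module_span_scale:
  assumes "x \<in> module_span n v" "c \<in> S" shows "c * x \<in> module_span n v"
proof -
  obtain s where "\<forall>j. s j \<in> S" "x = (\<Sum>j<n. s j * v j)"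
    using assms unfolding module_span_def by auto
  thus ?thesis unfolding module_span_def using assms(2)
    by (auto intro!: exI[of _ "\<lambda>j. c * s j"] simp: sum_distrib_left algebra_simps)
qed

lemma module_span_0: "0 \<in> module_span n v"
  unfolding module_span_def by (auto intro!: exI[of _ "\<lambda>_. 0"])

lemma module_span_sum:
  "(\<And>i. i \<in> I \<Longrightarrow> f i \<in> module_span n v) \<Longrightarrow> sum f I \<in> module_span n v"
  by (induction I rule: infinite_finite_induct) (auto simp: module_span_0 module_span_add)

lemma module_span_base: assumes "j < n" shows "v j \<in> module_span n v"
proof -
  have "v j = (\<Sum>i<n. (if i = j then 1 else 0) * v i)"
    using assms by (simp add: if_distrib[of "\<lambda>x. x * _"] sum.delta cong: if_cong)
  thus ?thesis unfolding module_span_def by (force intro!: exI[of _ "\<lambda>i. if i = j then 1 else 0"])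
qed

lemma module_span_mult:
  assumes "\<And>j. j < n \<Longrightarrow> z * v j \<in> module_span n v" "x \<in> module_span n v"
  shows "z * x \<in> module_span n v"
proof -
  obtain s where s: "\<forall>j. s j \<in> S" "x = (\<Sum>j<n. s j * v j)"
    using assms unfolding module_span_def by auto
  have "z * x = (\<Sum>j<n. s j * (z * v j))"
    by (simp add: s sum_distrib_left algebra_simps)
  also have "\<dots> \<in> module_span n v"
    by (intro module_span_sum module_span_scale[OF assms(1)]) (use s in auto)
  finally show ?thesis .
qed

lemma integral_over_module_span:
  assumes "\<And>i. i < n \<Longrightarrow> z * v i \<in> module_span n v" "i0 < n" "v i0 \<noteq> 0"
  shows "integral_over S z"
proof (rule integral_over_stable_module)
  show "i0 < n" "v i0 \<noteq> 0" by fact+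
next
  fix i assume "i < n"
  thus "\<exists>s. (\<forall>j. s j \<in> S) \<and> z * v i = (\<Sum>j<n. s j * v j)"
    using assms(1)[of i] unfolding module_span_def by auto
qed

lemma integral_over_powerD:
  assumes "integral_over S x"
  obtains n s where "n > 0" "\<And>i. s i \<in> S" "x ^ n = (\<Sum>i<n. s i * x ^ i)"
proof -
  obtain p where p: "lead_coeff p = 1" "\<And>i. coeff p i \<in> S" "poly p x = 0"
    using assms unfolding integral_over_def by blast
  have "degree p > 0" using p by (intro Nat.gr0I) (auto elim!: degree_eq_zeroE)
  moreover have "x ^ degree p = (\<Sum>i<degree p. - coeff p i * x ^ i)"
  proof -
    have "0 = (\<Sum>i\<le>degree p. coeff p i * x ^ i)" using p(3) by (simp add: poly_altdef)
    also have "\<dots> = (\<Sum>i<degree p. coeff p i * x ^ i) + x ^ degree p"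
      using p(1) by (simp add: lessThan_Suc_atMost[symmetric])
    finally show ?thesis by (simp add: sum_negf eq_neg_iff_add_eq_0 add.commute)
  qed
  ultimately show ?thesis using p(2) by (intro that[of "degree p" "\<lambda>i. - coeff p i"]) auto
qed

text \<open>The \<open>n * m\<close> products \<open>x ^ i * y ^ j\<close>, listed as
  \<open>v (i * m + j)\<close>, span a module containing 1 that is stable under \<open>x\<close> and
  under \<open>y\<close>, hence under their sum and their product.\<close>

lemma integral_over_add_mult:
  assumes "integral_over S x" "integral_over S y"
  shows "integral_over S (x + y)" "integral_over S (x * y)"
proof -
  obtain n s where n: "n > 0" "\<And>i. s i \<in> S" "x ^ n = (\<Sum>i<n. s i * x ^ i)"
    using integral_over_powerD[OF assms(1)] by blast
  obtain m t where m: "m > 0" "\<And>i. t i \<in> S" "y ^ m = (\<Sum>i<m. t i * y ^ i)"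
    using integral_over_powerD[OF assms(2)] by blast
  define v where "v k = x ^ (k div m) * y ^ (k mod m)" for k
  have mem: "x ^ i * y ^ j \<in> module_span (n * m) v" if "i < n" "j < m" for i j
  proof -
    have "i * m + j < n * m"
      using that mult_le_mono1[of "Suc i" n m] by simp
    moreover have "v (i * m + j) = x ^ i * y ^ j" using that by (simp add: v_def)
    ultimately show ?thesis by (metis module_span_base)
  qed
  have x: "x * v k \<in> module_span (n * m) v" if "k < n * m" for k
  proof -
    define i j where "i = k div m" and "j = k mod m"
    have ij: "i < n" "j < m" using that m(1) by (auto simp: i_def j_def less_mult_imp_div_less)
    show ?thesis
    proof (cases "Suc i < n")
      case True
      thus ?thesis using mem[OF True ij(2)] by (simp add: v_def i_def j_def mult_ac)
    next
      case False
      hence "x * v k = (\<Sum>l<n. s l * (x ^ l * y ^ j))"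
        using ij n(3) by (simp add: v_def flip: i_def j_def)
          (metis (no_types, lifting) Suc_lessI mult.assoc power_Suc sum.cong sum_distrib_right)
      also have "\<dots> \<in> module_span (n * m) v"
        by (intro module_span_sum module_span_scale mem n(2)) (use ij in auto)
      finally show ?thesis .
    qed
  qed
  have y: "y * v k \<in> module_span (n * m) v" if "k < n * m" for k
  proof -
    define i j where "i = k div m" and "j = k mod m"
    have ij: "i < n" "j < m" using that m(1) by (auto simp: i_def j_def less_mult_imp_div_less)
    show ?thesis
    proof (cases "Suc j < m")
      case True
      thus ?thesis using mem[OF ij(1) True] by (simp add: v_def i_def j_def mult_ac)
    next
      case False
      hence "Suc j = m" using ij by simp
      hence "y * v k = x ^ i * y ^ m" by (auto simp: v_def simp flip: i_def j_def)
      hence "y * v k = (\<Sum>l<m. t l * (x ^ i * y ^ l))"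
        by (simp add: m(3) sum_distrib_left mult_ac)
      also have "\<dots> \<in> module_span (n * m) v"
        by (intro module_span_sum module_span_scale mem m(2)) (use ij in auto)
      finally show ?thesis .
    qed
  qed
  have nz: "0 < n * m" "v 0 \<noteq> 0" using n m by (auto simp: v_def)
  show "integral_over S (x + y)"
    by (rule integral_over_module_span[where v = v and ?i0.0 = 0, OF _ nz]) (auto simp: distrib_right intro!: module_span_add x y)
  show "integral_over S (x * y)"
    by (rule integral_over_module_span[where v = v and ?i0.0 = 0, OF _ nz])
      (auto simp: mult.assoc intro!: module_span_mult[of "n * m" x v] x y)
qed

lemmas integral_over_add = integral_over_add_mult(1)
lemmas integral_over_mult = integral_over_add_mult(2)

lemma integral_over_of_int: "integral_over S (of_int n)"
  by (intro integral_over_base of_int_S)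

lemma integral_over_minus: "integral_over S x \<Longrightarrow> integral_over S (- x)"
  using integral_over_mult[OF integral_over_of_int[of "-1"], of x] by simp

lemma integral_over_power: "integral_over S x \<Longrightarrow> integral_over S (x ^ n)"
  by (induction n) (auto intro: integral_over_mult integral_over_base)

lemma integral_over_sum:
  "(\<And>i. i \<in> I \<Longrightarrow> integral_over S (f i)) \<Longrightarrow> integral_over S (sum f I)"
  by (induction I rule: infinite_finite_induct)
    (auto intro: integral_over_add integral_over_base)

lemma integral_over_prod:
  "(\<And>i. i \<in> I \<Longrightarrow> integral_over S (f i)) \<Longrightarrow> integral_over S (prod f I)"
  by (induction I rule: infinite_finite_induct)
    (auto intro: integral_over_mult integral_over_base)

text \<open>The module spanned by \<open>1, x, \<dots>, x\<^sup>n\<^sup>-\<^sup>1\<close> is stable under multiplication by the Horner sums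
  of an arbitrary, not necessarily monic, polynomial of degree \<open>n\<close> that vanishes at \<open>x\<close>.\<close>

lemma integral_over_horner:
  fixes x :: 'a and f :: "'a poly"
  assumes f: "\<And>i. coeff f i \<in> S" "poly f x = 0" "degree f > 0" and k: "k \<le> degree f"
  defines "b \<equiv> \<Sum>j=k..degree f. coeff f j * x ^ (j - k)"
  shows "integral_over S b" "integral_over S (b * x)"
proof -
  define n where "n = degree f"
  define v where "v i = x ^ i" for i :: nat
  \<comment> \<open>For \<open>e < k\<close> all exponents \<open>j - k + e\<close> stay below
    \<open>n\<close>. For \<open>e \<ge> k\<close> the equation f(x) = 0 trades the upper part
    \<open>b * x ^ k\<close> of f(x) for minus its lower part, whose exponents stay below
    \<open>n\<close> after multiplication by \<open>x ^ (e - k)\<close>. The case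
    \<open>e = n\<close> is included for the sake of \<open>b * x\<close>.\<close>
  have mem: "b * x ^ e \<in> module_span n v" if "e \<le> n" for e
  proof (cases "e < k")
    case True
    have "b * x ^ e = (\<Sum>j=k..n. coeff f j * v (j - k + e))"
      by (auto simp: b_def v_def sum_distrib_right mult.assoc n_def simp flip: power_add intro!: sum.cong)
    thus ?thesis using True k
      by (auto intro!: module_span_sum module_span_scale f module_span_base simp: n_def)
  next
    case False
    have "0 = (\<Sum>j\<le>n. coeff f j * x ^ j)" using f(2) by (simp add: poly_altdef n_def)
    also have "{..n} = {..<k} \<union> {k..n}" using k by (auto simp: n_def)
    also have "(\<Sum>j\<in>\<dots>. coeff f j * x ^ j) = (\<Sum>j<k. coeff f j * x ^ j) + (\<Sum>j=k..n. coeff f j * x ^ j)"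
      by (rule sum.union_disjoint) auto
    also have "(\<Sum>j=k..n. coeff f j * x ^ j) = b * x ^ k"
      unfolding b_def sum_distrib_right
      by (auto intro!: sum.cong simp: mult.assoc n_def simp flip: power_add)
    finally have "b * x ^ k = - (\<Sum>j<k. coeff f j * x ^ j)"
      by (simp add: eq_neg_iff_add_eq_0 add.commute)
    hence "b * x ^ e = - (\<Sum>j<k. coeff f j * x ^ j) * x ^ (e - k)"
      using False by (metis linorder_not_less mult.assoc ordered_cancel_comm_monoid_diff_class.add_diff_inverse power_add)
    also have "\<dots> = (\<Sum>j<k. - coeff f j * v (j + (e - k)))"
      by (simp add: sum_distrib_right v_def power_add mult.assoc sum_negf)
    also have "\<dots> \<in> module_span n v"
      by (intro module_span_sum module_span_scale module_span_base minus_S f)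
        (use False that k in \<open>auto simp: n_def\<close>)
    finally show ?thesis .
  qed
  have nz: "0 < n" "v 0 \<noteq> 0" using f by (auto simp: v_def n_def)
  show "integral_over S b"
    by (rule integral_over_module_span[where v = v and ?i0.0 = 0, OF _ nz]) (auto simp: v_def intro!: mem)
  show "integral_over S (b * x)"
  proof (rule integral_over_module_span[where v = v and ?i0.0 = 0, OF _ nz])
    fix i assume "i < n"
    thus "b * x * v i \<in> module_span n v" using mem[of "Suc i"] by (simp add: v_def mult.assoc)
  qed
qed

end

section \<open>Binomial expansions\<close>

definition binom_poly :: "nat \<Rightarrow> 'a::field_char_0 poly" where
  "binom_poly k = Polynomial.smult (1 / fact k) (\<Prod>i<k. [:- of_nat i, 1:])"

lemma poly_binom_poly [simp]: "poly (binom_poly k) x = x gchoose k"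
  by (simp add: binom_poly_def poly_prod gbinomial_prod_rev atLeast0LessThan)

lemma degree_binom_poly [simp]: "degree (binom_poly k) = k"
  by (simp add: binom_poly_def degree_prod_eq_sum_degree)

lemma lead_coeff_binom_poly: "coeff (binom_poly k) k = 1 / fact k"
proof -
  have "lead_coeff (\<Prod>i<k. [:- of_nat i, 1:]) = (1::'a)" by (simp add: lead_coeff_prod)
  thus ?thesis by (simp add: binom_poly_def degree_prod_eq_sum_degree)
qed

text \<open>The coefficients are found one value at a time: (x choose m) vanishes at 0, ..., m - 1
  and is 1 at m, so adding a multiple of it corrects the value at m without disturbing the earlier
  ones. Agreement at \<open>d + 1\<close> points then forces equality of polynomials.\<close>

lemma newton_expansion:
  fixes f :: "'a::field_char_0 poly"
  assumes f: "\<And>n::nat. poly f (of_nat n) \<in> \<int>" and d: "degree f \<le> d"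
  obtains c :: "nat \<Rightarrow> int" where "\<And>x. poly f x = (\<Sum>k\<le>d. of_int (c k) * (x gchoose k))"
    "f = (\<Sum>k\<le>d. Polynomial.smult (of_int (c k)) (binom_poly k))"
proof -
  have "\<exists>c::nat \<Rightarrow> int. \<forall>n<m. poly f (of_nat n) = (\<Sum>k<m. of_int (c k) * (of_nat n gchoose k))" for m
  proof (induction m)
    case (Suc m)
    then obtain c :: "nat \<Rightarrow> int" where c:
      "\<And>n. n < m \<Longrightarrow> poly f (of_nat n) = (\<Sum>k<m. of_int (c k) * (of_nat n gchoose k))" by blast
    have int: "(\<Sum>k<m. of_int (c k) * (of_nat m gchoose k)) \<in> (\<int> :: 'a set)"
      by (intro Ints_sum Ints_mult) (auto simp flip: binomial_gbinomial)
    obtain e :: int where e: "of_int e = poly f (of_nat m) - (\<Sum>k<m. of_int (c k) * (of_nat m gchoose k))"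
      using Ints_diff[OF f[of m] int] by (metis Ints_cases)
    have z: "(of_nat n gchoose m) = (0::'a)" if "n < m" for n
      using that by (simp flip: binomial_gbinomial)
    have s: "(\<Sum>k<m. of_int ((c(m := e)) k) * (x gchoose k)) = (\<Sum>k<m. of_int (c k) * (x gchoose k))"
      for x :: 'a by (intro sum.cong) auto
    have "poly f (of_nat n) = (\<Sum>k<Suc m. of_int ((c(m := e)) k) * (of_nat n gchoose k))"
      if "n < Suc m" for n
    proof (cases "n = m")
      case True
      have "(of_nat m gchoose m) = (1::'a)" by (simp flip: binomial_gbinomial)
      thus ?thesis by (simp add: True s e fun_upd_same del: fun_upd_apply)
    next
      case False
      hence "n < m" using that by simp
      thus ?thesis by (simp add: s c z del: fun_upd_apply)
    qed
    thus ?case by blast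
  qed auto
  then obtain c :: "nat \<Rightarrow> int" where c:
    "\<And>n. n < Suc d \<Longrightarrow> poly f (of_nat n) = (\<Sum>k<Suc d. of_int (c k) * (of_nat n gchoose k))" by blast
  define g where "g = (\<Sum>k\<le>d. Polynomial.smult (of_int (c k)) (binom_poly k) :: 'a poly)"
  have pg: "poly g x = (\<Sum>k\<le>d. of_int (c k) * (x gchoose k))" for x
    by (simp add: g_def poly_sum)
  have "degree g \<le> d" unfolding g_def
    by (intro degree_sum_le) (auto intro: order.trans[OF degree_smult_le])
  moreover have "card (of_nat ` {..d} :: 'a set) = Suc d"
    by (subst card_image) (auto simp: inj_on_def)
  ultimately have "f = g"
    using d c by (intro poly_eqI_degree[of "of_nat ` {..d}"]) (auto simp: pg lessThan_Suc_atMost)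
  thus ?thesis using pg that[of c] by (auto simp: g_def)
qed

text \<open>The coefficients of \<open>f\<close> may lie anywhere in the field; by
  \<open>newton_expansion\<close> they are rational all the same.\<close>

definition int_valued_image :: "'a::field_char_0 \<Rightarrow> 'a set" where
  "int_valued_image \<alpha> = {poly f \<alpha> | f. \<forall>n::int. poly f (of_int n) \<in> \<int>}"

lemma int_valued_imageI:
  "(\<And>n::int. poly f (of_int n) \<in> \<int>) \<Longrightarrow> x = poly f \<alpha> \<Longrightarrow> x \<in> int_valued_image \<alpha>"
  unfolding int_valued_image_def by blast

lemma coeff_subring_int_valued_image: "coeff_subring (int_valued_image \<alpha>)"
proof
  show "1 \<in> int_valued_image \<alpha>"
    by (rule int_valued_imageI[of 1]) auto
next
  fix x y assume "x \<in> int_valued_image \<alpha>" "y \<in> int_valued_image \<alpha>"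
  then obtain f g where fg: "\<And>n::int. poly f (of_int n) \<in> \<int>" "\<And>n::int. poly g (of_int n) \<in> \<int>"
    "x = poly f \<alpha>" "y = poly g \<alpha>" unfolding int_valued_image_def by blast
  show "x + y \<in> int_valued_image \<alpha>"
    by (rule int_valued_imageI[of "f + g"]) (auto simp: fg)
  show "x * y \<in> int_valued_image \<alpha>"
    by (rule int_valued_imageI[of "f * g"]) (auto simp: fg)
  show "- x \<in> int_valued_image \<alpha>"
    by (rule int_valued_imageI[of "- f"]) (auto simp: fg)
qed

lemma gchoose_in_int_valued_image: "(\<alpha> gchoose k) \<in> int_valued_image \<alpha>"
  by (rule int_valued_imageI[of "binom_poly k"]) (auto simp flip: of_int_gbinomial)

lemma int_valued_image_scale:
  "int_valued_image (of_nat \<delta> * \<alpha>) \<subseteq> int_valued_image \<alpha>"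
proof
  fix x assume "x \<in> int_valued_image (of_nat \<delta> * \<alpha>)"
  then obtain f where f: "\<And>n::int. poly f (of_int n) \<in> \<int>" "x = poly f (of_nat \<delta> * \<alpha>)"
    unfolding int_valued_image_def by blast
  show "x \<in> int_valued_image \<alpha>"
  proof (rule int_valued_imageI[of "f \<circ>\<^sub>p [:0, of_nat \<delta>:]"])
    fix n :: int
    show "poly (f \<circ>\<^sub>p [:0, of_nat \<delta>:]) (of_int n) \<in> \<int>"
      using f(1)[of "n * int \<delta>"] by (simp add: poly_pcompose)
  qed (simp add: f poly_pcompose mult.commute)
qed

section \<open>Nonnegative combinations\<close>

lemma binomial_semiring_0: "0 \<in> binomial_semiring \<alpha>"
  unfolding binomial_semiring_def by (force intro!: exI[of _ "\<lambda>_. 0"])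

lemma binomial_semiring_add:
  assumes "x \<in> binomial_semiring \<alpha>" "y \<in> binomial_semiring \<alpha>"
  shows "x + y \<in> binomial_semiring \<alpha>"
proof -
  have pad: "\<exists>b::nat\<Rightarrow>nat. \<forall>N\<ge>n. (\<Sum>k\<le>n. of_nat (a k) * (\<alpha> gchoose k)) = (\<Sum>k\<le>N. of_nat (b k) * (\<alpha> gchoose k))"
    for n and a :: "nat \<Rightarrow> nat"
    by (rule exI[of _ "\<lambda>k. if k \<le> n then a k else 0"])
      (auto intro!: sum.mono_neutral_cong_left split: if_splits)
  obtain n a m b where
    "x = (\<Sum>k\<le>n::nat. of_nat (a k) * (\<alpha> gchoose k))" "y = (\<Sum>k\<le>m::nat. of_nat (b k) * (\<alpha> gchoose k))"
    using assms unfolding binomial_semiring_def by blast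
  then obtain a' b' where
    "x = (\<Sum>k\<le>max n m. of_nat (a' k) * (\<alpha> gchoose k))" "y = (\<Sum>k\<le>max n m. of_nat (b' k) * (\<alpha> gchoose k))"
    using pad[of n a] pad[of m b] by (metis max.cobounded1 max.cobounded2)
  hence "x + y = (\<Sum>k\<le>max n m. of_nat (a' k + b' k) * (\<alpha> gchoose k))"
    by (simp add: sum.distrib algebra_simps)
  thus ?thesis unfolding binomial_semiring_def by (intro CollectI exI[of _ "\<lambda>k. a' k + b' k"] exI conjI TrueI)
qed

lemma binomial_semiring_sum:
  "(\<And>i. i \<in> I \<Longrightarrow> f i \<in> binomial_semiring \<alpha>) \<Longrightarrow> sum f I \<in> binomial_semiring \<alpha>"
  by (induction I rule: infinite_finite_induct) (auto simp: binomial_semiring_0 binomial_semiring_add)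

lemma binomial_semiring_scale:
  "x \<in> binomial_semiring \<alpha> \<Longrightarrow> of_nat n * x \<in> binomial_semiring \<alpha>"
  by (induction n) (auto simp: binomial_semiring_0 binomial_semiring_add distrib_right)

lemma binomial_semiring_gchoose: "(\<alpha> gchoose k) \<in> binomial_semiring \<alpha>"
proof -
  have "(\<alpha> gchoose k) = (\<Sum>j\<le>k. of_nat (if j = k then 1 else 0) * (\<alpha> gchoose j))"
    by (simp add: if_distrib[of of_nat] if_distrib[of "\<lambda>x. x * _"] sum.delta cong: if_cong)
  thus ?thesis unfolding binomial_semiring_def
    by (intro CollectI exI[of _ k] exI[of _ "\<lambda>j. if j = k then 1 else 0"]) simp
qed

lemma binomial_semiring_subset: "binomial_semiring \<alpha> \<subseteq> int_valued_image \<alpha>"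
proof
  interpret coeff_subring "int_valued_image \<alpha>" by (rule coeff_subring_int_valued_image)
  fix x assume "x \<in> binomial_semiring \<alpha>"
  then obtain n and a :: "nat \<Rightarrow> nat" where "x = (\<Sum>k\<le>n. of_nat (a k) * (\<alpha> gchoose k))"
    unfolding binomial_semiring_def by blast
  thus "x \<in> int_valued_image \<alpha>"
    by (auto intro!: sum_S mult_S of_nat_S gchoose_in_int_valued_image)
qed

section \<open>Additive inverses in the semiring\<close>

lemma integer_annihilator_without_nat_roots:
  fixes \<alpha> :: complex
  assumes "algebraic \<alpha>" "\<alpha> \<notin> \<nat>"
  obtains F :: "int poly" where "poly (map_poly of_int F) \<alpha> = 0" "lead_coeff F > 0"
    "\<And>n::nat. poly F (int n) \<noteq> 0"
proof -
  define P where "P F \<longleftrightarrow> F \<noteq> 0 \<and> poly (map_poly of_int F) \<alpha> = 0" for F :: "int poly"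
  obtain F0 where "P F0" using assms(1) by (auto simp: P_def elim!: algebraicE')
  then obtain F where F: "P F" "\<And>G. P G \<Longrightarrow> degree F \<le> degree G"
    using ex_has_least_nat[of P F0 degree] by auto
  define F' where "F' = (if lead_coeff F > 0 then F else - F)"
  have lc: "lead_coeff F' > 0" using F(1) by (auto simp: F'_def P_def not_less)
  have root: "poly (map_poly of_int F') \<alpha> = 0" using F(1) by (auto simp: F'_def P_def of_int_poly_hom.hom_uminus)
  have "poly F' (int n) \<noteq> 0" for n
  proof
    assume "poly F' (int n) = 0"
    then obtain G where G: "F' = [:- int n, 1:] * G" by (auto simp: poly_eq_0_iff_dvd elim!: dvdE)
    have "(of_nat n :: complex) \<noteq> \<alpha>" using assms(2) by auto
    hence "poly (map_poly of_int G) \<alpha> = 0" using root unfolding G of_int_poly_hom.hom_mult poly_mult by auto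
    moreover have "G \<noteq> 0" using lc G by auto
    ultimately have "degree F \<le> degree G" using F(2)[of G] by (simp add: P_def)
    moreover have "degree F = degree F'" by (simp add: F'_def)
    moreover have "degree F' = Suc (degree G)" unfolding G using \<open>G \<noteq> 0\<close> by (subst degree_mult_eq) auto
    ultimately show False by simp
  qed
  thus ?thesis using that root lc by blast
qed

text \<open>The \<open>i\<close>-th finite difference at \<open>k\<close> of the polynomial with Newton coefficients \<open>c\<close>.\<close>

definition newton_diff :: "(nat \<Rightarrow> int) \<Rightarrow> nat \<Rightarrow> nat \<Rightarrow> nat \<Rightarrow> int" where
  "newton_diff c d k i = (\<Sum>l\<le>d - i. c (l + i) * int (k choose l))"

text \<open>As a function of \<open>k\<close> this is a polynomial of degree \<open>d - i\<close>
  with leading coefficient \<open>c d / fact (d - i)\<close>, which is positive.\<close>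

lemma newton_diff_eventually_pos:
  assumes "c d > 0" "i \<le> d"
  shows "\<exists>K. \<forall>k\<ge>K. newton_diff c d k i > 0"
proof -
  define P :: "real poly" where "P = (\<Sum>l\<le>d - i. Polynomial.smult (of_int (c (l + i))) (binom_poly l))"
  have P: "poly P (real k) = of_int (newton_diff c d k i)" for k
    by (simp add: P_def newton_diff_def poly_sum binomial_gbinomial)
  have deg: "degree P \<le> d - i" unfolding P_def
    by (intro degree_sum_le) (auto intro: order.trans[OF degree_smult_le])
  have "coeff P (d - i) = (\<Sum>l\<le>d - i. of_int (c (l + i)) * coeff (binom_poly l) (d - i))"
    by (simp add: P_def coeff_sum)
  also have "\<dots> = (\<Sum>l\<in>{d - i}. of_int (c (l + i)) * coeff (binom_poly l) (d - i))"
    by (intro sum.mono_neutral_right) (auto intro!: coeff_eq_0)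
  also have "\<dots> > 0" using assms by (simp add: lead_coeff_binom_poly)
  finally have "lead_coeff P > 0" using deg by (metis coeff_eq_0 le_neq_implies_less less_irrefl)
  then obtain x where x: "\<And>y. y \<ge> x \<Longrightarrow> poly P y \<ge> lead_coeff P" using poly_pinfty_gt_lc[of P] by blast
  show ?thesis
  proof (intro exI allI impI)
    fix k assume "k \<ge> nat \<lceil>x\<rceil>"
    hence "real k \<ge> x" by linarith
    hence "poly P (real k) > 0" using x[of "real k"] \<open>lead_coeff P > 0\<close> by linarith
    thus "newton_diff c d k i > 0" by (simp add: P)
  qed
qed

text \<open>Vandermonde's identity expands each (x choose j) in the polynomials (x - k choose i),
  and the product of (x choose k) with (x - k choose i) is a multiple of (x choose k + i).
  Collecting terms by \<open>i\<close> leaves exactly the finite differences at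
  \<open>k\<close>.\<close>

lemma gchoose_mult_newton:
  fixes x :: "'a::field_char_0"
  shows "(x gchoose k) * (\<Sum>j\<le>d. of_int (c j) * (x gchoose j)) =
    (\<Sum>i\<le>d. of_int (newton_diff c d k i) * (of_nat ((k + i) choose k) * (x gchoose (k + i))))"
proof -
  have v: "(x gchoose j) = (\<Sum>i\<le>j. (x - of_nat k gchoose i) * (of_nat k gchoose (j - i)))" for j
    using gbinomial_Vandermonde[of "x - of_nat k" "of_nat k" j] by (simp add: atLeast0AtMost)
  have t: "(x gchoose k) * (x - of_nat k gchoose i) = of_nat ((k + i) choose k) * (x gchoose (k + i))" for i
    using gbinomial_trinomial_revision[of k "k + i" x] by (simp add: binomial_gbinomial mult.commute)
  define g where "g i j = of_int (c j) * ((x - of_nat k gchoose i) * (of_nat k gchoose (j - i)))" for i j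
  have "(\<Sum>j\<le>d. of_int (c j) * (x gchoose j)) = (\<Sum>j\<le>d. \<Sum>i\<le>j. g i j)"
    by (subst v) (simp add: sum_distrib_left g_def)
  also have "\<dots> = (\<Sum>i\<le>d. \<Sum>l\<le>d - i. g i (l + i))"
    unfolding sum.Sigma[OF finite_atMost ballI[OF finite_atMost]]
    by (rule sum.reindex_bij_witness[of _ "\<lambda>(i,l). (l + i, i)" "\<lambda>(j,i). (i, j - i)"]) auto
  also have "\<dots> = (\<Sum>i\<le>d. of_int (newton_diff c d k i) * (x - of_nat k gchoose i))"
    by (simp add: g_def newton_diff_def binomial_gbinomial sum_distrib_right sum_distrib_left mult_ac)
  finally have "(x gchoose k) * (\<Sum>j\<le>d. of_int (c j) * (x gchoose j)) =
      (\<Sum>i\<le>d. of_int (newton_diff c d k i) * ((x gchoose k) * (x - of_nat k gchoose i)))"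
    by (simp add: sum_distrib_left mult_ac)
  thus ?thesis by (simp only: t)
qed

theorem binomial_semiring_eq_int_valued_image:
  fixes \<alpha> :: complex
  assumes "algebraic \<alpha>" "\<alpha> \<notin> \<nat>"
  shows "binomial_semiring \<alpha> = int_valued_image \<alpha>"
proof
  show "binomial_semiring \<alpha> \<subseteq> int_valued_image \<alpha>" by (rule binomial_semiring_subset)
  obtain F where F: "poly (map_poly of_int F) \<alpha> = 0" "lead_coeff F > 0" "\<And>n::nat. poly F (int n) \<noteq> 0"
    using integer_annihilator_without_nat_roots[OF assms] by blast
  define d where "d = degree F"
  let ?F = "map_poly of_int F :: complex poly"
  have "poly ?F (of_nat n) \<in> \<int>" for n
    by (metis Ints_of_int of_int_hom.poly_map_poly of_int_of_nat_eq)
  then obtain c where c: "\<And>x. poly ?F x = (\<Sum>k\<le>d. of_int (c k) * (x gchoose k))"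
    "?F = (\<Sum>k\<le>d. Polynomial.smult (of_int (c k)) (binom_poly k))"
    using newton_expansion[of ?F d] by (auto simp: d_def)
  have "coeff ?F d = (\<Sum>k\<le>d. of_int (c k) * coeff (binom_poly k) d)"
    by (subst c(2)) (simp add: coeff_sum)
  also have "\<dots> = (\<Sum>k\<in>{d}. of_int (c k) * coeff (binom_poly k) d)"
    by (intro sum.mono_neutral_right) (auto intro!: coeff_eq_0)
  finally have "of_int (lead_coeff F) * fact d = (of_int (c d) :: complex)"
    by (simp add: lead_coeff_binom_poly d_def)
  hence "lead_coeff F * fact d = c d"
    by (metis of_int_eq_iff of_int_fact of_int_mult)
  hence cd: "c d > 0" using F(2) by (metis fact_gt_zero mult_pos_pos)
  have rel: "(\<Sum>i\<le>d. of_int (newton_diff c d k i) * (of_nat ((k + i) choose k) * (\<alpha> gchoose (k + i)))) = 0" for k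
    using gchoose_mult_newton[of \<alpha> k c d] F(1) by (simp add: c(1)[symmetric])
  \<comment> \<open>The zeroth difference is the value F(k), which is never 0; this is what the
    choice of \<open>F\<close> without natural roots is for.\<close>
  have nd0: "newton_diff c d k 0 = poly F (int k)" for k
  proof -
    have "(of_int (newton_diff c d k 0) :: complex) = poly ?F (of_int (int k))"
      by (simp add: c(1) newton_diff_def binomial_gbinomial)
    thus ?thesis by (metis of_int_eq_iff of_int_hom.poly_map_poly)
  qed
  define S where "S = binomial_semiring \<alpha>"
  \<comment> \<open>\<open>I\<close> is the largest additive group inside the semiring; the aim is
    to place every (\<alpha> choose k) in it.\<close>
  define I where "I = {s \<in> S. - s \<in> S}"
  have I_sum: "sum f A \<in> I" if "\<And>i. i \<in> A \<Longrightarrow> f i \<in> I" for f and A :: "nat set"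
    using that binomial_semiring_sum[of A f \<alpha>] binomial_semiring_sum[of A "\<lambda>i. - f i" \<alpha>]
    by (auto simp: I_def S_def sum_negf)
  have I_nat: "of_nat n * s \<in> I" if "s \<in> I" for n s
    using that binomial_semiring_scale[of s \<alpha> n] binomial_semiring_scale[of "-s" \<alpha> n] by (auto simp: I_def S_def)
  have I_int: "of_int z * s \<in> I" if "s \<in> I" for z s
    using I_nat[OF that, of "nat \<bar>z\<bar>"] by (cases "z \<ge> 0") (auto simp: I_def)
  \<comment> \<open>Adding n - 1 copies of an element to minus n copies leaves its negative.\<close>
  have neg: "(\<alpha> gchoose k) \<in> I" if "n > 0" "- (of_nat n * (\<alpha> gchoose k)) \<in> S" for n k
  proof -
    have "- (of_nat n * (\<alpha> gchoose k)) + of_nat (n - 1) * (\<alpha> gchoose k) \<in> S"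
      using that binomial_semiring_scale[OF binomial_semiring_gchoose] binomial_semiring_add
      unfolding S_def by blast
    also have "- (of_nat n * (\<alpha> gchoose k)) + of_nat (n - 1) * (\<alpha> gchoose k) = - (\<alpha> gchoose k)"
      using that by (simp add: of_nat_diff algebra_simps)
    finally show ?thesis using binomial_semiring_gchoose by (auto simp: I_def S_def)
  qed
  obtain K where K: "\<And>i k. i \<le> d \<Longrightarrow> k \<ge> K i \<Longrightarrow> newton_diff c d k i > 0"
    using newton_diff_eventually_pos[of c d, OF cd] by metis
  define L where "L = Max (K ` {..d})"
  have L: "newton_diff c d k i > 0" if "i \<le> d" "k \<ge> L" for i k
    using that by (intro K) (auto simp: L_def)
  have split: "- (of_int (newton_diff c d k 0) * (\<alpha> gchoose k)) =
      (\<Sum>i=1..d. of_int (newton_diff c d k i) * (of_nat ((k + i) choose k) * (\<alpha> gchoose (k + i))))" for k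
  proof -
    have "{..d} = insert 0 {1..d}" by auto
    thus ?thesis using rel[of k] by (simp add: add_eq_0_iff)
  qed
  have large: "(\<alpha> gchoose k) \<in> I" if "k \<ge> L" for k
  proof (rule neg)
    show "nat (newton_diff c d k 0) > 0" using L[of 0 k] that by simp
    have "(\<Sum>i=1..d. of_int (newton_diff c d k i) * (of_nat ((k + i) choose k) * (\<alpha> gchoose (k + i)))) \<in> S"
      unfolding S_def
    proof (rule binomial_semiring_sum)
      fix i assume "i \<in> {1..d}"
      hence "newton_diff c d k i > 0" using L that by simp
      hence "of_int (newton_diff c d k i) = (of_nat (nat (newton_diff c d k i)) :: complex)" by simp
      thus "of_int (newton_diff c d k i) * (of_nat ((k + i) choose k) * (\<alpha> gchoose (k + i))) \<in> binomial_semiring \<alpha>"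
        by (metis binomial_semiring_gchoose binomial_semiring_scale)
    qed
    thus "- (of_nat (nat (newton_diff c d k 0)) * (\<alpha> gchoose k)) \<in> S"
      using split[of k] L[of 0 k] that by simp
  qed
  \<comment> \<open>Below \<open>L\<close> the coefficients may have any sign. But the right-hand
    side of \<open>split\<close> involves only larger indices, so it lies in the group
    \<open>I\<close>, and F(k) is nonzero; hence \<open>neg\<close> applies with the absolute value
    of F(k). Taking \<open>m = L\<close> reaches every \<open>k\<close>.\<close>
  have "\<forall>k\<ge>L - m. (\<alpha> gchoose k) \<in> I" for m
  proof (induction m)
    case (Suc m)
    show ?case
    proof (intro allI impI)
      fix k assume k: "k \<ge> L - Suc m"
      show "(\<alpha> gchoose k) \<in> I"
      proof (cases "k \<ge> L - m")
        case False
        have "- (of_int (newton_diff c d k 0) * (\<alpha> gchoose k)) \<in> I"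
          unfolding split using Suc k False by (intro I_sum I_int I_nat) auto
        hence *: "- (of_int \<bar>newton_diff c d k 0\<bar> * (\<alpha> gchoose k)) \<in> S"
          by (cases "newton_diff c d k 0 \<ge> 0") (auto simp: I_def)
        show ?thesis
        proof (rule neg)
          show "nat \<bar>newton_diff c d k 0\<bar> > 0" using F(3)[of k] by (simp add: nd0)
          show "- (of_nat (nat \<bar>newton_diff c d k 0\<bar>) * (\<alpha> gchoose k)) \<in> S" using * by simp
        qed
      qed (use Suc in auto)
    qed
  qed (use large in auto)
  from this[of L] have all: "(\<alpha> gchoose k) \<in> I" for k by simp
  show "int_valued_image \<alpha> \<subseteq> binomial_semiring \<alpha>"
  proof
    fix x assume "x \<in> int_valued_image \<alpha>"
    then obtain f where f: "\<And>n::int. poly f (of_int n) \<in> \<int>" "x = poly f \<alpha>"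
      unfolding int_valued_image_def by blast
    have "poly f (of_nat n) \<in> \<int>" for n using f(1)[of "int n"] by simp
    then obtain a where "\<And>x. poly f x = (\<Sum>k\<le>degree f. of_int (a k) * (x gchoose k))"
      using newton_expansion[of f "degree f", OF _ order_refl] by blast
    hence "x = (\<Sum>k\<le>degree f. of_int (a k) * (\<alpha> gchoose k))" using f by simp
    also have "\<dots> \<in> I" by (intro I_sum I_int all)
    finally show "x \<in> binomial_semiring \<alpha>" by (simp add: I_def S_def)
  qed
qed

section \<open>Integer-valued indicator polynomials\<close>

text \<open>The library constrains \<^const>\<open>gbinomial\<close> to fields.\<close>

definition int_gchoose :: "int \<Rightarrow> nat \<Rightarrow> int" where
  "int_gchoose n k =
    (if n \<ge> 0 then int (nat n choose k) else (- 1) ^ k * int ((k + nat (- n) - 1) choose k))"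

lemma of_int_int_gchoose: "of_int (int_gchoose n k) = (of_int n gchoose k)"
  using of_int_gbinomial[of n k] unfolding gbinomial_int_binomial int_gchoose_def .

lemma fact_mult_int_gchoose: "fact k * int_gchoose n k = (\<Prod>i=0..<k. n - int i)"
proof -
  have "(of_int (fact k * int_gchoose n k) :: rat) = of_int (\<Prod>i=0..<k. n - int i)"
    by (simp add: of_int_int_gchoose gbinomial_mult_fact)
  thus ?thesis by (simp only: of_int_eq_iff)
qed


text \<open>If \<open>q\<close> divides \<open>n\<close>, the factors \<open>n - (1 + i)\<close> and
  \<open>1 + i\<close> for \<open>i < q - 1\<close> have equal \<open>p\<close>-adic valuation, so
  multiplying (q - 1)! by the binomial coefficient does not change its valuation. Otherwise q (n
  choose q) = n (n - 1 choose q - 1) forces a factor \<open>p\<close> into the second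
  binomial.\<close>

lemma prime_dvd_gchoose_shifted:
  fixes n :: int
  assumes p: "prime p" and q: "q = p ^ M"
  shows "int p dvd int_gchoose (n - 1) (q - 1) \<longleftrightarrow> \<not> int q dvd n"
proof -
  let ?c = "int_gchoose (n - 1) (q - 1)"
  have q0: "q > 0" using p q by (simp add: prime_gt_0_nat)
  have pe: "prime (int p)" using p by simp
  show ?thesis
  proof (cases "int q dvd n")
    case True
    have fp: "(fact (q - 1) :: int) * ?c = (\<Prod>i=0..<q - 1. n - (1 + int i))"
      unfolding fact_mult_int_gchoose by (simp add: algebra_simps)
    have ff: "(fact (q - 1) :: int) = (\<Prod>i=0..<q - 1. 1 + int i)"
      by (simp add: fact_prod_Suc)
    have nd: "\<not> int q dvd 1 + int i" if "i < q - 1" for i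
      using that by (auto dest!: zdvd_imp_le)
    hence nz: "n - (1 + int i) \<noteq> 0" if "i < q - 1" for i
      using True that by auto
    have m: "multiplicity (int p) (n - (1 + int i)) = multiplicity (int p) (1 + int i)" if i: "i < q - 1" for i
    proof -
      have iff: "int p ^ k dvd n - (1 + int i) \<longleftrightarrow> int p ^ k dvd 1 + int i" if "k \<le> M" for k
        using True that by (metis dvd_diff_right_iff dvd_trans le_imp_power_dvd of_nat_power q)
      define l where "l = multiplicity (int p) (1 + int i)"
      have "l < M" using nd[OF i] by (metis l_def leI multiplicity_dvd' of_nat_power q)
      have "\<not> int p ^ Suc l dvd 1 + int i" 
        by (subst power_dvd_iff_le_multiplicity) (use pe in \<open>auto simp: l_def\<close>)
      hence "multiplicity (int p) (n - (1 + int i)) = l"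
        using \<open>l < M\<close> iff[of l] iff[of "Suc l"] multiplicity_dvd[of "int p" "1 + int i"]
        by (intro multiplicity_eqI) (auto simp: l_def)
      thus ?thesis by (simp add: l_def)
    qed
    have "multiplicity (int p) (\<Prod>i=0..<q - 1. n - (1 + int i)) = multiplicity (int p) (\<Prod>i=0..<q - 1. 1 + int i)"
    proof -
      have d: "multiplicity (int p) (prod f I) = (\<Sum>i\<in>I. multiplicity (int p) (f i))"
        if "\<And>i. i \<in> I \<Longrightarrow> f i \<noteq> 0" "finite I" for f and I :: "nat set"
        by (rule prime_elem_multiplicity_prod_distrib) (use that pe in force)+
      have "(\<Sum>i\<in>{0..<q - 1}. multiplicity (int p) (n - (1 + int i))) =
          (\<Sum>i\<in>{0..<q - 1}. multiplicity (int p) (1 + int i))"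
        by (intro sum.cong refl m) simp
      thus ?thesis using nz by (subst (1 2) d) (simp_all del: of_nat_Suc)
    qed
    hence "multiplicity (int p) ((fact (q - 1) :: int) * ?c) = multiplicity (int p) (fact (q - 1) :: int)"
      unfolding fp by (simp only: ff)
    moreover have "?c \<noteq> 0" using fp nz by auto
    ultimately have "multiplicity (int p) ?c = 0"
      using pe by (simp add: prime_elem_multiplicity_mult_distrib)
    hence "\<not> int p dvd ?c" using \<open>?c \<noteq> 0\<close> pe
      by (subst (asm) multiplicity_eq_zero_iff) auto
    thus ?thesis using True by simp
  next
    case False
    have "int q * int_gchoose n q = n * ?c"
    proof -
      have "(of_int (int q * int_gchoose n q) :: rat) = of_int (n * ?c)"
        using gbinomial_absorption'[of q "of_int n :: rat"] q0 by (simp add: of_int_int_gchoose)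
      thus ?thesis by (simp only: of_int_eq_iff)
    qed
    hence "int p ^ M dvd n * ?c" using q by (metis dvd_triv_left of_nat_power)
    hence "int p dvd ?c" using False q pe
      by (metis coprime_dvd_mult_left_iff coprime_power_left_iff of_nat_power prime_imp_coprime)
    thus ?thesis using False by simp
  qed
qed

text \<open>(n - 1 choose q - 1) is a unit modulo \<open>p\<close> exactly when \<open>q\<close>
  divides \<open>n\<close>. A suitable power sends units to 1 by Euler's theorem and multiples of
  \<open>p\<close> to 0.\<close>

lemma indicator_polynomial:
  assumes p: "prime p"
  obtains g :: "int \<Rightarrow> int" and E :: "'a::field_char_0 poly"
  where "\<And>n. poly E (of_int n) = of_int (g n)"
    "\<And>n. [g n = (if int p ^ M dvd n then 1 else 0)] (mod int p ^ M)"
proof -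
  define q where "q = p ^ M"
  \<comment> \<open>The factor \<open>totient q\<close> serves Euler's theorem, \<open>Suc M\<close>
    ensures \<open>e \<ge> M\<close>, and the factor 2 makes the power even, so that the
    natural-number form of Euler's theorem can be applied to the absolute value.\<close>
  define e where "e = 2 * Suc M * totient q"
  define g :: "int \<Rightarrow> int" where "g n = int_gchoose (n - 1) (q - 1) ^ e" for n
  define E where "E = (binom_poly (q - 1) \<circ>\<^sub>p [:-1, 1:] :: 'a poly) ^ e"
  have q0: "q > 0" using p by (simp add: q_def prime_gt_0_nat)
  have "e \<ge> M" using mult_le_mono2[of 1 "totient q" "Suc M"] q0 by (simp add: e_def Suc_le_eq)
  show ?thesis
  proof (rule that)
    show "poly E (of_int n) = of_int (g n)" for n
      by (simp add: E_def g_def poly_pcompose of_int_int_gchoose)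
    show "[g n = (if int p ^ M dvd n then 1 else 0)] (mod int p ^ M)" for n
    proof (cases "int p ^ M dvd n")
      case False
      hence "int p dvd int_gchoose (n - 1) (q - 1)"
        using prime_dvd_gchoose_shifted[OF p q_def, of n] by (simp add: q_def)
      hence "int p ^ e dvd g n" unfolding g_def by (rule dvd_power_same)
      hence "int p ^ M dvd g n" using \<open>e \<ge> M\<close> by (metis dvd_trans le_imp_power_dvd)
      thus ?thesis using False by (simp add: cong_0_iff)
    next
      case True
      define z where "z = nat \<bar>int_gchoose (n - 1) (q - 1)\<bar>"
      have "\<not> p dvd z" using True prime_dvd_gchoose_shifted[OF p q_def, of n]
        by (simp add: q_def z_def flip: int_dvd_int_iff)
      hence "Rings.coprime z q" using p by (simp add: q_def coprime_commute prime_imp_coprime)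
      hence "[(z ^ totient q) ^ (2 * Suc M) = 1 ^ (2 * Suc M)] (mod q)"
        by (intro cong_pow euler_theorem)
      moreover have "totient q * (2 * Suc M) = e" by (simp add: e_def)
      ultimately have "[z ^ e = 1] (mod q)" by (simp only: power_one flip: power_mult)
      hence "[int (z ^ e) = int 1] (mod int q)" by (simp only: cong_int_iff)
      moreover have "int (z ^ e) = g n"
        by (simp add: g_def z_def e_def power_mult power_even_abs)
      ultimately show ?thesis using True by (simp add: q_def)
    qed
  qed
qed

text \<open>The gcd of \<open>a\<close> and \<open>p ^ (s + t)\<close> is some \<open>p ^ j\<close>
  and has to divide \<open>p ^ t * b\<close>. This is clear for \<open>j \<le> t\<close>; for
  \<open>j > t\<close> the premise applies, since then \<open>p ^ t\<close> divides
  \<open>a\<close>.\<close>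

lemma solve_linear_cong:
  fixes a b p :: int
  assumes "prime p" "p ^ t dvd a \<Longrightarrow> p ^ s dvd b"
  shows "\<exists>c. p ^ (s + t) dvd p ^ t * b + a * c"
proof -
  define d where "d = gcd a (p ^ (s + t))"
  have "d dvd p ^ (s + t)" by (simp add: d_def)
  then obtain j where j: "j \<le> s + t" "normalize d = p ^ j"
    using divides_primepow[OF assms(1)] by blast
  hence dj: "d = p ^ j" using assms(1) by (simp add: d_def prime_ge_0_int)
  have "d dvd p ^ t * b"
  proof (cases "j \<le> t")
    case True
    thus ?thesis by (simp add: dj le_imp_power_dvd)
  next
    case False
    hence "p ^ t dvd a" using dj by (metis d_def dvd_trans gcd_dvd1 le_imp_power_dvd nat_le_linear)
    hence "p ^ (s + t) dvd p ^ t * b" using assms(2) by (simp add: power_add mult.commute mult_dvd_mono)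
    thus ?thesis using \<open>d dvd p ^ (s + t)\<close> dvd_trans by blast
  qed
  then obtain k where k: "p ^ t * b = d * k" by blast
  obtain u w where uw: "u * a + w * p ^ (s + t) = d"
    using bezout_int[of a "p ^ (s + t)"] by (auto simp: d_def)
  have "p ^ t * b + a * (- u * k) = p ^ (s + t) * (w * k)"
    unfolding k uw[symmetric] by (simp add: algebra_simps)
  thus ?thesis by (metis dvd_triv_left)
qed

text \<open>H / p^s may be altered by a multiple of \<open>m\<close>, which vanishes at \<alpha>. In
  each residue class modulo \<open>p ^ (s + t)\<close> the congruence lemma supplies a constant
  \<open>c\<close> for which p^t H + c m is divisible by \<open>p ^ (s + t)\<close>. The polynomial
  \<open>U\<close> glues these constants with translated indicators, and \<open>F\<close> is the
  resulting integer-valued polynomial.\<close>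

lemma local_in_int_valued_image:
  fixes \<alpha> :: "'a::field_char_0" and m H :: "int poly"
  assumes p: "prime p" and root: "poly (map_poly of_int m) \<alpha> = 0"
    and loc: "\<And>n. int p ^ t dvd poly m n \<Longrightarrow> int p ^ s dvd poly H n"
  shows "poly (map_poly of_int H) \<alpha> / of_nat p ^ s \<in> int_valued_image \<alpha>"
proof -
  define M where "M = s + t"
  define Q where "Q = p ^ M"
  have p0: "p > 0" using p prime_gt_0_nat by blast
  hence Q0: "Q > 0" by (simp add: Q_def)
  have ex: "\<exists>c. int p ^ M dvd int p ^ t * poly H n + poly m n * c" for n
    unfolding M_def by (rule solve_linear_cong) (use p loc in auto)
  define c where "c n = (SOME c. int p ^ M dvd int p ^ t * poly H n + poly m n * c)" for n
  have c: "int p ^ M dvd int p ^ t * poly H n + poly m n * c n" for n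
    unfolding c_def by (rule someI_ex[OF ex])
  obtain E :: "'a poly" and g :: "int \<Rightarrow> int"
    where E: "\<And>n. poly E (of_int n) = of_int (g n)"
      "\<And>n. [g n = (if int p ^ M dvd n then 1 else 0)] (mod int p ^ M)"
  proof (rule indicator_polynomial[OF p, where M = M and 'a = 'a])
    fix g :: "int \<Rightarrow> int" and E :: "'a poly"
    assume "\<And>n. poly E (of_int n) = of_int (g n)"
      "\<And>n. [g n = (if int p ^ M dvd n then 1 else 0)] (mod int p ^ M)"
    thus thesis by (rule that)
  qed
  define U where "U = (\<Sum>a<Q. Polynomial.smult (of_int (c (int a))) (E \<circ>\<^sub>p [:- of_nat a, 1:]))"
  define u where "u n = (\<Sum>a<Q. c (int a) * g (n - int a))" for n
  have U: "poly U (of_int n) = of_int (u n)" for n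
  proof -
    have "poly E (of_int n - of_nat a) = of_int (g (n - int a))" for a
      using E(1)[of "n - int a"] by simp
    thus ?thesis by (simp add: U_def u_def poly_sum poly_pcompose)
  qed
  have u: "[u n = c (n mod int Q)] (mod int p ^ M)" for n
  proof -
    have "[u n = (\<Sum>a<Q. c (int a) * (if int p ^ M dvd n - int a then 1 else 0))] (mod int p ^ M)"
      unfolding u_def by (intro cong_sum cong_mult cong_refl E(2))
    also have "(\<Sum>a<Q. c (int a) * (if int p ^ M dvd n - int a then 1 else 0)) =
        (\<Sum>a<Q. if a = nat (n mod int Q) then c (int a) else 0)"
    proof (intro sum.cong refl)
      fix a assume a: "a \<in> {..<Q}"
      have "int Q dvd n - int a \<longleftrightarrow> n mod int Q = int a mod int Q"
        by (simp add: mod_eq_dvd_iff)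
      also have "\<dots> \<longleftrightarrow> a = nat (n mod int Q)" using a Q0 by auto
      finally show "c (int a) * (if int p ^ M dvd n - int a then 1 else 0) =
          (if a = nat (n mod int Q) then c (int a) else 0)" by (simp add: Q_def)
    qed
    also have "\<dots> = c (n mod int Q)" using Q0 by (simp add: nat_less_iff)
    finally show ?thesis .
  qed
  define F where "F = Polynomial.smult (1 / of_nat p ^ M)
    (Polynomial.smult (of_nat p ^ t) (map_poly of_int H) + map_poly of_int m * U)"
  show ?thesis
  proof (rule int_valued_imageI[of F])
    fix n :: int
    define r where "r = n mod int Q"
    have nr: "[n = r] (mod int p ^ M)" by (simp add: r_def Q_def cong_def)
    have cp: "[poly f n = poly f r] (mod int p ^ M)" for f :: "int poly"
      using nr by (induction f) (auto intro!: cong_add cong_mult)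
    have "[int p ^ t * poly H n + poly m n * u n = int p ^ t * poly H r + poly m r * c r] (mod int p ^ M)"
      by (intro cong_add cong_mult cong_refl cp) (simp add: u r_def)
    hence "int p ^ M dvd int p ^ t * poly H n + poly m n * u n"
      using c[of r] by (simp add: cong_dvd_iff)
    then obtain k where k: "int p ^ t * poly H n + poly m n * u n = int p ^ M * k" by blast
    have "poly F (of_int n) = of_int (int p ^ t * poly H n + poly m n * u n) / of_nat p ^ M"
      by (simp add: F_def U of_int_hom.poly_map_poly)
    also have "\<dots> = of_int k" unfolding k using p0 by simp
    finally show "poly F (of_int n) \<in> \<int>" by simp
  next
    show "poly (map_poly of_int H) \<alpha> / of_nat p ^ s = poly F \<alpha>"
      using p0 by (simp add: F_def root M_def power_add)
  qed
qed

section \<open>Integrality and localization\<close>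

interpretation Ints_subring: coeff_subring "\<int> :: 'a::field_char_0 set"
  by unfold_locales auto

lemma algebraic_int_iff_integral_over: "algebraic_int x \<longleftrightarrow> integral_over \<int> (x :: 'a::field_char_0)"
  by (auto simp: algebraic_int.simps integral_over_def)

lemmas algebraic_int_mult = Ints_subring.integral_over_mult[folded algebraic_int_iff_integral_over]

text \<open>The integers that multiply \<open>x\<close> into \<open>S\<close> form an ideal. It
  contains \<open>N\<close> and, for each prime factor of \<open>N\<close>, an element prime to it;
  repeated gcds therefore descend to 1.\<close>

lemma (in coeff_subring) mem_of_local:
  assumes N: "N > 0" "of_nat N * x \<in> S"
    and loc: "\<And>p. prime p \<Longrightarrow> p dvd N \<Longrightarrow> \<exists>D. \<not> p dvd D \<and> of_nat D * x \<in> S"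
  shows "x \<in> S"
  using assms
proof (induction N rule: less_induct)
  case (less N)
  show ?case
  proof (cases "N = 1")
    case False
    then obtain p where p: "prime p" "p dvd N" using prime_factor_nat by blast
    then obtain D where D: "\<not> p dvd D" "of_nat D * x \<in> S" using less.prems(3) by blast
    obtain u w :: int where uw: "u * int D + w * int N = int (gcd D N)"
      using bezout_int[of "int D" "int N"] by auto
    have "of_int u * (of_nat D * x) + of_int w * (of_nat N * x) \<in> S"
      by (intro add_S mult_S[OF of_int_S] D less.prems)
    also have "of_int u * (of_nat D * x) + of_int w * (of_nat N * x) =
        of_int (u * int D + w * int N) * x" by (simp add: algebra_simps)
    also have "\<dots> = of_nat (gcd D N) * x" unfolding uw by simp
    finally have 1: "of_nat (gcd D N) * x \<in> S" .
    have 2: "gcd D N dvd N" by simp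
    have "gcd D N \<noteq> N"
    proof
      assume "gcd D N = N"
      hence "N dvd D" using gcd_dvd1[of D N] by simp
      thus False using D(1) p(2) dvd_trans by blast
    qed
    with dvd_imp_le[OF 2 less.prems(1)] have "gcd D N < N" by (rule le_neq_trans)
    thus ?thesis
    proof (rule less.IH[OF _ _ 1])
      show "gcd D N > 0" using less.prems(1) by simp
      fix p assume "prime p" "p dvd gcd D N"
      thus "\<exists>D. \<not> p dvd D \<and> of_nat D * x \<in> S" using less.prems(3) by simp
    qed
  next
    case True
    thus ?thesis using less.prems(2) by simp
  qed
qed

text \<open>Z is integrally closed: if \<mu> takes an integer value at the rational number H(n) /
  p^s, that number is a root of a monic integer polynomial and so an integer. Thus high divisibility
  of m(n) by \<open>p\<close> gives divisibility of H(n) by \<open>p ^ s\<close>, the hypothesis of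
  \<open>local_in_int_valued_image\<close>.\<close>

lemma integral_prime_power_in_int_valued_image:
  fixes \<gamma> :: "'a::field_char_0"
  assumes p: "prime p" and int: "algebraic_int \<gamma>"
    and \<gamma>: "of_nat p ^ s * \<gamma> = poly (map_poly of_int H) \<alpha>"
  shows "\<gamma> \<in> int_valued_image \<alpha>"
proof -
  obtain \<mu> where \<mu>: "poly (map_poly of_int \<mu>) \<gamma> = 0" "lead_coeff \<mu> = 1"
    using int by (auto simp: algebraic_int_altdef_ipoly)
  define d where "d = degree \<mu>"
  have d: "d > 0"
  proof (rule Nat.gr0I)
    assume "d = 0"
    then obtain a where "\<mu> = [:a:]" by (auto simp: d_def elim: degree_eq_zeroE)
    thus False using \<mu> by simp
  qed
  define P where "P = int p ^ s"
  have P0: "P > 0" using p by (simp add: P_def prime_gt_0_nat)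
  \<comment> \<open>This is P^d \<mu>(H / P), with denominators cleared by homogenizing
    \<mu>.\<close>
  define m where "m = (\<Sum>i\<le>d. Polynomial.smult (coeff \<mu> i * P ^ (d - i)) (H ^ i))"
  have hom: "x ^ (d - i) * (x * y) ^ i = x ^ d * y ^ i" if "i \<le> d" for i and x y :: "'b::comm_ring_1"
    using that by (simp add: power_mult_distrib mult.assoc[symmetric] flip: power_add)
  have "poly (map_poly of_int m) \<alpha> = (\<Sum>i\<le>d. of_int (coeff \<mu> i) * (of_int P ^ (d - i) * (of_int P * \<gamma>) ^ i))"
    using \<gamma> by (simp add: m_def of_int_poly_hom.hom_sum of_int_hom.map_poly_hom_smult poly_sum
        of_int_poly_hom.hom_power P_def mult.assoc)
  also have "\<dots> = (\<Sum>i\<le>d. of_int (coeff \<mu> i) * (of_int P ^ d * \<gamma> ^ i))"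
    by (intro sum.cong refl) (simp only: hom atMost_iff)
  also have "\<dots> = of_int P ^ d * poly (map_poly of_int \<mu>) \<gamma>"
    by (simp add: poly_altdef d_def sum_distrib_left mult_ac)
  finally have root: "poly (map_poly of_int m) \<alpha> = 0" by (simp add: \<mu>)
  have "int p ^ s dvd poly H n" if dvd: "int p ^ (s * d) dvd poly m n" for n
  proof -
    define y where "y = (of_int (poly H n) / of_int P :: rat)"
    obtain k where k: "poly m n = P ^ d * k" using dvd by (auto simp: P_def power_mult)
    have "of_int (poly m n) = (\<Sum>i\<le>d. of_int (coeff \<mu> i) * (of_int P ^ (d - i) * (of_int P * y) ^ i))"
      using P0 by (simp add: m_def poly_sum y_def mult.assoc)
    also have "\<dots> = (\<Sum>i\<le>d. of_int (coeff \<mu> i) * (of_int P ^ d * y ^ i))"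
      by (intro sum.cong refl) (simp only: hom atMost_iff)
    also have "\<dots> = of_int P ^ d * poly (map_poly of_int \<mu>) y"
      by (simp add: poly_altdef d_def sum_distrib_left mult_ac)
    finally have "of_int P ^ d * poly (map_poly of_int \<mu>) y = of_int P ^ d * of_int k"
      unfolding k by (simp only: of_int_mult of_int_power)
    hence "poly (map_poly of_int \<mu>) y = of_int k"
      by (rule mult_left_cancel[THEN iffD1, rotated]) (use P0 in simp)
    have "algebraic_int y"
    proof (rule algebraic_int_root)
      show "poly (map_poly of_int \<mu>) y = of_int k" by fact
      show "degree (map_poly of_int \<mu> :: rat poly) > 0" using d by (simp add: d_def)
    qed (use \<mu>(2) in simp_all)
    hence "y \<in> \<int>" by (rule rational_algebraic_int_is_int) (auto simp: y_def)
    then obtain z where "y = of_int z" by (elim Ints_cases)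
    hence "(of_int (poly H n) :: rat) = of_int (P * z)" using P0 by (simp add: y_def field_simps)
    hence "poly H n = P * z" by (simp only: of_int_eq_iff)
    thus ?thesis by (simp add: P_def)
  qed
  hence "poly (map_poly of_int H) \<alpha> / of_nat p ^ s \<in> int_valued_image \<alpha>"
    by (rule local_in_int_valued_image[OF p root])
  thus ?thesis using \<gamma>[symmetric] p by (simp add: prime_gt_0_nat)
qed

text \<open>With D = p^s D' the algebraic integer D' \<gamma> has only a power of \<open>p\<close>
  as denominator, so the previous lemma applies to it; \<open>mem_of_local\<close> then combines the
  primes.\<close>

lemma integral_in_int_valued_image:
  fixes \<gamma> :: "'a::field_char_0"
  assumes int: "algebraic_int \<gamma>" and D: "D > 0" "of_nat D * \<gamma> = poly (map_poly of_int H) \<alpha>"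
  shows "\<gamma> \<in> int_valued_image \<alpha>"
proof -
  interpret coeff_subring "int_valued_image \<alpha>" by (rule coeff_subring_int_valued_image)
  have \<alpha>: "\<alpha> \<in> int_valued_image \<alpha>" using gchoose_in_int_valued_image[of \<alpha> 1] by simp
  have "poly (map_poly of_int H) \<alpha> \<in> int_valued_image \<alpha>"
    unfolding poly_altdef by (intro sum_S mult_S power_S \<alpha>) (simp add: of_int_S)
  hence "of_nat D * \<gamma> \<in> int_valued_image \<alpha>" by (simp add: D)
  with D(1) show ?thesis
  proof (rule mem_of_local)
    fix p assume p: "prime p" "p dvd D"
    obtain s D' where D': "D = p ^ s * D'" "\<not> p dvd D'"
      using D(1) p(1) by (metis multiplicity_decompose' not_prime_unit neq0_conv)
    have "of_nat D' * \<gamma> \<in> int_valued_image \<alpha>"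
      by (rule integral_prime_power_in_int_valued_image[OF p(1), of _ s H])
        (use int D(2) in \<open>auto simp: D' mult.assoc intro: algebraic_int_mult\<close>)
    thus "\<exists>D. \<not> p dvd D \<and> of_nat D * \<gamma> \<in> int_valued_image \<alpha>" using D'(2) by blast
  qed
qed

section \<open>Number fields\<close>

abbreviation rpoly :: "rat poly \<Rightarrow> 'a::field_char_0 \<Rightarrow> 'a" where
  "rpoly q x \<equiv> poly (map_poly of_rat q) x"

interpretation of_rat_poly_hom: map_poly_comm_ring_hom "of_rat :: rat \<Rightarrow> 'a::field_char_0" ..

interpretation Rats_subring: coeff_subring "\<rat> :: 'a::field_char_0 set"
  by unfold_locales auto

lemma complex_ring_ops [simp]:
  "\<one>\<^bsub>complex_ring\<^esub> = 1" "\<zero>\<^bsub>complex_ring\<^esub> = 0"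
  "x \<oplus>\<^bsub>complex_ring\<^esub> y = x + y" "x \<otimes>\<^bsub>complex_ring\<^esub> y = x * y"
  "carrier complex_ring = UNIV"
  by (simp_all add: ring_of_type_algebra_def)

lemma complex_ring_a_inv [simp]: "\<ominus>\<^bsub>complex_ring\<^esub> x = - x"
  using abelian_group.minus_equality[OF ring.is_abelian_group[OF ring_from_type_algebra], of "- x :: complex" x]
  by simp

lemma complex_ring_m_inv [simp]: "x \<noteq> 0 \<Longrightarrow> inv\<^bsub>complex_ring\<^esub> x = inverse x"
  using comm_monoid.comm_inv_char[OF cring.axioms(2)[OF cring_from_type_algebra], of x "inverse x :: complex"]
  by simp

lemma rat_poly_clear_denominators:
  fixes q :: "rat poly"
  obtains D :: nat and H :: "int poly"
  where "D > 0" "Polynomial.smult (of_nat D) q = map_poly of_int H"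
proof -
  have "\<exists>D H. D > 0 \<and> Polynomial.smult (of_nat D) q = map_poly of_int H"
  proof (induction q)
    case 0
    show ?case by (intro exI[of _ 1] exI[of _ 0]) simp
  next
    case (pCons c q)
    then obtain D H where D: "D > 0" "Polynomial.smult (of_nat D) q = map_poly of_int H" by blast
    obtain a b where c: "c = of_int a / of_int b" "b > 0"
      by (metis quotient_of_denom_pos quotient_of_div surj_pair)
    have b: "of_nat (nat b) = (of_int b :: rat)" using c(2) by simp
    have "Polynomial.smult (of_nat (nat b * D)) (pCons c q) =
        map_poly of_int (pCons (int D * a) (Polynomial.smult b H))"
    proof -
      have "Polynomial.smult (of_int b * of_nat D) q = Polynomial.smult (of_int b) (map_poly of_int H)"
        unfolding D(2)[symmetric] by simp
      moreover have "of_int b * of_nat D * c = of_int (int D * a)" using c by simp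
      ultimately show ?thesis
        by (simp only: b of_int_hom.map_poly_hom_smult of_int_hom.map_poly_pCons_hom of_nat_mult
            smult_pCons)
    qed
    moreover have "nat b * D > 0" using c D by simp
    ultimately show ?case by blast
  qed
  thus ?thesis using that by blast
qed

lemma rpoly_clear_denominators:
  fixes x :: "'a::field_char_0"
  assumes "D > 0" "Polynomial.smult (of_nat D) q = map_poly of_int H"
  shows "of_nat D * rpoly q x = poly (map_poly of_int H) x"
proof -
  have "map_poly of_rat (Polynomial.smult (of_nat D) q) = (map_poly of_int H :: 'a poly)"
    unfolding assms(2) by (simp add: map_poly_map_poly o_def)
  hence "rpoly (Polynomial.smult (of_nat D) q) x = poly (map_poly of_int H) x" by simp
  thus ?thesis by (simp add: of_rat_hom.map_poly_hom_smult)
qed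

text \<open>A rational annihilator of least degree has nonzero constant term, since otherwise a
  factor X could be divided out. Solving for that term exhibits the inverse as a polynomial, which
  is why every element of Q(\<alpha>) is a polynomial in \<alpha>.\<close>

lemma integral_over_Rats_inverse:
  fixes x :: "'a::field_char_0"
  assumes "integral_over \<rat> x" "x \<noteq> 0"
  obtains q :: "rat poly" where "inverse x = rpoly q x"
proof -
  define P where "P p \<longleftrightarrow> p \<noteq> 0 \<and> rpoly p x = 0" for p :: "rat poly"
  obtain p0 where p0: "lead_coeff p0 = 1" "\<And>i. coeff p0 i \<in> \<rat>" "poly p0 x = 0"
    using assms(1) unfolding integral_over_def by blast
  have "\<exists>q. coeff p0 i = of_rat q" for i using p0(2)[of i] by (cases rule: Rats_cases) auto
  hence "\<forall>i. \<exists>q. coeff p0 i = of_rat q" by blast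
  from choice[OF this] obtain f where f: "\<And>i. coeff p0 i = of_rat (f i)" by blast
  define p1 where "p1 = (\<Sum>i\<le>degree p0. monom (f i) i)"
  have "map_poly of_rat p1 = p0"
    unfolding p1_def of_rat_poly_hom.hom_sum
    by (subst poly_as_sum_of_monoms[symmetric]) (simp add: f)
  hence "P p1" using p0 by (auto simp: P_def)
  then obtain p where p: "P p" "\<And>q. P q \<Longrightarrow> degree p \<le> degree q"
    using ex_has_least_nat[of P p1 degree] by auto
  obtain c r where cr: "p = pCons c r" by (cases p)
  have eq: "of_rat c + x * rpoly r x = 0" using p(1) by (simp add: P_def cr of_rat_hom.map_poly_pCons_hom)
  have "c \<noteq> 0"
  proof
    assume "c = 0"
    hence "rpoly r x = 0" "r \<noteq> 0" using eq assms(2) p(1) by (auto simp: P_def cr)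
    hence "degree p \<le> degree r" using p(2) by (simp add: P_def)
    thus False using \<open>r \<noteq> 0\<close> by (simp add: cr)
  qed
  have "rpoly (Polynomial.smult (- inverse c) r) x = inverse x"
  proof (rule inverse_unique[symmetric])
    have "x * rpoly r x = - of_rat c" using eq by (simp add: add_eq_0_iff)
    moreover have "x * rpoly (Polynomial.smult (- inverse c) r) x = - (inverse (of_rat c) * (x * rpoly r x))"
      by (simp add: of_rat_hom.map_poly_hom_smult of_rat_poly_hom.hom_uminus of_rat_inverse mult.left_commute)
    ultimately show "x * rpoly (Polynomial.smult (- inverse c) r) x = 1"
      using \<open>c \<noteq> 0\<close> by simp
  qed
  thus ?thesis by (rule that[OF sym])
qed

lemma algebraic_imp_integral_over_Rats:
  assumes "algebraic (x :: 'a::field_char_0)"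
  shows "integral_over \<rat> x"
proof -
  obtain p where p: "p \<noteq> 0" "poly (map_poly of_int p) x = 0" using assms by (auto elim: algebraicE')
  define q :: "'a poly" where "q = Polynomial.smult (inverse (of_int (lead_coeff p))) (map_poly of_int p)"
  have "lead_coeff q = 1" "poly q x = 0" "\<And>i. coeff q i \<in> \<rat>" using p by (auto simp: q_def)
  thus ?thesis unfolding integral_over_def by blast
qed

lemma integral_over_Rats_rpoly:
  fixes x :: "'a::field_char_0"
  assumes "integral_over \<rat> x" shows "integral_over \<rat> (rpoly q x)"
  unfolding poly_altdef
  by (intro Rats_subring.integral_over_sum Rats_subring.integral_over_mult
      Rats_subring.integral_over_power assms Rats_subring.integral_over_base) simp

lemma number_field_repr:
  assumes "algebraic \<alpha>" "x \<in> number_field \<alpha>"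
  obtains q where "x = rpoly q \<alpha>"
proof -
  have "\<exists>q. x = rpoly q \<alpha>"
    using assms(2) unfolding number_field_def
  proof (induction rule: generate_field.induct)
    case one
    show ?case by (intro exI[of _ 1]) simp
  next
    case (incl h)
    thus ?case by (intro exI[of _ "[:0, 1:]"]) simp
  next
    case (a_inv h)
    then obtain q where "h = rpoly q \<alpha>" by blast
    thus ?case by (intro exI[of _ "- q"]) (simp add: of_rat_poly_hom.hom_uminus)
  next
    case (m_inv h)
    then obtain q where q: "h = rpoly q \<alpha>" by blast
    have int: "integral_over \<rat> h" unfolding q
      by (intro integral_over_Rats_rpoly algebraic_imp_integral_over_Rats assms)
    have "h \<noteq> 0" using m_inv(2) by simp
    obtain r where "inverse h = rpoly r h"
      by (rule integral_over_Rats_inverse[OF int \<open>h \<noteq> 0\<close>])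
    thus ?case using m_inv(2)
      by (intro exI[of _ "r \<circ>\<^sub>p q"]) (simp add: q of_rat_hom.map_poly_pcompose poly_pcompose)
  next
    case (eng_add x y)
    then obtain q r where "x = rpoly q \<alpha>" "y = rpoly r \<alpha>" by blast
    thus ?case by (intro exI[of _ "q + r"]) (simp add: of_rat_poly_hom.hom_add)
  next
    case (eng_mult x y)
    then obtain q r where "x = rpoly q \<alpha>" "y = rpoly r \<alpha>" by blast
    thus ?case by (intro exI[of _ "q * r"]) (simp add: of_rat_poly_hom.hom_mult)
  qed
  thus ?thesis using that by blast
qed

interpretation number_field: coeff_subring "number_field \<alpha>"
proof
  show "1 \<in> number_field \<alpha>"
    using generate_field.one[of complex_ring "{\<alpha>}"] by (simp add: number_field_def)
  show "x + y \<in> number_field \<alpha>" if "x \<in> number_field \<alpha>" "y \<in> number_field \<alpha>" for x y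
    using generate_field.eng_add[of x complex_ring "{\<alpha>}" y] that by (simp add: number_field_def)
  show "x * y \<in> number_field \<alpha>" if "x \<in> number_field \<alpha>" "y \<in> number_field \<alpha>" for x y
    using generate_field.eng_mult[of x complex_ring "{\<alpha>}" y] that by (simp add: number_field_def)
  show "- x \<in> number_field \<alpha>" if "x \<in> number_field \<alpha>" for x
    using generate_field.a_inv[of x complex_ring "{\<alpha>}"] that by (simp add: number_field_def)
qed

lemma number_field_inverse: "x \<in> number_field \<alpha> \<Longrightarrow> inverse x \<in> number_field \<alpha>"
  using generate_field.m_inv[of x complex_ring "{\<alpha>}"]
  by (cases "x = 0") (simp_all add: number_field_def)

lemma number_field_divide:
  "x \<in> number_field \<alpha> \<Longrightarrow> y \<in> number_field \<alpha> \<Longrightarrow> x / y \<in> number_field \<alpha>"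
  by (simp add: divide_inverse number_field_inverse number_field.mult_S)

lemma number_field_generator: "\<alpha> \<in> number_field \<alpha>"
  by (simp add: number_field_def generate_field.incl)

lemma number_field_gchoose: "x \<in> number_field \<alpha> \<Longrightarrow> (x gchoose k) \<in> number_field \<alpha>"
proof -
  assume x: "x \<in> number_field \<alpha>"
  have "(x gchoose k) = (\<Prod>i=0..<k. x - of_nat i) / of_nat (fact k)"
    by (simp add: gbinomial_prod_rev)
  also have "\<dots> \<in> number_field \<alpha>"
    by (intro number_field_divide number_field.prod_S number_field.diff_S number_field.of_nat_S x)
  finally show ?thesis .
qed

lemma number_field_scale:
  assumes "\<delta> > 0" shows "number_field (of_nat \<delta> * \<alpha>) = number_field \<alpha>"
proof -
  have mono: "number_field x \<subseteq> number_field y" if "x \<in> number_field y" for x y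
  proof
    fix z assume "z \<in> number_field x"
    thus "z \<in> number_field y" unfolding number_field_def[of x]
      by (induction rule: generate_field.induct)
        (auto simp: that number_field_inverse intro: number_field.add_S number_field.mult_S number_field.minus_S)
  qed
  have "number_field (of_nat \<delta> * \<alpha>) \<subseteq> number_field \<alpha>"
    by (rule mono) (intro number_field.mult_S number_field.of_nat_S number_field_generator)
  moreover have "of_nat \<delta> * \<alpha> / of_nat \<delta> \<in> number_field (of_nat \<delta> * \<alpha>)"
    by (intro number_field_divide number_field.of_nat_S number_field_generator)
  hence "\<alpha> \<in> number_field (of_nat \<delta> * \<alpha>)" using assms by simp
  hence "number_field \<alpha> \<subseteq> number_field (of_nat \<delta> * \<alpha>)" by (rule mono)
  ultimately show ?thesis by (rule equalityI)
qed

lemma ring_of_integers_in_int_valued_image: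
  assumes "algebraic \<alpha>" shows "ring_of_integers \<alpha> \<subseteq> int_valued_image \<alpha>"
proof
  fix x assume x: "x \<in> ring_of_integers \<alpha>"
  then obtain q where q: "x = rpoly q \<alpha>"
    using number_field_repr[OF assms] by (auto simp: ring_of_integers_def)
  obtain D H where D: "D > 0" "Polynomial.smult (of_nat D) q = map_poly of_int H"
    by (rule rat_poly_clear_denominators)
  have "of_nat D * x = poly (map_poly of_int H) \<alpha>"
    unfolding q by (rule rpoly_clear_denominators[OF D])
  moreover have "algebraic_int x" using x unfolding ring_of_integers_def by blast
  ultimately show "x \<in> int_valued_image \<alpha>"
    by (intro integral_in_int_valued_image[OF _ D(1)])
qed

interpretation integers_adjoin: coeff_subring "integers_adjoin \<alpha> T"
proof
  let ?G = "ring_of_integers \<alpha> \<union> T"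
  show "1 \<in> integers_adjoin \<alpha> T"
    using generate_ring.one[of complex_ring ?G] by (simp add: integers_adjoin_def)
  show "x + y \<in> integers_adjoin \<alpha> T" if "x \<in> integers_adjoin \<alpha> T" "y \<in> integers_adjoin \<alpha> T" for x y
    using generate_ring.eng_add[of x complex_ring ?G y] that by (simp add: integers_adjoin_def)
  show "x * y \<in> integers_adjoin \<alpha> T" if "x \<in> integers_adjoin \<alpha> T" "y \<in> integers_adjoin \<alpha> T" for x y
    using generate_ring.eng_mult[of x complex_ring ?G y] that by (simp add: integers_adjoin_def)
  show "- x \<in> integers_adjoin \<alpha> T" if "x \<in> integers_adjoin \<alpha> T" for x
    using generate_ring.a_inv[of x complex_ring ?G] that by (simp add: integers_adjoin_def)
qed

lemma integers_adjoin_incl: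
  "x \<in> ring_of_integers \<alpha> \<Longrightarrow> x \<in> integers_adjoin \<alpha> T" "x \<in> T \<Longrightarrow> x \<in> integers_adjoin \<alpha> T"
  by (auto simp: integers_adjoin_def intro: generate_ring.incl)

lemma integers_adjoin_minimal:
  assumes "coeff_subring S" "ring_of_integers \<alpha> \<subseteq> S" "T \<subseteq> S"
  shows "integers_adjoin \<alpha> T \<subseteq> S"
proof
  interpret coeff_subring S by fact
  fix x assume "x \<in> integers_adjoin \<alpha> T"
  thus "x \<in> S" unfolding integers_adjoin_def
  proof (induction rule: generate_ring.induct)
    case (incl h)
    thus ?case using assms(2,3) by blast
  qed (simp_all add: add_S mult_S minus_S)
qed

text \<open>The leading coefficient of an integer equation, with its sign adjusted, is a witness for
  the \<open>LEAST\<close>: it is the Horner sum for \<open>k = degree f\<close>.\<close>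

lemma alg_denominator:
  assumes "algebraic \<alpha>"
  shows "alg_denominator \<alpha> > 0" "algebraic_int (integral_part \<alpha>)"
proof -
  obtain f where f: "f \<noteq> 0" "poly (map_poly of_int f) \<alpha> = 0" using assms by (auto elim: algebraicE')
  have d: "degree f > 0"
  proof (rule Nat.gr0I)
    assume "degree f = 0"
    then obtain a where "f = [:a:]" by (auto elim: degree_eq_zeroE)
    thus False using f by simp
  qed
  have "integral_over \<int> (of_int (lead_coeff f) * \<alpha>)"
    using Ints_subring.integral_over_horner(2)[of "map_poly of_int f" \<alpha> "degree f"] f(2) d by simp
  hence "algebraic_int (of_int (sgn (lead_coeff f)) * (of_int (lead_coeff f) * \<alpha>))"
    unfolding algebraic_int_iff_integral_over
    by (rule Ints_subring.integral_over_mult[OF Ints_subring.integral_over_of_int])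
  moreover have "sgn (lead_coeff f) * lead_coeff f = int (nat \<bar>lead_coeff f\<bar>)"
    by (simp add: sgn_if)
  hence "(of_int (sgn (lead_coeff f)) * of_int (lead_coeff f) :: complex) = of_nat (nat \<bar>lead_coeff f\<bar>)"
    by (metis of_int_mult of_int_of_nat_eq)
  ultimately have "nat \<bar>lead_coeff f\<bar> > 0 \<and> algebraic_int (of_nat (nat \<bar>lead_coeff f\<bar>) * \<alpha>)"
    using f(1) by (simp add: mult.assoc[symmetric])
  from LeastI[where P = "\<lambda>d. d > 0 \<and> algebraic_int (of_nat d * \<alpha>)", OF this]
  show "alg_denominator \<alpha> > 0" "algebraic_int (integral_part \<alpha>)"
    by (simp_all add: alg_denominator_def integral_part_def)
qed

lemma integral_part_algebraic_int: "algebraic_int \<alpha> \<Longrightarrow> integral_part \<alpha> = \<alpha>"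
proof -
  assume "algebraic_int \<alpha>"
  hence "alg_denominator \<alpha> = 1" unfolding alg_denominator_def by (intro Least_equality) auto
  thus ?thesis by (simp add: integral_part_def)
qed

section \<open>From local to global\<close>

text \<open>What the \<open>p\<close>-adic analysis has to provide about \<open>a = \<alpha>\<^sub>p\<close> of an algebraic integer \<open>\<beta>\<close>.\<close>

definition local_property :: "nat \<Rightarrow> bool" where
  "local_property p \<longleftrightarrow> (\<forall>\<beta> r. algebraic_int \<beta> \<longrightarrow> admissible_choice p \<beta> r \<longrightarrow>
     alpha_p p \<beta> r \<noteq> 0 \<and> alpha_p p \<beta> r \<in> int_valued_image \<beta> \<and>
     (\<exists>D. \<not> p dvd D \<and> algebraic_int (of_nat D * inverse (alpha_p p \<beta> r))) \<and>
     (\<forall>\<delta> k c. \<delta> > 0 \<longrightarrow> c \<in> number_field \<beta> \<longrightarrow> algebraic_int c \<longrightarrow> algebraic_int (c * (\<beta> / of_nat \<delta>)) \<longrightarrow>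
       (\<exists>M N D. \<not> p dvd D \<and>
         algebraic_int (of_nat D * ((\<beta> / of_nat \<delta> gchoose k) * c ^ N * inverse (alpha_p p \<beta> r) ^ M)))))"

definition localized :: "nat \<Rightarrow> 'a::field_char_0 set \<Rightarrow> 'a set" where
  "localized p S = {x. \<exists>D. \<not> p dvd D \<and> of_nat D * x \<in> S}"

lemma subset_localized: "prime p \<Longrightarrow> x \<in> S \<Longrightarrow> x \<in> localized p S"
  unfolding localized_def by (intro CollectI exI[of _ 1]) (auto simp: not_prime_unit)

lemma coeff_subring_localized:
  fixes S :: "'a::field_char_0 set"
  assumes p: "prime p" and "coeff_subring S"
  shows "coeff_subring (localized p S)"
proof -
  interpret coeff_subring S by fact
  have pd: "\<not> p dvd D * E" if "\<not> p dvd D" "\<not> p dvd E" for D E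
    using that p by (simp add: prime_dvd_mult_iff)
  show ?thesis
  proof
    show "1 \<in> localized p S" using p by (auto intro: subset_localized)
    fix x y assume "x \<in> localized p S" "y \<in> localized p S"
    then obtain D E where *: "\<not> p dvd D" "of_nat D * x \<in> S" "\<not> p dvd E" "of_nat E * y \<in> S"
      unfolding localized_def by blast
    have "of_nat (D * E) * (x + y) = of_nat E * (of_nat D * x) + of_nat D * (of_nat E * y)"
      by (simp add: algebra_simps)
    also have "\<dots> \<in> S" by (intro add_S mult_S[OF of_nat_S] *)
    finally show "x + y \<in> localized p S" unfolding localized_def using pd * by blast
    have "of_nat (D * E) * (x * y) = (of_nat D * x) * (of_nat E * y)" by (simp add: algebra_simps)
    also have "\<dots> \<in> S" by (intro mult_S *)
    finally show "x * y \<in> localized p S" unfolding localized_def using pd * by blast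
    have "of_nat D * (- x) \<in> S" using minus_S[OF *(2)] by simp
    thus "- x \<in> localized p S" unfolding localized_def using * by blast
  qed
qed

lemma localized_cancel:
  fixes S :: "'a::field_char_0 set"
  assumes "coeff_subring S" "prime p" "\<not> int p dvd z" "of_int z * x \<in> localized p S"
  shows "x \<in> localized p S"
proof -
  interpret coeff_subring S by fact
  obtain D where D: "\<not> p dvd D" "of_nat D * (of_int z * x) \<in> S" using assms unfolding localized_def by blast
  have "of_int (sgn z) * (of_nat D * (of_int z * x)) \<in> S" by (intro mult_S of_int_S D)
  also have "of_int (sgn z) * (of_nat D * (of_int z * x)) = of_nat D * (of_int (sgn z * z) * x)"
    by (simp add: mult_ac)
  also have "sgn z * z = int (nat \<bar>z\<bar>)" by (simp add: sgn_if)
  finally have "of_nat (D * nat \<bar>z\<bar>) * x \<in> S" by (simp add: mult.assoc)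
  moreover have "\<not> p dvd nat \<bar>z\<bar>" using assms(3) by (simp flip: int_dvd_int_iff)
  hence "\<not> p dvd D * nat \<bar>z\<bar>" using D assms(2) by (simp add: prime_dvd_mult_iff)
  ultimately show ?thesis unfolding localized_def by blast
qed

text \<open>Dividing by the content leaves a coefficient that survives modulo \<open>p\<close>;
  \<open>k\<close> is the last such index. The Horner sum of \<open>f\<close> starting at
  \<open>k\<close> is then congruent modulo \<open>p\<close> to the integer
  \<open>coeff f k\<close>.\<close>

lemma primitive_annihilator:
  assumes "algebraic (\<alpha> :: complex)" "prime p"
  obtains f :: "int poly" and k where "poly (map_poly of_int f) \<alpha> = 0" "degree f > 0" "k \<le> degree f"
    "\<not> int p dvd coeff f k" "\<And>j. j > k \<Longrightarrow> int p dvd coeff f j"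
proof -
  obtain f0 where f0: "f0 \<noteq> 0" "poly (map_poly of_int f0) \<alpha> = 0" using assms by (auto elim: algebraicE')
  define f where "f = primitive_part f0"
  have f0f: "f0 = Polynomial.smult (content f0) f" by (simp add: f_def)
  have root: "poly (map_poly of_int f) \<alpha> = 0"
    using f0 by (subst (asm) f0f) (simp add: of_int_hom.map_poly_hom_smult)
  have cf: "content f = 1" using f0(1) by (simp add: f_def)
  hence "f \<noteq> 0" by auto
  have "degree f > 0"
  proof (rule Nat.gr0I)
    assume "degree f = 0"
    then obtain a where "f = [:a:]" by (auto elim: degree_eq_zeroE)
    thus False using \<open>f \<noteq> 0\<close> root by simp
  qed
  have "\<exists>k. \<not> int p dvd coeff f k"
  proof (rule ccontr)
    assume "\<not> ?thesis"
    hence "[:int p:] dvd f" by (simp add: const_poly_dvd_iff)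
    hence "int p dvd content f" by (simp add: const_poly_dvd_iff_dvd_content)
    thus False using assms(2) cf by (simp add: not_prime_unit)
  qed
  moreover have fin: "finite {k. \<not> int p dvd coeff f k}"
    by (rule finite_subset[of _ "{..degree f}"]) (auto intro: le_degree)
  ultimately have ne: "{k. \<not> int p dvd coeff f k} \<noteq> {}" by blast
  define k where "k = Max {k. \<not> int p dvd coeff f k}"
  have k: "\<not> int p dvd coeff f k" using Max_in[OF fin ne] by (simp add: k_def)
  moreover have "int p dvd coeff f j" if "j > k" for j
    using Max_ge[OF fin, of j] that by (force simp: k_def)
  moreover have "k \<le> degree f" using k by (intro le_degree) auto
  ultimately show ?thesis using that root \<open>degree f > 0\<close> by blast
qed

text \<open>The local property makes \<open>x * c ^ N * inverse a ^ M\<close> integral at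
  \<open>p\<close>. The power of \<open>c\<close> can be removed because \<open>c\<close> differs
  from the integer \<open>coeff f l\<close>, prime to \<open>p\<close>, by \<open>p * \<eta>\<close>
  with \<eta> in the ring; the power of \<open>inverse a\<close> is removed by multiplying with
  \<open>a ^ M\<close>.\<close>

lemma gchoose_locally_in_integers_adjoin:
  fixes \<alpha> :: complex
  assumes p: "prime p" and loc: "local_property p" and alg: "algebraic \<alpha>"
    and r: "admissible_choice p (integral_part \<alpha>) r"
    and T: "\<alpha> \<in> T" "alpha_p p (integral_part \<alpha>) r \<in> T"
  shows "(\<alpha> gchoose k) \<in> localized p (integers_adjoin \<alpha> T)"
proof -
  define \<beta> where "\<beta> = integral_part \<alpha>"
  define \<delta> where "\<delta> = alg_denominator \<alpha>"
  define a where "a = alpha_p p \<beta> r"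
  define x where "x = (\<alpha> gchoose k)"
  define A where "A = integers_adjoin \<alpha> T"
  define Ap where "Ap = localized p A"
  have \<delta>: "\<delta> > 0" and \<beta>: "algebraic_int \<beta>" using alg_denominator[OF alg] by (auto simp: \<beta>_def \<delta>_def)
  have \<beta>\<alpha>: "\<beta> = of_nat \<delta> * \<alpha>" by (simp add: \<beta>_def \<delta>_def integral_part_def)
  hence \<alpha>\<beta>: "\<beta> / of_nat \<delta> = \<alpha>" using \<delta> by simp
  have nf: "number_field \<beta> = number_field \<alpha>" using number_field_scale[OF \<delta>] by (simp add: \<beta>\<alpha>)
  interpret A: coeff_subring A unfolding A_def by (rule integers_adjoin.coeff_subring_axioms)
  interpret Ap: coeff_subring Ap unfolding Ap_def
    by (intro coeff_subring_localized p A.coeff_subring_axioms)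
  have A_Ap: "y \<in> A \<Longrightarrow> y \<in> Ap" for y unfolding Ap_def by (rule subset_localized[OF p])
  have int_A: "y \<in> A" if "y \<in> number_field \<alpha>" "algebraic_int y" for y
    unfolding A_def by (rule integers_adjoin_incl(1)) (use that in \<open>auto simp: ring_of_integers_def\<close>)
  have int_Ap: "y \<in> Ap" if "y \<in> number_field \<alpha>" "\<not> p dvd D" "algebraic_int (of_nat D * y)" for y D
    unfolding Ap_def localized_def
    by (intro CollectI exI[of _ D] conjI int_A number_field.mult_S number_field.of_nat_S that)
  have \<alpha>A: "\<alpha> \<in> A" and aA: "a \<in> A" using T by (auto simp: A_def a_def \<beta>_def integers_adjoin_incl)
  have a: "a \<noteq> 0" "\<exists>D. \<not> p dvd D \<and> algebraic_int (of_nat D * inverse a)"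
    and step: "\<And>c. c \<in> number_field \<alpha> \<Longrightarrow> algebraic_int c \<Longrightarrow> algebraic_int (c * \<alpha>) \<Longrightarrow>
       (\<exists>M N D. \<not> p dvd D \<and> algebraic_int (of_nat D * (x * c ^ N * inverse a ^ M)))"
  proof -
    have r': "admissible_choice p \<beta> r" using r by (simp add: \<beta>_def)
    note l = loc[unfolded local_property_def, rule_format, OF \<beta> r', folded a_def]
    show "a \<noteq> 0" using conjunct1[OF l] .
    show "\<exists>D. \<not> p dvd D \<and> algebraic_int (of_nat D * inverse a)"
      using conjunct1[OF conjunct2[OF conjunct2[OF l]]] .
    fix c assume "c \<in> number_field \<alpha>" "algebraic_int c" "algebraic_int (c * \<alpha>)"
    thus "\<exists>M N D. \<not> p dvd D \<and> algebraic_int (of_nat D * (x * c ^ N * inverse a ^ M))"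
      using conjunct2[OF conjunct2[OF conjunct2[OF l]], rule_format, OF \<delta>, of c k]
      unfolding \<alpha>\<beta> nf x_def by simp
  qed
  have a_nf: "a \<in> number_field \<alpha>"
    unfolding a_def alpha_p_def nf[symmetric]
    by (intro number_field_divide number_field.prod_S number_field.diff_S number_field.of_int_S
        number_field.power_S number_field.of_nat_S number_field_generator)
  have x_nf: "x \<in> number_field \<alpha>" unfolding x_def by (intro number_field_gchoose number_field_generator)
  have b_Ap: "inverse a \<in> Ap" using a(2) int_Ap number_field_inverse[OF a_nf] by blast
  obtain f l where f: "poly (map_poly of_int f) \<alpha> = 0" "degree f > 0" "l \<le> degree f"
    "\<not> int p dvd coeff f l" "\<And>j. j > l \<Longrightarrow> int p dvd coeff f j"
    using primitive_annihilator[OF alg p] by blast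
  define n where "n = degree f"
  define c where "c = (\<Sum>j=l..n. of_int (coeff f j) * \<alpha> ^ (j - l))"
  have c_int: "algebraic_int c" "algebraic_int (c * \<alpha>)"
    using Ints_subring.integral_over_horner[of "map_poly of_int f" \<alpha> l] f
    by (auto simp: c_def n_def algebraic_int_iff_integral_over)
  have c_nf: "c \<in> number_field \<alpha>" unfolding c_def
    by (intro number_field.sum_S number_field.mult_S number_field.of_int_S number_field.power_S
        number_field_generator)
  obtain M N D where MND: "\<not> p dvd D" "algebraic_int (of_nat D * (x * c ^ N * inverse a ^ M))"
    using step[OF c_nf c_int] by blast
  define y where "y = x * c ^ N * inverse a ^ M"
  have y_Ap: "y \<in> Ap"
    by (rule int_Ap[OF _ MND(1)])
      (use MND(2) in \<open>auto simp: y_def intro!: number_field.mult_S number_field.power_S number_field_inverse x_nf c_nf a_nf\<close>)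
  define \<eta> where "\<eta> = (\<Sum>j=Suc l..n. of_int (coeff f j div int p) * \<alpha> ^ (j - l))"
  have \<eta>A: "\<eta> \<in> A" unfolding \<eta>_def by (intro A.sum_S A.mult_S A.of_int_S A.power_S \<alpha>A)
  have "c = of_int (coeff f l) + (\<Sum>j=Suc l..n. of_int (coeff f j) * \<alpha> ^ (j - l))"
    unfolding c_def using f(3) by (subst sum.atLeast_Suc_atMost) (auto simp: n_def)
  also have "(\<Sum>j=Suc l..n. of_int (coeff f j) * \<alpha> ^ (j - l)) = of_nat p * \<eta>"
    unfolding \<eta>_def sum_distrib_left
  proof (intro sum.cong refl)
    fix j assume "j \<in> {Suc l..n}"
    hence "int p * (coeff f j div int p) = coeff f j" using f(5)[of j] by simp
    hence "(of_int (coeff f j) :: complex) = of_nat p * of_int (coeff f j div int p)"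
      by (metis of_int_mult of_int_of_nat_eq)
    thus "of_int (coeff f j) * \<alpha> ^ (j - l) = of_nat p * (of_int (coeff f j div int p) * \<alpha> ^ (j - l))"
      by simp
  qed
  finally have c_eq: "of_int (coeff f l) = c + - (of_nat p * \<eta>)" by simp
  \<comment> \<open>\<open>p ^ s\<close> is the exact power of \<open>p\<close> in k!, so that it
    alone clears the denominator of \<open>x\<close> in the localization.\<close>
  obtain s u where su: "fact k = p ^ s * u" "\<not> p dvd u"
    using multiplicity_decompose'[of "fact k" p] p by (metis fact_nonzero not_prime_unit)
  have factx: "fact k * x \<in> A"
    unfolding x_def gbinomial_mult_fact by (intro A.prod_S A.diff_S A.of_nat_S \<alpha>A)
  have psx: "of_nat p ^ s * x \<in> Ap"
    unfolding Ap_def localized_def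
  proof (intro CollectI exI conjI)
    show "\<not> p dvd u" by fact
    have "(fact k :: complex) = of_nat p ^ s * of_nat u"
      using arg_cong[OF su(1), of "of_nat :: nat \<Rightarrow> complex"] by simp
    thus "of_nat u * (of_nat p ^ s * x) \<in> A" using factx by (simp add: mult_ac)
  qed
  \<comment> \<open>In the expansion of (c - p \<eta>)^L every term has either at least
    \<open>N\<close> factors \<open>c\<close>, which turn \<open>x * inverse a ^ M\<close> into a
    multiple of \<open>y\<close>, or more than \<open>s\<close> factors \<open>p\<close>, which
    clear the denominator of \<open>x\<close>.\<close>
  define L where "L = N + s"
  have "of_int (coeff f l) ^ L * (x * inverse a ^ M) \<in> Ap"
  proof -
    have "of_int (coeff f l) ^ L * (x * inverse a ^ M) =
        (\<Sum>i\<le>L. of_nat (L choose i) * (c ^ i * (- (of_nat p * \<eta>)) ^ (L - i) * (x * inverse a ^ M)))"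
      unfolding c_eq binomial_ring by (simp add: sum_distrib_right mult.assoc)
    also have "\<dots> \<in> Ap"
    proof (intro Ap.sum_S Ap.mult_S[OF Ap.of_nat_S])
      fix i assume i: "i \<in> {..L}"
      show "c ^ i * (- (of_nat p * \<eta>)) ^ (L - i) * (x * inverse a ^ M) \<in> Ap"
      proof (cases "i \<ge> N")
        case True
        hence "c ^ i = c ^ (i - N) * c ^ N" by (simp flip: power_add)
        hence "c ^ i * (- (of_nat p * \<eta>)) ^ (L - i) * (x * inverse a ^ M) =
            c ^ (i - N) * (- (of_nat p * \<eta>)) ^ (L - i) * y" by (simp add: y_def mult_ac)
        also have "\<dots> \<in> Ap"
          by (intro Ap.mult_S y_Ap Ap.power_S Ap.minus_S Ap.of_nat_S A_Ap[OF \<eta>A] A_Ap[OF int_A[OF c_nf c_int(1)]])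
        finally show ?thesis .
      next
        case False
        define j where "j = L - i - s"
        have "L - i = s + j" using False by (simp add: j_def L_def)
        moreover have "(- (of_nat p * \<eta>)) ^ s = of_nat p ^ s * (- \<eta>) ^ s"
          using power_mult_distrib[of "of_nat p" "- \<eta>" s] by simp
        ultimately have "c ^ i * (- (of_nat p * \<eta>)) ^ (L - i) * (x * inverse a ^ M) =
            c ^ i * (- \<eta>) ^ s * (- (of_nat p * \<eta>)) ^ j * inverse a ^ M * (of_nat p ^ s * x)"
          by (simp only: power_add mult_ac)
        also have "\<dots> \<in> Ap"
          by (intro Ap.mult_S psx Ap.power_S b_Ap Ap.minus_S Ap.of_nat_S A_Ap[OF \<eta>A] A_Ap[OF int_A[OF c_nf c_int(1)]])
        finally show ?thesis .
      qed
    qed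
    finally show ?thesis .
  qed
  hence "of_int (coeff f l) ^ L * (x * inverse a ^ M) * a ^ M \<in> Ap"
    by (intro Ap.mult_S[of _ "a ^ M"] Ap.power_S A_Ap[OF aA])
  also have "of_int (coeff f l) ^ L * (x * inverse a ^ M) * a ^ M = of_int (coeff f l ^ L) * x"
    using a(1) by (simp add: power_inverse)
  finally have "of_int (coeff f l ^ L) * x \<in> localized p A" by (simp only: Ap_def)
  moreover have "\<not> int p dvd coeff f l ^ L" using f(4) p prime_dvd_power by (metis prime_nat_int_transfer)
  ultimately show ?thesis unfolding x_def A_def
    by (rule localized_cancel[OF integers_adjoin.coeff_subring_axioms p, rotated])
qed

text \<open>Since k! clears the denominator of (\<alpha> choose k), membership can be tested at one
  prime at a time by \<open>mem_of_local\<close>.\<close>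

lemma binomial_semiring_eq_integers_adjoin:
  fixes \<alpha> :: complex
  assumes loc: "\<And>p. prime p \<Longrightarrow> local_property p"
    and alg: "algebraic \<alpha>" and nat: "\<alpha> \<notin> \<nat>"
    and r: "\<And>p. prime p \<Longrightarrow> admissible_choice p (integral_part \<alpha>) (r p)"
  shows "binomial_semiring \<alpha> =
    integers_adjoin \<alpha> ({\<alpha>} \<union> {alpha_p p (integral_part \<alpha>) (r p) | p. prime p})"
    (is "_ = integers_adjoin \<alpha> ?T")
proof -
  interpret R: coeff_subring "int_valued_image \<alpha>" by (rule coeff_subring_int_valued_image)
  have \<alpha>R: "\<alpha> \<in> int_valued_image \<alpha>" using gchoose_in_int_valued_image[of \<alpha> 1] by simp
  have "integers_adjoin \<alpha> ?T \<subseteq> int_valued_image \<alpha>"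
  proof (rule integers_adjoin_minimal[OF R.coeff_subring_axioms ring_of_integers_in_int_valued_image[OF alg]])
    show "?T \<subseteq> int_valued_image \<alpha>"
    proof
      fix x assume "x \<in> ?T"
      then consider "x = \<alpha>" | p where "prime p" "x = alpha_p p (integral_part \<alpha>) (r p)" by blast
      thus "x \<in> int_valued_image \<alpha>"
      proof cases
        case 2
        hence "x \<in> int_valued_image (integral_part \<alpha>)"
          using loc[unfolded local_property_def] alg_denominator(2)[OF alg] r by blast
        thus ?thesis using int_valued_image_scale unfolding integral_part_def by blast
      qed (use \<alpha>R in simp)
    qed
  qed
  moreover have "binomial_semiring \<alpha> \<subseteq> integers_adjoin \<alpha> ?T"
  proof
    have g: "(\<alpha> gchoose k) \<in> integers_adjoin \<alpha> ?T" for k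
    proof (rule integers_adjoin.mem_of_local[of "fact k"])
      have "fact k * (\<alpha> gchoose k) \<in> integers_adjoin \<alpha> ?T"
        unfolding gbinomial_mult_fact
        by (intro integers_adjoin.prod_S integers_adjoin.diff_S integers_adjoin.of_nat_S integers_adjoin_incl(2)) simp
      thus "of_nat (fact k) * (\<alpha> gchoose k) \<in> integers_adjoin \<alpha> ?T" by simp
      fix p assume "prime (p :: nat)"
      hence "(\<alpha> gchoose k) \<in> localized p (integers_adjoin \<alpha> ?T)"
        by (intro gchoose_locally_in_integers_adjoin[OF _ loc alg r]) auto
      thus "\<exists>D. \<not> p dvd D \<and> of_nat D * (\<alpha> gchoose k) \<in> integers_adjoin \<alpha> ?T"
        by (simp add: localized_def)
    qed simp
    fix x assume "x \<in> binomial_semiring \<alpha>"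
    then obtain n and b :: "nat \<Rightarrow> nat" where "x = (\<Sum>k\<le>n. of_nat (b k) * (\<alpha> gchoose k))"
      unfolding binomial_semiring_def by blast
    moreover have "(\<Sum>k\<le>n. of_nat (b k) * (\<alpha> gchoose k)) \<in> integers_adjoin \<alpha> ?T"
      by (intro integers_adjoin.sum_S integers_adjoin.mult_S integers_adjoin.of_nat_S g)
    ultimately show "x \<in> integers_adjoin \<alpha> ?T" by (simp only:)
  qed
  ultimately show ?thesis using binomial_semiring_eq_int_valued_image[OF alg nat] by auto
qed

text \<open>For an algebraic integer the integral part is \<alpha> itself, and \<alpha> already
  belongs to the ring of integers, so adjoining it changes nothing.\<close>

lemma main_of_local:
  fixes \<alpha> :: complex
  assumes loc: "\<And>p. prime p \<Longrightarrow> local_property p"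
    and alg: "algebraic \<alpha>" and nat: "\<alpha> \<notin> \<nat>"
  shows "(\<forall>r :: nat \<Rightarrow> padic \<Rightarrow> int.
            (\<forall>p. prime p \<longrightarrow> admissible_choice p (integral_part \<alpha>) (r p)) \<longrightarrow>
            binomial_semiring \<alpha> =
              integers_adjoin \<alpha> ({\<alpha>} \<union> {alpha_p p (integral_part \<alpha>) (r p) | p. prime p})) \<and>
         (algebraic_int \<alpha> \<longrightarrow>
          (\<forall>r :: nat \<Rightarrow> padic \<Rightarrow> int.
            (\<forall>p. prime p \<longrightarrow> admissible_choice p \<alpha> (r p)) \<longrightarrow>
            binomial_semiring \<alpha> = integers_adjoin \<alpha> {alpha_p p \<alpha> (r p) | p. prime p}))"
proof (intro conjI allI impI)
  fix r :: "nat \<Rightarrow> padic \<Rightarrow> int"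
  assume "\<forall>p. prime p \<longrightarrow> admissible_choice p (integral_part \<alpha>) (r p)"
  thus "binomial_semiring \<alpha> =
      integers_adjoin \<alpha> ({\<alpha>} \<union> {alpha_p p (integral_part \<alpha>) (r p) | p. prime p})"
    by (intro binomial_semiring_eq_integers_adjoin loc alg nat) auto
next
  fix r :: "nat \<Rightarrow> padic \<Rightarrow> int"
  assume int: "algebraic_int \<alpha>" and r: "\<forall>p. prime p \<longrightarrow> admissible_choice p \<alpha> (r p)"
  have "\<alpha> \<in> ring_of_integers \<alpha>" using int by (simp add: ring_of_integers_def number_field_generator)
  hence "ring_of_integers \<alpha> \<union> ({\<alpha>} \<union> U) = ring_of_integers \<alpha> \<union> U" for U by blast
  hence eq: "integers_adjoin \<alpha> ({\<alpha>} \<union> U) = integers_adjoin \<alpha> U" for U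
    by (simp add: integers_adjoin_def)
  have "admissible_choice p (integral_part \<alpha>) (r p)" if "prime p" for p
    unfolding integral_part_algebraic_int[OF int] using r that by blast
  from binomial_semiring_eq_integers_adjoin[OF loc alg nat this]
  show "binomial_semiring \<alpha> = integers_adjoin \<alpha> {alpha_p p \<alpha> (r p) | p. prime p}"
    unfolding integral_part_algebraic_int[OF int] eq .
qed

section \<open>Irreducible polynomials over a field\<close>

text \<open>A nonzero element of least degree in the ideal generated by \<open>f\<close> and
  \<open>g\<close> divides both, and by irreducibility of \<open>f\<close> it can only be a
  unit.\<close>

lemma irreducible_bezout:
  fixes f g :: "'a::field poly"
  assumes irr: "Factorial_Ring.irreducible f" and nd: "\<not> f dvd g"
  obtains a b where "a * f + b * g = 1"
proof -
  define P where "P h \<longleftrightarrow> h \<noteq> 0 \<and> (\<exists>a b. h = a * f + b * g)" for h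
  have f: "f \<noteq> 0" using irr by auto
  have "P f" unfolding P_def using f by (intro conjI exI[of _ 1] exI[of _ 0]) auto
  then obtain h where h: "P h" "\<And>h'. P h' \<Longrightarrow> degree h \<le> degree h'"
    using ex_has_least_nat[of P f degree] by auto
  obtain a b where ab: "h = a * f + b * g" using h(1) unfolding P_def by blast
  have dvd: "h dvd u" if u: "u = c * f + d * g" for u c d
  proof -
    have "u mod h = u - (u div h) * h" by (simp add: minus_div_mult_eq_mod)
    also have "\<dots> = (c - (u div h) * a) * f + (d - (u div h) * b) * g"
      unfolding u ab by (simp add: algebra_simps)
    finally have "u mod h = 0 \<or> P (u mod h)" unfolding P_def by blast
    moreover have "\<not> degree h \<le> degree (u mod h)" if "u mod h \<noteq> 0"
      using degree_mod_less[of h u] h(1) that by (auto simp: P_def)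
    ultimately show ?thesis using h(2) by (auto simp: dvd_eq_mod_eq_0)
  qed
  have hf: "h dvd f" using dvd[of f 1 0] by simp
  have hg: "h dvd g" using dvd[of g 0 1] by simp
  obtain u where u: "f = h * u" using hf by blast
  have "h dvd 1 \<or> u dvd 1" using irr u by (rule irreducibleD)
  moreover have "\<not> u dvd 1"
  proof
    assume "u dvd 1"
    then obtain w where "1 = u * w" by blast
    hence "h = f * w" using u by (simp add: mult.assoc)
    thus False using hg nd by (meson dvd_trans dvd_triv_left)
  qed
  ultimately obtain w where "1 = h * w" by blast
  hence "(w * a) * f + (w * b) * g = 1" unfolding ab by (simp add: algebra_simps)
  thus ?thesis by (rule that)
qed

text \<open>Otherwise a Bezout relation evaluated at the common root would give 1 = 0. The root may
  lie in an extension field, embedded by \<open>h\<close>.\<close>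

lemma irreducible_dvd_of_common_root:
  fixes f g :: "'a::field poly" and h :: "'a \<Rightarrow> 'b::field"
  assumes "field_hom h" "Factorial_Ring.irreducible f"
    "poly (map_poly h f) x = 0" "poly (map_poly h g) x = 0"
  shows "f dvd g"
proof (rule ccontr)
  interpret field_hom h by fact
  interpret map: map_poly_comm_ring_hom h ..
  assume "\<not> f dvd g"
  then obtain a b where ab: "a * f + b * g = 1" using irreducible_bezout[OF assms(2)] by blast
  have "poly (map_poly h (a * f + b * g)) x = 0" 
    unfolding map.hom_add map.hom_mult using assms(3,4) by simp
  thus False unfolding ab by simp
qed

lemma irreducible_poly_iff_degree:
  fixes f :: "'a::field poly"
  shows "Factorial_Ring.irreducible f \<longleftrightarrow> degree f > 0 \<and> (\<forall>g h. f = g * h \<longrightarrow> degree g = 0 \<or> degree h = 0)"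
proof
  assume irr: "Factorial_Ring.irreducible f"
  hence "f \<noteq> 0" "\<not> f dvd 1" by auto
  hence "degree f > 0" by (metis is_unit_iff_degree neq0_conv)
  moreover have "degree g = 0 \<or> degree h = 0" if "f = g * h" for g h
    using irreducibleD[OF irr that] by (auto simp: poly_dvd_1)
  ultimately show "degree f > 0 \<and> (\<forall>g h. f = g * h \<longrightarrow> degree g = 0 \<or> degree h = 0)" by blast
next
  assume f: "degree f > 0 \<and> (\<forall>g h. f = g * h \<longrightarrow> degree g = 0 \<or> degree h = 0)"
  hence f0: "f \<noteq> 0" by auto
  show "Factorial_Ring.irreducible f"
  proof (rule irreducibleI)
    show "f \<noteq> 0" by fact
    show "\<not> f dvd 1" using f f0 by (simp add: is_unit_iff_degree)
    fix a b assume "f = a * b"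
    moreover from this have "a \<noteq> 0" "b \<noteq> 0" using f0 by auto
    ultimately show "a dvd 1 \<or> b dvd 1" using f by (auto simp: is_unit_iff_degree)
  qed
qed

lemma irreducible_smult:
  fixes f :: "'a::field poly"
  assumes "Factorial_Ring.irreducible f" "c \<noteq> 0"
  shows "Factorial_Ring.irreducible (Polynomial.smult c f)"
  unfolding irreducible_poly_iff_degree
proof (intro conjI allI impI)
  show "degree (Polynomial.smult c f) > 0" using assms by (simp add: irreducible_poly_iff_degree)
  fix g h assume "Polynomial.smult c f = g * h"
  hence "f = Polynomial.smult (inverse c) g * h" using assms(2)
    by (metis field_class.field_inverse mult_smult_left smult_1_left smult_smult)
  hence "degree (Polynomial.smult (inverse c) g) = 0 \<or> degree h = 0"
    by (rule assms(1)[unfolded irreducible_poly_iff_degree, THEN conjunct2, rule_format])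
  thus "degree g = 0 \<or> degree h = 0" using assms(2) by simp
qed

lemma irreducible_pcompose_linear:
  fixes f :: "'a::field poly"
  assumes "Factorial_Ring.irreducible f" "a \<noteq> 0"
  shows "Factorial_Ring.irreducible (f \<circ>\<^sub>p [:b, a:])"
  unfolding irreducible_poly_iff_degree
proof (intro conjI allI impI)
  show "degree (f \<circ>\<^sub>p [:b, a:]) > 0" using assms by (simp add: irreducible_poly_iff_degree degree_pcompose)
  fix g h assume gh: "f \<circ>\<^sub>p [:b, a:] = g * h"
  have "[:b, a:] \<circ>\<^sub>p [:- b / a, 1 / a:] = [:0, 1:]" using assms(2) by (simp add: pcompose_pCons)
  hence "f = (f \<circ>\<^sub>p [:b, a:]) \<circ>\<^sub>p [:- b / a, 1 / a:]"
    by (metis pcompose_assoc pcompose_idR)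
  also have "\<dots> = (g \<circ>\<^sub>p [:- b / a, 1 / a:]) * (h \<circ>\<^sub>p [:- b / a, 1 / a:])" by (simp add: gh pcompose_mult)
  finally have "degree (g \<circ>\<^sub>p [:- b / a, 1 / a:]) = 0 \<or> degree (h \<circ>\<^sub>p [:- b / a, 1 / a:]) = 0"
    using assms by (metis irreducible_poly_iff_degree)
  thus "degree g = 0 \<or> degree h = 0" using assms(2) by (simp add: degree_pcompose)
qed

text \<open>Reversal of coefficients is multiplicative and is an involution when the constant term
  is nonzero. It is used to pass from a root to its inverse.\<close>

lemma irreducible_reflect_poly:
  fixes f :: "'a::field poly"
  assumes "Factorial_Ring.irreducible f" "coeff f 0 \<noteq> 0"
  shows "Factorial_Ring.irreducible (reflect_poly f)"
  unfolding irreducible_poly_iff_degree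
proof (intro conjI allI impI)
  show "degree (reflect_poly f) > 0" using assms by (simp add: irreducible_poly_iff_degree)
  fix g h assume gh: "reflect_poly f = g * h"
  have "lead_coeff f \<noteq> 0" using assms(1) by auto
  hence "coeff (g * h) 0 \<noteq> 0" by (simp flip: gh)
  hence c: "coeff g 0 \<noteq> 0" "coeff h 0 \<noteq> 0" by (auto simp: coeff_mult_0)
  have "f = reflect_poly (g * h)" using assms(2) by (simp flip: gh)
  also have "\<dots> = reflect_poly g * reflect_poly h" by (rule reflect_poly_mult)
  finally have "degree (reflect_poly g) = 0 \<or> degree (reflect_poly h) = 0"
    using assms(1) by (metis irreducible_poly_iff_degree)
  thus "degree g = 0 \<or> degree h = 0" using c by simp
qed

lemma monic_irreducible_factor:
  fixes f :: "'a::field poly"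
  assumes "degree f > 0"
  obtains g where "lead_coeff g = 1" "Factorial_Ring.irreducible g" "g dvd f"
proof -
  define P where "P g \<longleftrightarrow> degree g > 0 \<and> g dvd f" for g
  have "P f" using assms by (simp add: P_def)
  then obtain g where g: "P g" "\<And>h. P h \<Longrightarrow> degree g \<le> degree h"
    using ex_has_least_nat[of P f degree] by auto
  have g0: "g \<noteq> 0" using g(1) by (auto simp: P_def)
  have "Factorial_Ring.irreducible g"
    unfolding irreducible_poly_iff_degree
  proof (intro conjI allI impI)
    show "degree g > 0" using g by (simp add: P_def)
    fix a b assume ab: "g = a * b"
    hence n: "a \<noteq> 0" "b \<noteq> 0" using g0 by auto
    show "degree a = 0 \<or> degree b = 0"
    proof (rule ccontr)
      assume c: "\<not> ?thesis"
      hence "P a" using g(1) by (auto simp: P_def ab dest: dvd_mult_left)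
      hence "degree g \<le> degree a" by (rule g(2))
      thus False using c n by (simp add: ab degree_mult_eq)
    qed
  qed
  hence "Factorial_Ring.irreducible (Polynomial.smult (inverse (lead_coeff g)) g)"
    using g0 by (intro irreducible_smult) auto
  moreover have "Polynomial.smult (inverse (lead_coeff g)) g dvd f"
    using g g0 by (simp add: P_def smult_dvd_iff)
  ultimately show ?thesis
    using that[of "Polynomial.smult (inverse (lead_coeff g)) g"] g0 by simp
qed

text \<open>Induction along a factorization into monic irreducibles. Every factor \<open>g\<close>
  that occurs divides \<open>m\<close>, so a statement about all roots of \<open>m\<close> reduces
  to one irreducible factor at a time.\<close>

lemma monic_factor_induct [consumes 2, case_names one mult]:
  fixes m f :: "'a::field poly"
  assumes "lead_coeff f = 1" "f dvd m"
    and one: "Q 1"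
    and mult: "\<And>g f. lead_coeff g = 1 \<Longrightarrow> Factorial_Ring.irreducible g \<Longrightarrow> g dvd m \<Longrightarrow> Q f \<Longrightarrow> Q (g * f)"
  shows "Q f"
  using assms(1,2)
proof (induction "degree f" arbitrary: f rule: less_induct)
  case less
  show ?case
  proof (cases "degree f = 0")
    case True
    hence "f = 1" using less.prems(1) by (auto elim!: degree_eq_zeroE)
    thus ?thesis using one by simp
  next
    case False
    then obtain g where g: "lead_coeff g = 1" "Factorial_Ring.irreducible g" "g dvd f"
      using monic_irreducible_factor by blast
    then obtain h where h: "f = g * h" by blast
    have lc: "lead_coeff h = 1" using less.prems(1) g(1) by (simp add: h lead_coeff_mult)
    hence "g \<noteq> 0" "h \<noteq> 0" using g by auto
    hence "degree h < degree f" using g(2) by (simp add: h degree_mult_eq irreducible_poly_iff_degree)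
    moreover have "h dvd m" using less.prems(2) by (auto simp: h dest: dvd_mult_right)
    ultimately have "Q h" using less.hyps lc by blast
    thus ?thesis unfolding h using g less.prems(2) by (intro mult) (auto intro: dvd_trans)
  qed
qed

section \<open>Complete discretely valued fields\<close>

text \<open>An axiomatic description of Q_p: \<open>v_of_int\<close> normalizes v(p) = 1, and
  \<open>integers_dense\<close> makes Z dense in the valuation ring. Completeness is asked only for
  sequences whose \<open>n\<close>-th step has valuation at least \<open>n\<close>, the kind
  produced by the iteration in \<open>hensel_factor\<close>.\<close>

locale padic_valued_field =
  fixes p :: nat and v :: "'a::field_char_0 \<Rightarrow> int"
  assumes prime_p: "prime p"
    and v_mult: "x \<noteq> 0 \<Longrightarrow> y \<noteq> 0 \<Longrightarrow> v (x * y) = v x + v y"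
    and v_add: "x \<noteq> 0 \<Longrightarrow> y \<noteq> 0 \<Longrightarrow> x + y \<noteq> 0 \<Longrightarrow> min (v x) (v y) \<le> v (x + y)"
    and v_of_int: "n \<noteq> 0 \<Longrightarrow> v (of_int n) = int (multiplicity (int p) n)"
    and integers_dense: "x = 0 \<or> 0 \<le> v x \<Longrightarrow> \<exists>n::int. x = of_int n \<or> k \<le> v (x - of_int n)"
    and complete: "(\<And>n. s (Suc n) = s n \<or> int n \<le> v (s (Suc n) - s n)) \<Longrightarrow>
      \<exists>l. \<forall>n. l = s n \<or> int n \<le> v (l - s n)"
begin

text \<open>The value \<open>v 0\<close> is arbitrary, so this relation treats 0 as having infinite
  valuation.\<close>

definition vge :: "int \<Rightarrow> 'a \<Rightarrow> bool" where "vge k x \<longleftrightarrow> x = 0 \<or> k \<le> v x"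

lemma p_gt_1: "p > 1" using prime_p by (rule prime_gt_1_nat)

lemma p_pos [simp]: "p > 0" "p \<noteq> 0" using p_gt_1 by simp_all

lemma v_1 [simp]: "v 1 = 0" using v_mult[of 1 1] by simp

lemma v_minus [simp]: "v (- x) = v x"
proof -
  have "v (-1) + v (-1) = 0" using v_mult[of "-1" "-1"] by simp
  thus ?thesis using v_mult[of "-1" x] by (cases "x = 0") auto
qed

lemma v_power: "x \<noteq> 0 \<Longrightarrow> v (x ^ n) = int n * v x"
  by (induction n) (auto simp: v_mult algebra_simps)

lemma v_inverse: "x \<noteq> 0 \<Longrightarrow> v (inverse x) = - v x"
  using v_mult[of x "inverse x"] by simp

lemma v_divide: "x \<noteq> 0 \<Longrightarrow> y \<noteq> 0 \<Longrightarrow> v (x / y) = v x - v y"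
  by (simp add: divide_inverse v_mult v_inverse)

lemma v_p [simp]: "v (of_nat p) = 1"
proof -
  have "prime (int p)" using prime_p by simp
  hence "multiplicity (int p) (int p) = 1" by (intro multiplicity_self) auto
  thus ?thesis using v_of_int[of "int p"] p_gt_1 by simp
qed

lemma v_p_power [simp]: "v (of_nat p ^ n) = int n" by (simp add: v_power)

lemma v_prod: "(\<And>i. i \<in> I \<Longrightarrow> f i \<noteq> 0) \<Longrightarrow> v (prod f I) = (\<Sum>i\<in>I. v (f i))"
  by (induction I rule: infinite_finite_induct) (auto simp: v_mult)

lemma vge_0 [simp]: "vge k 0" by (simp add: vge_def)

lemma vge_mono: "vge k x \<Longrightarrow> l \<le> k \<Longrightarrow> vge l x" by (auto simp: vge_def)

lemma vge_add: "vge k x \<Longrightarrow> vge k y \<Longrightarrow> vge k (x + y)"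
  using v_add[of x y] by (cases "x = 0"; cases "y = 0"; cases "x + y = 0") (auto simp: vge_def)

lemma vge_minus [simp]: "vge k (- x) \<longleftrightarrow> vge k x" by (simp add: vge_def)

lemma vge_diff: "vge k x \<Longrightarrow> vge k y \<Longrightarrow> vge k (x - y)"
  using vge_add[of k x "- y"] by simp

lemma vge_diff_commute: "vge k (x - y) \<longleftrightarrow> vge k (y - x)"
  using vge_minus[of k "x - y"] by simp

lemma vge_mult: "vge k x \<Longrightarrow> vge l y \<Longrightarrow> vge (k + l) (x * y)"
  by (cases "x = 0"; cases "y = 0") (auto simp: vge_def v_mult)

lemma vge_sum: "(\<And>i. i \<in> I \<Longrightarrow> vge k (f i)) \<Longrightarrow> vge k (sum f I)"
  by (induction I rule: infinite_finite_induct) (auto simp: vge_add)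

lemma vge_1_iff [simp]: "vge k 1 \<longleftrightarrow> k \<le> 0" by (simp add: vge_def)

lemma vge_v: "vge (v x) x" by (simp add: vge_def)

lemma vge_p_power [simp]: "vge k (of_nat p ^ n) \<longleftrightarrow> k \<le> int n" by (simp add: vge_def)

lemma vge_p_power_mult [simp]: "vge k (of_nat p ^ n * x) \<longleftrightarrow> vge (k - int n) x"
  by (cases "x = 0") (auto simp: vge_def v_mult)

lemma vge_divide_p_power [simp]: "vge k (x / of_nat p ^ n) \<longleftrightarrow> vge (k + int n) x"
  by (cases "x = 0") (auto simp: vge_def v_divide)

lemma vge_all_imp_0: "(\<And>n. vge (int n) x) \<Longrightarrow> x = 0"
proof (rule ccontr)
  assume all: "\<And>n. vge (int n) x" and "x \<noteq> 0"
  hence "int (nat (v x + 1)) \<le> v x" using all[of "nat (v x + 1)"] unfolding vge_def by blast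
  thus False by linarith
qed

definition val_ring :: "'a set" where "val_ring = {x. vge 0 x}"

sublocale val_ring: coeff_subring val_ring
proof
  show "x * y \<in> val_ring" if "x \<in> val_ring" "y \<in> val_ring" for x y
    using vge_mult[of 0 x 0 y] that by (simp add: val_ring_def)
qed (auto simp: val_ring_def vge_add)

lemma vge_of_int_iff: "vge (int k) (of_int n) \<longleftrightarrow> int p ^ k dvd n"
proof (cases "n = 0")
  case False
  have "\<not> is_unit (int p)" using p_gt_1 by simp
  hence "int p ^ k dvd n \<longleftrightarrow> k \<le> multiplicity (int p) n"
    by (rule power_dvd_iff_le_multiplicity[OF False])
  thus ?thesis using False by (simp add: vge_def v_of_int)
qed simp

lemma vge_of_rat:
  assumes "vge 0 (of_rat e :: 'a)"
  obtains D :: nat where "\<not> p dvd D" "of_nat D * e \<in> \<int>"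
proof -
  obtain a b where ab: "quotient_of e = (a, b)" by (cases "quotient_of e")
  hence e: "e = of_int a / of_int b" "b > 0" "Rings.coprime a b"
    by (auto simp: quotient_of_div quotient_of_denom_pos quotient_of_coprime)
  have "\<not> int p dvd b"
  proof
    assume pb: "int p dvd b"
    hence pa: "\<not> int p dvd a" using e(3) prime_p
      by (metis coprime_common_divisor not_prime_unit prime_nat_int_transfer)
    hence "a \<noteq> 0" by auto
    have "(of_rat e :: 'a) = of_int a / of_int b" by (simp add: e of_rat_divide)
    hence "v (of_rat e :: 'a) = v (of_int a :: 'a) - v (of_int b :: 'a)" using \<open>a \<noteq> 0\<close> e(2) by (simp add: v_divide)
    moreover have "\<not> vge (int 1) (of_int a :: 'a)" using pa by (subst vge_of_int_iff) simp
    moreover have "vge (int 1) (of_int b :: 'a)" using pb by (subst vge_of_int_iff) simp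
    moreover have "(of_rat e :: 'a) \<noteq> 0" using \<open>a \<noteq> 0\<close> e by simp
    ultimately show False using assms e(2) by (auto simp: vge_def)
  qed
  hence "\<not> p dvd nat b" using e(2) by (simp flip: int_dvd_int_iff)
  moreover have "of_nat (nat b) * e = of_int a" using e by simp
  ultimately show ?thesis using that[of "nat b"] by simp
qed

section \<open>Polynomials over the valuation ring\<close>

definition pge :: "int \<Rightarrow> 'a poly \<Rightarrow> bool" where "pge k f \<longleftrightarrow> (\<forall>i. vge k (coeff f i))"

lemma pge_0 [simp]: "pge k 0" by (simp add: pge_def)
lemma pge_1: "pge 0 1" by (auto simp: pge_def coeff_1)
lemma pge_mono: "pge k f \<Longrightarrow> l \<le> k \<Longrightarrow> pge l f" by (auto simp: pge_def intro: vge_mono)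
lemma pge_add: "pge k f \<Longrightarrow> pge k g \<Longrightarrow> pge k (f + g)" by (auto simp: pge_def vge_add)
lemma pge_minus [simp]: "pge k (- f) \<longleftrightarrow> pge k f" by (auto simp: pge_def)
lemma pge_diff: "pge k f \<Longrightarrow> pge k g \<Longrightarrow> pge k (f - g)" by (auto simp: pge_def vge_diff)
lemma pge_mult: "pge k f \<Longrightarrow> pge l g \<Longrightarrow> pge (k + l) (f * g)"
  by (auto simp: pge_def coeff_mult intro!: vge_sum vge_mult)
lemma pge_smult: "vge k c \<Longrightarrow> pge l f \<Longrightarrow> pge (k + l) (Polynomial.smult c f)"
  by (auto simp: pge_def intro: vge_mult)
lemma pge_sum: "(\<And>i. i \<in> I \<Longrightarrow> pge k (f i)) \<Longrightarrow> pge k (sum f I)"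
  by (induction I rule: infinite_finite_induct) (auto simp: pge_add)
lemma pge_all_imp_0: "(\<And>n. pge (int n) f) \<Longrightarrow> f = 0"
  by (rule poly_eqI) (auto simp: pge_def intro!: vge_all_imp_0)
lemma pge_0_iff: "pge 0 f \<longleftrightarrow> (\<forall>i. coeff f i \<in> val_ring)" by (simp add: pge_def val_ring_def)

lemma pge_exists: "\<exists>n. pge (- int n) f"
proof -
  define s where "s = (\<Sum>i\<le>degree f. nat \<bar>v (coeff f i)\<bar>)"
  have "pge (- int s) f"
    unfolding pge_def
  proof
    fix i
    show "vge (- int s) (coeff f i)"
    proof (cases "i \<le> degree f")
      case True
      hence "nat \<bar>v (coeff f i)\<bar> \<le> s"
        unfolding s_def by (intro member_le_sum) auto
      hence "- int s \<le> v (coeff f i)" by linarith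
      thus ?thesis by (simp add: vge_def)
    qed (simp add: coeff_eq_0)
  qed
  thus ?thesis by blast
qed

lemma vge_poly: "pge k f \<Longrightarrow> vge 0 x \<Longrightarrow> vge k (poly f x)"
proof -
  assume f: "pge k f" and x: "vge 0 x"
  have "vge (k + 0) (coeff f i * x ^ i)" for i
    using f val_ring.power_S[of x i] x by (intro vge_mult) (auto simp: pge_def val_ring_def)
  thus ?thesis unfolding poly_altdef by (intro vge_sum) simp
qed

text \<open>Each step of long division by a monic \<open>g\<close> subtracts \<open>g\<close> times
  a coefficient of the current remainder, so no divisibility is lost.\<close>

lemma pge_div_mod:
  assumes g: "lead_coeff g = 1" "pge 0 g" and f: "pge k f"
  shows "pge k (f div g)" "pge k (f mod g)"
proof -
  have "\<exists>q r. f = q * g + r \<and> (r = 0 \<or> degree r < degree g) \<and> pge k q \<and> pge k r"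
    using f
  proof (induction "degree f" arbitrary: f rule: less_induct)
    case less
    show ?case
    proof (cases "f = 0 \<or> degree f < degree g")
      case True
      thus ?thesis using less.prems by (intro exI[of _ 0] exI[of _ f]) auto
    next
      case False
      define c where "c = monom (lead_coeff f) (degree f - degree g)"
      define f' where "f' = f - c * g"
      have pc: "pge k c" using less.prems by (auto simp: pge_def c_def)
      hence pf': "pge k f'" unfolding f'_def using pge_mult[OF pc g(2)] less.prems by (auto intro: pge_diff)
      show ?thesis
      proof (cases "f' = 0")
        case True
        thus ?thesis using pc by (intro exI[of _ c] exI[of _ 0]) (auto simp: f'_def)
      next
        case f'0: False
        have g0: "g \<noteq> 0" using g(1) by auto
        have c0: "c \<noteq> 0" using False by (auto simp: c_def)
        have dc: "degree c = degree f - degree g" using False by (simp add: c_def degree_monom_eq)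
        have d: "degree (c * g) = degree f" using False g0 c0 dc by (simp add: degree_mult_eq)
        have "lead_coeff c = lead_coeff f" unfolding dc by (simp add: c_def)
        hence "lead_coeff (c * g) = lead_coeff f" using g(1) by (simp add: lead_coeff_mult)
        hence "coeff f' (degree f) = 0" using d by (simp add: f'_def)
        moreover have "degree f' \<le> degree f" unfolding f'_def using d by (intro degree_diff_le) auto
        ultimately have "degree f' < degree f" using f'0
          by (metis le_neq_implies_less leading_coeff_0_iff)
        from less.hyps[OF this pf'] obtain q r where
          "f' = q * g + r" "r = 0 \<or> degree r < degree g" "pge k q" "pge k r" by blast
        thus ?thesis using pc
          by (intro exI[of _ "c + q"] exI[of _ r]) (auto simp: f'_def algebra_simps intro: pge_add)
      qed
    qed
  qed
  then obtain q r where qr: "f = q * g + r" "r = 0 \<or> degree r < degree g" "pge k q" "pge k r" by blast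
  have g0: "g \<noteq> 0" using g(1) by auto
  have "r div g = 0" "r mod g = r" using qr(2) by (auto simp: div_poly_less mod_poly_less)
  hence "f div g = q" "f mod g = r" unfolding qr(1) using g0 by simp_all
  thus "pge k (f div g)" "pge k (f mod g)" using qr by simp_all
qed

text \<open>Hensel's lemma in the special case of the factorization \<open>f \<equiv> g \<cdot> 1\<close> modulo \<open>p\<close>: the iteration
  \<open>g \<mapsto> g + f mod g\<close> converges to a monic factor of degree \<open>i\<close>.\<close>

lemma hensel_factor:
  assumes f: "pge 0 f" "coeff f i = 1" "\<And>j. j > i \<Longrightarrow> vge 1 (coeff f j)"
  obtains g where "lead_coeff g = 1" "degree g = i" "g dvd f"
proof -
  \<comment> \<open>The start is \<open>f\<close> truncated to degree \<open>i\<close>: it is monic,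
    and what is cut off is divisible by \<open>p\<close>.\<close>
  define G where "G = rec_nat (\<Sum>j\<le>i. monom (coeff f j) j) (\<lambda>_ g. g + f mod g)"
  have G_Suc: "G (Suc n) = G n + f mod G n" for n by (simp add: G_def)
  have div_add: "(q * g + e) div g = q + e div g" "(q * g + e) mod g = e mod g" if "g \<noteq> 0" for q g e :: "'a poly"
    using that by simp_all
  have inv: "degree (G n) = i \<and> lead_coeff (G n) = 1 \<and> pge 0 (G n) \<and>
      pge (int (Suc n)) (f mod G n) \<and> pge 1 (f div G n - 1)" for n
  proof (induction n)
    case 0
    have cG: "coeff (G 0) j = (if j \<le> i then coeff f j else 0)" for j
      by (simp add: G_def coeff_sum)
    have "degree (G 0) \<le> i" by (rule degree_le) (simp add: cG)
    moreover have "degree (G 0) \<ge> i" by (rule le_degree) (simp add: cG f)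
    ultimately have d: "degree (G 0) = i" by simp
    have lc: "lead_coeff (G 0) = 1" unfolding d by (simp add: cG f)
    have pG: "pge 0 (G 0)" using f(1) by (auto simp: pge_def cG)
    define e where "e = f - G 0"
    have pe: "pge 1 e" using f(3) by (auto simp: e_def pge_def cG)
    have g0: "G 0 \<noteq> 0" using lc by auto
    have fe: "f = 1 * G 0 + e" by (simp add: e_def)
    have "f mod G 0 = e mod G 0" "f div G 0 - 1 = e div G 0"
      by (subst fe, subst div_add[OF g0], simp)+
    thus ?case using d lc pG pge_div_mod[OF lc pG pe] by simp
  next
    case (Suc n)
    define g R Q where "g = G n" and "R = f mod g" and "Q = f div g"
    have IH: "degree g = i" "lead_coeff g = 1" "pge 0 g" "pge (int (Suc n)) R" "pge 1 (Q - 1)"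
      using Suc by (auto simp: g_def R_def Q_def)
    have g0: "g \<noteq> 0" using IH(2) by auto
    define g' where "g' = g + R"
    have g': "G (Suc n) = g'" by (simp add: G_Suc g'_def g_def R_def)
    have R: "R = 0 \<or> degree R < i" using degree_mod_less[OF g0, of f] IH(1) by (simp add: R_def)
    hence d: "degree g' = i" and lc: "lead_coeff g' = 1"
      using IH(1,2) by (auto simp: g'_def degree_add_eq_left coeff_eq_0)
    have pg': "pge 0 g'" unfolding g'_def using IH(3) pge_mono[OF IH(4), of 0] by (intro pge_add) auto
    \<comment> \<open>From f = Q g + R one gets f = Q (g + R) + (1 - Q) R. The quotient
      \<open>Q\<close> is 1 modulo \<open>p\<close>, so the new remainder has gained a factor
      \<open>p\<close>.\<close>
    define e where "e = (1 - Q) * R"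
    have "pge 1 (1 - Q)" using IH(5) pge_minus[of 1 "Q - 1"] by simp
    hence pe: "pge (int (Suc (Suc n))) e" unfolding e_def using pge_mult[OF _ IH(4), of 1 "1 - Q"] by simp
    have g'0: "g' \<noteq> 0" using lc by auto
    have "f = Q * g + R" by (simp add: Q_def R_def)
    hence fe: "f = Q * g' + e" by (simp add: g'_def e_def algebra_simps)
    have m: "f mod g' = e mod g'" and q: "f div g' - 1 = (Q - 1) + e div g'"
      by (subst fe, subst div_add[OF g'0], simp)+
    have "pge 1 (f div g' - 1)" unfolding q
      using IH(5) pge_mono[OF pge_div_mod(1)[OF lc pg' pe], of 1] by (intro pge_add) auto
    thus ?case unfolding g' using d lc pg' pge_div_mod(2)[OF lc pg' pe] m by simp
  qed
  have "\<exists>l. \<forall>n. vge (int n) (l - coeff (G n) j)" for j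
  proof -
    have "vge (int n) (coeff (G (Suc n)) j - coeff (G n) j)" for n
      using inv[of n] by (auto simp: G_Suc pge_def intro: vge_mono)
    thus ?thesis using complete[of "\<lambda>n. coeff (G n) j"] by (simp add: vge_def)
  qed
  then obtain l where l: "\<And>j n. vge (int n) (l j - coeff (G n) j)" by metis
  define g where "g = monom 1 i + (\<Sum>j<i. monom (l j) j)"
  have cg: "coeff g j = (if j < i then l j else if j = i then 1 else 0)" for j
    by (simp add: g_def coeff_sum)
  have "degree g \<le> i" by (rule degree_le) (simp add: cg)
  moreover have "degree g \<ge> i" by (rule le_degree) (simp add: cg)
  ultimately have d: "degree g = i" by simp
  hence lc: "lead_coeff g = 1" by (simp add: cg)
  have gG: "pge (int n) (g - G n)" for n
    unfolding pge_def
  proof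
    fix j
    consider "j < i" | "j = i" | "j > i" by linarith
    thus "vge (int n) (coeff (g - G n) j)"
      using l[of n j] inv[of n] by cases (auto simp: cg coeff_eq_0)
  qed
  have pg: "pge 0 g" using pge_add[OF gG[of 0], of "G 0"] inv[of 0] by simp
  have g0: "g \<noteq> 0" using lc by auto
  have "pge (int n) (f mod g)" for n
  proof -
    \<comment> \<open>Replacing \<open>G n\<close> by the limit \<open>g\<close> costs an error
      divisible by \<open>p ^ n\<close>; hence the remainder of \<open>f\<close> modulo
      \<open>g\<close> is divisible by every power of \<open>p\<close>.\<close>
    define Q where "Q = f div G n"
    define e where "e = Q * (G n - g) + f mod G n"
    have "pge 0 Q" unfolding Q_def using inv[of n] f(1) by (intro pge_div_mod(1)) auto
    moreover have "pge (int n) (G n - g)" using pge_minus[of "int n" "g - G n"] gG by simp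
    ultimately have "pge (0 + int n) (Q * (G n - g))" by (rule pge_mult)
    hence pe: "pge (int n) e" unfolding e_def using inv[of n] by (intro pge_add) (auto intro: pge_mono)
    have "f = Q * G n + f mod G n" by (simp add: Q_def)
    hence fe: "f = Q * g + e" by (simp add: e_def algebra_simps)
    have "f mod g = e mod g" by (subst fe, subst div_add[OF g0], simp)
    thus ?thesis using pge_div_mod(2)[OF lc pg pe] by simp
  qed
  hence "f mod g = 0" by (rule pge_all_imp_0)
  thus ?thesis using that d lc by (simp add: dvd_eq_mod_eq_0)
qed

text \<open>If some coefficient had negative valuation, division by a coefficient of minimal
  valuation would bring \<open>f\<close> into the form required by \<open>hensel_factor\<close>, and
  the factor found there would be proper.\<close>

theorem irreducible_imp_integral:
  assumes irr: "Factorial_Ring.irreducible f" and lc: "vge 0 (lead_coeff f)" and c0: "vge 0 (coeff f 0)"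
  shows "pge 0 f"
proof (rule ccontr)
  assume "\<not> pge 0 f"
  then obtain j0 where j0: "\<not> vge 0 (coeff f j0)" by (auto simp: pge_def)
  define I where "I = {j. coeff f j \<noteq> 0}"
  have finI: "finite I" unfolding I_def by (rule finite_subset[of _ "{..degree f}"]) (auto intro: le_degree)
  have "j0 \<in> I" unfolding I_def using j0 vge_0 by (metis (mono_tags) mem_Collect_eq)
  hence neI: "I \<noteq> {}" by blast
  define u where "u = Min (v ` coeff f ` I)"
  have u_le: "u \<le> v (coeff f j)" if "j \<in> I" for j using that finI by (auto simp: u_def)
  have "u < 0" using u_le[of j0] j0 by (auto simp: vge_def I_def)
  have "u \<in> v ` coeff f ` I" unfolding u_def using finI neI by (intro Min_in) auto
  hence ne: "{j \<in> I. v (coeff f j) = u} \<noteq> {}" by auto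
  \<comment> \<open>With the largest index of minimal valuation, all later coefficients of
    \<open>f'\<close> become divisible by \<open>p\<close>. As \<open>u < 0\<close>, this index is
    neither 0 nor the degree, so the factor of degree \<open>i\<close> contradicts
    irreducibility.\<close>
  define i where "i = Max {j \<in> I. v (coeff f j) = u}"
  have i: "i \<in> I" "v (coeff f i) = u" using Max_in[OF _ ne] finI by (auto simp: i_def)
  have i_max: "v (coeff f j) > u" if "j > i" "j \<in> I" for j
  proof -
    have "j \<le> i" if "v (coeff f j) = u"
      unfolding i_def using finI that \<open>j \<in> I\<close> by (intro Max_ge) auto
    hence "v (coeff f j) \<noteq> u" using that(1) by auto
    thus ?thesis using u_le[OF that(2)] by simp
  qed
  define c where "c = coeff f i"
  have c: "c \<noteq> 0" "v c = u" using i by (auto simp: c_def I_def)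
  define f' where "f' = Polynomial.smult (inverse c) f"
  have cf': "coeff f' j = coeff f j / c" for j by (simp add: f'_def divide_inverse mult.commute)
  have vf': "v (coeff f' j) = v (coeff f j) - u" if "j \<in> I" for j
    using that c by (simp add: cf' v_divide I_def)
  have f'0: "coeff f' j = 0" if "j \<notin> I" for j using that by (simp add: cf' I_def)
  have "vge 0 (coeff f' j)" for j
    using u_le[of j] vf'[of j] f'0[of j] by (cases "j \<in> I") (auto simp: vge_def)
  hence "pge 0 f'" by (simp add: pge_def)
  moreover have "coeff f' i = 1" using c by (simp add: cf' c_def)
  moreover have "vge 1 (coeff f' j)" if "j > i" for j
    using i_max[OF that] vf'[of j] f'0[of j] by (cases "j \<in> I") (auto simp: vge_def)
  ultimately obtain g where g: "lead_coeff g = 1" "degree g = i" "g dvd f'" using hensel_factor by metis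
  have "\<not> vge 0 (coeff f i)" using c \<open>u < 0\<close> by (simp add: vge_def c_def)
  hence i0: "i \<noteq> 0" and id: "i \<noteq> degree f" using c0 lc by metis+
  have i_le: "i \<le> degree f" using c by (intro le_degree) (simp add: c_def)
  have irr': "Factorial_Ring.irreducible f'" unfolding f'_def using c by (intro irreducible_smult irr) auto
  obtain h where h: "f' = g * h" using g(3) by blast
  have "f' \<noteq> 0" using irr' by auto
  hence "degree f' = degree g + degree h" unfolding h by (intro degree_mult_eq) auto
  moreover have "degree f' = degree f" using c by (simp add: f'_def)
  moreover have "degree g = 0 \<or> degree h = 0"
    using h by (rule irr'[unfolded irreducible_poly_iff_degree, THEN conjunct2, rule_format])
  ultimately show False using i0 id g(2) by simp
qed

end

section \<open>Integrality over the valuation ring\<close>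

interpretation to_ac_hom: field_hom "to_ac :: 'a::field \<Rightarrow> 'a alg_closure"
  by unfold_locales auto

interpretation to_ac_poly_hom: map_poly_comm_ring_hom "to_ac :: 'a::field \<Rightarrow> 'a alg_closure" ..

lemma to_ac_of_rat [simp]: "to_ac (of_rat q :: 'a::field_char_0) = of_rat q"
  by (cases q rule: Rat_cases) (auto simp: of_rat_rat)

lemma map_poly_to_ac_of_rat:
  "map_poly to_ac (map_poly of_rat q :: 'a::field_char_0 poly) = map_poly of_rat q"
  by (simp add: map_poly_map_poly o_def)

context padic_valued_field
begin

text \<open>Gauss's lemma. Let \<open>c\<close> and \<open>d\<close> be the lowest coefficients of
  minimal valuation in \<open>g\<close> and \<open>h\<close>; the coefficient of the product at
  \<open>i + j\<close> has valuation v(c) + v(d), which is therefore nonnegative. Both terms are at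
  most 0 because the polynomials are monic, so both vanish.\<close>

lemma monic_factor_integral:
  assumes gh: "pge 0 (g * h)" and lc: "lead_coeff g = 1" "lead_coeff h = 1"
  shows "pge 0 g"
proof -
  have least: "\<exists>i c. c \<noteq> 0 \<and> coeff f i = c \<and> (\<forall>j. vge (v c) (coeff f j)) \<and> (\<forall>j<i. vge (v c + 1) (coeff f j))"
    if f: "lead_coeff f = 1" for f
  proof -
    define I where "I = {j. coeff f j \<noteq> 0}"
    have finI: "finite I" unfolding I_def by (rule finite_subset[of _ "{..degree f}"]) (auto intro: le_degree)
    have "degree f \<in> I" using f by (simp add: I_def)
    hence neI: "I \<noteq> {}" by blast
    define u where "u = Min (v ` coeff f ` I)"
    have u_le: "u \<le> v (coeff f j)" if "j \<in> I" for j using that finI by (auto simp: u_def)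
    have "u \<in> v ` coeff f ` I" unfolding u_def using finI neI by (intro Min_in) auto
    hence ex: "\<exists>j. j \<in> I \<and> v (coeff f j) = u" by auto
    define i where "i = (LEAST j. j \<in> I \<and> v (coeff f j) = u)"
    have i: "i \<in> I" "v (coeff f i) = u" using LeastI_ex[OF ex] by (auto simp: i_def)
    have i_min: "v (coeff f j) \<noteq> u" if "j < i" "j \<in> I" for j
      using not_less_Least[of j "\<lambda>j. j \<in> I \<and> v (coeff f j) = u"] that by (auto simp: i_def)
    show ?thesis
    proof (intro exI conjI allI impI)
      show "coeff f i \<noteq> 0" using i by (simp add: I_def)
      show "vge (v (coeff f i)) (coeff f j)" for j
        using u_le[of j] i by (cases "j \<in> I") (auto simp: vge_def I_def)
      show "vge (v (coeff f i) + 1) (coeff f j)" if "j < i" for j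
        using u_le[of j] i i_min[OF that] by (cases "j \<in> I") (auto simp: vge_def I_def)
    qed simp
  qed
  obtain i c where c: "c \<noteq> 0" "coeff g i = c" "\<And>j. vge (v c) (coeff g j)" "\<And>j. j < i \<Longrightarrow> vge (v c + 1) (coeff g j)"
    using least[OF lc(1)] by blast
  obtain j d where d: "d \<noteq> 0" "coeff h j = d" "\<And>k. vge (v d) (coeff h k)" "\<And>k. k < j \<Longrightarrow> vge (v d + 1) (coeff h k)"
    using least[OF lc(2)] by blast
  have "v c \<le> 0" using c(3)[of "degree g"] lc(1) by simp
  have "v d \<le> 0" using d(3)[of "degree h"] lc(2) by simp
  have rest: "vge (v c + v d + 1) (\<Sum>k\<in>{..i + j} - {i}. coeff g k * coeff h (i + j - k))"
  proof (rule vge_sum)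
    fix k assume k: "k \<in> {..i + j} - {i}"
    show "vge (v c + v d + 1) (coeff g k * coeff h (i + j - k))"
    proof (cases "k < i")
      case True
      show ?thesis using vge_mult[OF c(4)[OF True] d(3)[of "i + j - k"]] by (simp add: add_ac)
    next
      case False
      hence "i + j - k < j" using k by auto
      from vge_mult[OF c(3)[of k] d(4)[OF this]] show ?thesis by (simp add: add_ac)
    qed
  qed
  have "coeff (g * h) (i + j) = c * d + (\<Sum>k\<in>{..i + j} - {i}. coeff g k * coeff h (i + j - k))"
    unfolding coeff_mult by (subst sum.remove[of _ i]) (auto simp: c d)
  hence cd: "c * d = coeff (g * h) (i + j) - (\<Sum>k\<in>{..i + j} - {i}. coeff g k * coeff h (i + j - k))" by simp
  have "\<not> v c + v d < 0"
  proof
    assume neg: "v c + v d < 0"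
    have "vge (v c + v d + 1) (c * d)" unfolding cd
      using gh neg by (intro vge_diff rest) (auto simp: pge_def intro: vge_mono)
    thus False using c(1) d(1) by (simp add: vge_def v_mult)
  qed
  hence "v c = 0" using \<open>v c \<le> 0\<close> \<open>v d \<le> 0\<close> by simp
  thus ?thesis using c(3) by (simp add: pge_def)
qed

text \<open>If \<open>v x < 0\<close>, every lower term of a monic integral equation has valuation
  strictly above \<open>n * v x\<close>, so nothing can cancel \<open>x ^ n\<close>.\<close>

lemma integral_over_val_ring_imp_vge:
  assumes "integral_over val_ring x" shows "vge 0 x"
proof (rule ccontr)
  assume neg: "\<not> vge 0 x"
  hence x: "x \<noteq> 0" "v x < 0" by (auto simp: vge_def)
  obtain n s where n: "n > 0" "\<And>i. s i \<in> val_ring" "x ^ n = (\<Sum>i<n. s i * x ^ i)"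
    using val_ring.integral_over_powerD[OF assms] by blast
  have "vge (int n * v x + 1) (\<Sum>i<n. s i * x ^ i)"
  proof (rule vge_sum)
    fix i assume "i \<in> {..<n}"
    hence "int i + 1 \<le> int n" by simp
    hence "(int i + 1) * v x \<ge> int n * v x" using x(2) by (intro mult_right_mono_neg) auto
    hence "int n * v x + 1 \<le> int i * v x" using x(2) by (simp add: algebra_simps)
    moreover have "vge (0 + int i * v x) (s i * x ^ i)"
      using n(2)[of i] x(1) by (intro vge_mult) (auto simp: val_ring_def vge_def v_power)
    ultimately show "vge (int n * v x + 1) (s i * x ^ i)" by (auto intro: vge_mono)
  qed
  thus False using x(1) by (simp flip: n(3) add: vge_def v_power)
qed

text \<open>The polynomial f(z + p^N X) divided by p^(dN), with d the degree, is monic and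
  irreducible, and its constant term is integral by assumption. So all its coefficients are
  integral: the roots of \<open>f\<close> are within N of \<open>z\<close>.\<close>

lemma monic_irreducible_scaled_integral:
  assumes irr: "Factorial_Ring.irreducible f" and lc: "lead_coeff f = 1" and c0: "vge (int (degree f * N)) (poly f z)"
  shows "vge (int (degree f * N)) (coeff (f \<circ>\<^sub>p [:z, of_nat p ^ N:]) i)"
proof -
  define h where "h = Polynomial.smult (1 / of_nat p ^ (degree f * N)) (f \<circ>\<^sub>p [:z, of_nat p ^ N:])"
  have "Factorial_Ring.irreducible h" unfolding h_def
    by (intro irreducible_smult irreducible_pcompose_linear irr) auto
  moreover have "lead_coeff (f \<circ>\<^sub>p [:z, of_nat p ^ N:]) = of_nat p ^ (degree f * N)"
    using lc by (subst lead_coeff_comp) (auto simp: power_mult mult.commute)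
  hence "lead_coeff h = 1" by (simp add: h_def)
  moreover have "coeff (f \<circ>\<^sub>p [:z, of_nat p ^ N:]) 0 = poly f z"
    using poly_pcompose[of f "[:z, of_nat p ^ N:]" 0] by (simp add: poly_0_coeff_0)
  hence "coeff h 0 = poly f z / of_nat p ^ (degree f * N)" by (simp add: h_def)
  ultimately have "pge 0 h" using c0 by (intro irreducible_imp_integral) auto
  hence "vge 0 (coeff h i)" by (simp add: pge_def)
  thus ?thesis by (simp add: h_def)
qed

text \<open>This expresses v(\<xi> - z) \<le> N without a valuation at \<xi>. The number in question
  is a root of the reversal of f(z + p^N X); made monic, this has constant term p^(dN) / f(z),
  integral by assumption, and \<open>irreducible_imp_integral\<close> applies.\<close>

lemma integral_inverse_of_root:
  fixes \<xi> :: "'a alg_closure"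
  assumes irr: "Factorial_Ring.irreducible f" and lc: "lead_coeff f = 1"
    and root: "poly (map_poly to_ac f) \<xi> = 0"
    and z: "poly f z \<noteq> 0" "v (poly f z) \<le> int (degree f * N)"
  shows "integral_over (to_ac ` val_ring) (of_nat p ^ N / (\<xi> - to_ac z))"
proof -
  define h where "h = f \<circ>\<^sub>p [:z, of_nat p ^ N:]"
  have irr_h: "Factorial_Ring.irreducible h" unfolding h_def by (intro irreducible_pcompose_linear irr) auto
  have lc_h: "lead_coeff h = of_nat p ^ (degree f * N)"
    unfolding h_def using lc by (subst lead_coeff_comp) (auto simp: power_mult mult.commute)
  have h0: "coeff h 0 = poly f z"
    using poly_pcompose[of f "[:z, of_nat p ^ N:]" 0] by (simp add: poly_0_coeff_0 h_def)
  have deg_h: "degree h = degree f" by (simp add: h_def degree_pcompose)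
  define g where "g = Polynomial.smult (inverse (poly f z)) (reflect_poly h)"
  have irr_g: "Factorial_Ring.irreducible g" unfolding g_def
    using z(1) by (intro irreducible_smult irreducible_reflect_poly irr_h) (auto simp: h0)
  have lc_g: "lead_coeff g = 1" using z(1) by (simp add: g_def h0 coeff_reflect_poly)
  have "coeff g 0 = of_nat p ^ (degree f * N) / poly f z"
    by (simp add: g_def lc_h field_simps)
  hence "vge 0 (coeff g 0)" using z by (simp add: vge_def v_divide)
  hence pg: "pge 0 g" using irr_g lc_g by (intro irreducible_imp_integral) auto
  have \<xi>z: "\<xi> \<noteq> to_ac z" using root z(1) by (auto simp: to_ac_hom.poly_map_poly)
  define y where "y = (\<xi> - to_ac z) / of_nat p ^ N"
  have y0: "y \<noteq> 0" using \<xi>z by (simp add: y_def)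
  have "poly (map_poly to_ac h) y = poly (map_poly to_ac f) (to_ac z + y * of_nat p ^ N)"
    by (simp add: h_def to_ac_hom.map_poly_pcompose poly_pcompose to_ac_hom.map_poly_pCons_hom)
  also have "to_ac z + y * of_nat p ^ N = \<xi>" by (simp add: y_def)
  finally have "poly (map_poly to_ac h) y = 0" using root by simp
  hence "poly (reflect_poly (map_poly to_ac h)) (inverse y) = 0"
    using y0 by (simp add: poly_reflect_poly_nz)
  also have "reflect_poly (map_poly to_ac h) = map_poly to_ac (reflect_poly h)"
    by (rule poly_eqI) (simp add: coeff_reflect_poly)
  finally have "poly (map_poly to_ac g) (inverse y) = 0"
    by (simp add: g_def to_ac_hom.map_poly_hom_smult)
  moreover have "lead_coeff (map_poly to_ac g) = 1" using lc_g by simp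
  moreover have "coeff (map_poly to_ac g) i \<in> to_ac ` val_ring" for i
    using pg by (simp add: pge_0_iff)
  ultimately have "integral_over (to_ac ` val_ring) (inverse y)" unfolding integral_over_def by blast
  thus ?thesis by (simp add: y_def)
qed

text \<open>Takes the place of compactness of Z_p. If f(z) were divisible by a very high power of
  \<open>p\<close>, so would be f'(z), the linear coefficient of a shift of \<open>f\<close>,
  against a relation a f + b f' = 1.\<close>

lemma irreducible_bounded_on_val_ring:
  assumes irr: "Factorial_Ring.irreducible f" and lc: "lead_coeff f = 1" and int: "pge 0 f" and d: "degree f > 1"
  shows "\<exists>B. \<forall>z. vge 0 z \<longrightarrow> \<not> vge (int B) (poly f z)"
proof -
  have "pderiv f \<noteq> 0" using d by (simp add: pderiv_eq_0_iff)
  hence "\<not> f dvd pderiv f" using d by (auto dest: dvd_imp_degree_le simp: degree_pderiv)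
  then obtain a b where ab: "a * f + b * pderiv f = 1" using irreducible_bezout[OF irr] by blast
  obtain ka kb where k: "pge (- int ka) a" "pge (- int kb) b" using pge_exists by metis
  \<comment> \<open>\<open>C\<close> exceeds the denominators of \<open>a\<close> and
    \<open>b\<close>. Divisibility of f(z) by p^(dC) gives divisibility of p^C f'(z) by p^(dC),
    hence of f'(z) by p^C, because d is at least 2.\<close>
  define C where "C = max ka kb + 1"
  have "\<not> vge (int (degree f * C)) (poly f z)" if z: "vge 0 z" for z
  proof
    assume c0: "vge (int (degree f * C)) (poly f z)"
    define h where "h = f \<circ>\<^sub>p [:z, of_nat p ^ C:]"
    have "coeff h 1 = poly (pderiv h) 0" by (simp add: poly_0_coeff_0 coeff_pderiv)
    also have "\<dots> = of_nat p ^ C * poly (pderiv f) z"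
      by (simp add: h_def pderiv_pcompose poly_pcompose pderiv_pCons)
    finally have "vge (int (degree f * C)) (of_nat p ^ C * poly (pderiv f) z)"
      using monic_irreducible_scaled_integral[OF irr lc c0, of 1] by (simp add: h_def)
    hence f'z: "vge (int (degree f * C) - int C) (poly (pderiv f) z)" by (simp only: vge_p_power_mult)
    have dC: "int C \<le> int (degree f * C) - int C"
    proof -
      have "2 * C \<le> degree f * C" using d by (intro mult_le_mono1) simp
      thus ?thesis by linarith
    qed
    have "vge (- int ka + int C) (poly a z * poly f z)"
      using dC by (intro vge_mult vge_poly[OF k(1) z] vge_mono[OF c0]) auto
    moreover have "vge (- int kb + int C) (poly b z * poly (pderiv f) z)"
      by (intro vge_mult vge_poly[OF k(2) z] vge_mono[OF f'z] dC)
    ultimately have "vge 1 (poly a z * poly f z + poly b z * poly (pderiv f) z)"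
      by (intro vge_add) (auto simp: C_def elim!: vge_mono)
    also have "poly a z * poly f z + poly b z * poly (pderiv f) z = poly (a * f + b * pderiv f) z" by simp
    finally show False unfolding ab by simp
  qed
  thus ?thesis by blast
qed

lemma integral_monic_root_in_val_ring:
  assumes "pge 0 f" "lead_coeff f = 1" "poly f z = 0" shows "vge 0 z"
  using assms by (intro integral_over_val_ring_imp_vge) (auto simp: integral_over_def pge_0_iff)

text \<open>If a product is highly divisible by \<open>p\<close> then one factor is. A linear factor
  then says that \<open>x\<close> is close to its root, while a nonlinear irreducible factor is
  bounded on Z_p and so drops out for a large threshold.\<close>

lemma near_root:
  assumes m: "lead_coeff m = 1" "pge 0 m"
  shows "\<exists>t. \<forall>x. vge 0 x \<longrightarrow> vge (int t) (poly m x) \<longrightarrow> (\<exists>z. poly m z = 0 \<and> vge (int T) (x - z))"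
proof -
  have "\<exists>t. \<forall>x. vge 0 x \<longrightarrow> vge (int t) (poly f x) \<longrightarrow> (\<exists>z. poly m z = 0 \<and> vge (int T) (x - z))"
    if "lead_coeff f = 1" "f dvd m" for f
    using that
  proof (induction rule: monic_factor_induct)
    case one
    show ?case by (intro exI[of _ 1]) auto
  next
    case (mult g f)
    then obtain t where t: "\<And>x. vge 0 x \<Longrightarrow> vge (int t) (poly f x) \<Longrightarrow> \<exists>z. poly m z = 0 \<and> vge (int T) (x - z)"
      by blast
    have key: ?case if B: "\<And>x. vge 0 x \<Longrightarrow> vge (int B) (poly g x) \<Longrightarrow> \<exists>z. poly m z = 0 \<and> vge (int T) (x - z)" for B
    proof (intro exI[of _ "t + B"] allI impI)
      fix x assume x: "vge 0 x" "vge (int (t + B)) (poly (g * f) x)"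
      show "\<exists>z. poly m z = 0 \<and> vge (int T) (x - z)"
      proof (cases "vge (int B) (poly g x)")
        case False
        hence "vge (int t) (poly f x)" using x(2)
          by (cases "poly f x = 0") (auto simp: vge_def v_mult)
        thus ?thesis using t x(1) by blast
      qed (use B x in blast)
    qed
    show ?case
    proof (cases "degree g = 1")
      case True
      then obtain c b where "g = [:c, b:]" by (metis degree1_coeffs)
      hence g: "g = [:c, 1:]" using mult.hyps(1) True by (auto split: if_splits)
      have "poly m (- c) = 0" using mult.hyps(3) by (auto simp: g elim!: dvdE)
      thus ?thesis by (intro key[of T]) (auto simp: g add.commute intro!: exI[of _ "- c"])
    next
      case False
      hence d: "degree g > 1" using mult.hyps(2) by (simp add: irreducible_poly_iff_degree)
      obtain h where h: "m = g * h" using mult.hyps(3) by blast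
      have "lead_coeff h = 1" using m(1) mult.hyps(1) by (simp add: h lead_coeff_mult)
      hence "pge 0 g" using monic_factor_integral[of g h] m(2) mult.hyps(1) by (simp add: h)
      then obtain B where "\<And>z. vge 0 z \<Longrightarrow> \<not> vge (int B) (poly g z)"
        using irreducible_bounded_on_val_ring[OF mult.hyps(2,1) _ d] by blast
      thus ?thesis by (intro key[of B]) auto
    qed
  qed
  thus ?thesis using m by simp
qed

end

section \<open>Integrality at \<open>p\<close> from equations over the \<open>p\<close>-adic numbers\<close>

lemma pcompose_as_sum:
  fixes P q :: "'a::field_char_0 poly"
  shows "P \<circ>\<^sub>p q = (\<Sum>i\<le>degree P. Polynomial.smult (coeff P i) (q ^ i))"
proof -
  have "poly (P \<circ>\<^sub>p q) = poly (\<Sum>i\<le>degree P. Polynomial.smult (coeff P i) (q ^ i))"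
    by (rule ext) (simp add: poly_pcompose poly_sum poly_altdef[of P])
  thus ?thesis by (simp only: poly_eq_poly_eq_iff)
qed

lemma degree_mod_less_pos:
  fixes f g :: "'a::field poly"
  assumes "degree g > 0" shows "degree (f mod g) < degree g"
proof -
  have "g \<noteq> 0" using assms by auto
  thus ?thesis using degree_mod_less[of g f] assms by (cases "f mod g = 0") auto
qed

text \<open>An irreducible \<open>m\<close> divides every rational polynomial that vanishes at one
  of its roots. This carries algebraic relations from the complex number \<beta> to its conjugates
  in other fields.\<close>

lemma rat_root_transfer:
  fixes x :: "'a::field_char_0" and y :: "'b::field_char_0"
  assumes "Factorial_Ring.irreducible m" "rpoly m x = 0" "rpoly q x = 0" "rpoly m y = 0"
  shows "rpoly q y = 0"
proof -
  have "field_hom (of_rat :: rat \<Rightarrow> 'a)" ..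
  hence "m dvd q" using assms by (intro irreducible_dvd_of_common_root)
  then obtain h where "q = m * h" by blast
  thus ?thesis using assms(4) by (simp add: of_rat_poly_hom.hom_mult)
qed

lemma map_poly_of_rat_of_int: "map_poly of_rat (map_poly of_int f) = (map_poly of_int f :: 'a::field_char_0 poly)"
  by (simp add: map_poly_map_poly o_def)

lemma algebraic_int_transfer:
  fixes x :: "'a::field_char_0" and y :: "'b::field_char_0"
  assumes m: "Factorial_Ring.irreducible m" "rpoly m x = 0" "rpoly m y = 0"
    and int: "algebraic_int (rpoly q x)"
  shows "algebraic_int (rpoly q y)"
proof -
  obtain P where P: "poly (map_poly of_int P) (rpoly q x) = 0" "lead_coeff P = 1"
    using int by (auto simp: algebraic_int_altdef_ipoly)
  have eq: "rpoly (map_poly of_int P \<circ>\<^sub>p q) z = poly (map_poly of_int P) (rpoly q z)" for z :: "'c::field_char_0"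
    by (simp add: of_rat_hom.map_poly_pcompose poly_pcompose map_poly_of_rat_of_int)
  have "rpoly (map_poly of_int P \<circ>\<^sub>p q) y = 0"
    by (rule rat_root_transfer[OF m(1,2) _ m(3)]) (simp add: eq P)
  thus ?thesis using P(2) by (auto simp: eq algebraic_int_altdef_ipoly)
qed

lemma integral_over_mono: "integral_over S x \<Longrightarrow> S \<subseteq> T \<Longrightarrow> integral_over T x"
  unfolding integral_over_def by blast

context padic_valued_field
begin

lemma algebraic_int_imp_vge: "algebraic_int x \<Longrightarrow> vge 0 x"
  by (rule integral_over_val_ring_imp_vge)
    (auto simp: algebraic_int_iff_integral_over Ints_def val_ring.of_int_S elim!: integral_over_mono)

lemma coeff_subring_to_ac: "coeff_subring (to_ac ` val_ring)"
proof
  show "1 \<in> to_ac ` val_ring" using val_ring.one_S by (metis imageI to_ac_1)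
  fix x y assume "x \<in> to_ac ` val_ring" "y \<in> to_ac ` val_ring"
  then obtain a b where "x = to_ac a" "y = to_ac b" "a \<in> val_ring" "b \<in> val_ring" by blast
  moreover from this have "a + b \<in> val_ring" "a * b \<in> val_ring" "- a \<in> val_ring" by auto
  ultimately show "x + y \<in> to_ac ` val_ring" "x * y \<in> to_ac ` val_ring" "- x \<in> to_ac ` val_ring"
    by (metis imageI to_ac_add to_ac_mult to_ac_minus)+
qed

sublocale ac: coeff_subring "to_ac ` val_ring" by (rule coeff_subring_to_ac)

lemma algebraic_int_imp_integral_ac: "algebraic_int x \<Longrightarrow> integral_over (to_ac ` val_ring) x"
  by (auto simp: algebraic_int_iff_integral_over Ints_def ac.of_int_S elim!: integral_over_mono)

lemma integral_min_poly:
  assumes m: "Factorial_Ring.irreducible m" "lead_coeff m = 1" "rpoly m \<beta> = 0" and int: "algebraic_int (\<beta> :: complex)"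
  shows "pge 0 (map_poly of_rat m)"
proof -
  obtain P where P: "poly (map_poly of_int P) \<beta> = 0" "lead_coeff P = 1"
    using int by (auto simp: algebraic_int_altdef_ipoly)
  have "field_hom (of_rat :: rat \<Rightarrow> complex)" ..
  hence "m dvd map_poly of_int P"
    by (rule irreducible_dvd_of_common_root[OF _ m(1,3)]) (simp add: P map_poly_of_rat_of_int)
  then obtain h where h: "map_poly of_int P = m * h" by blast
  have "lead_coeff (map_poly of_int P :: rat poly) = 1" using P(2) by simp
  hence lh: "lead_coeff h = 1" unfolding h using m(2) by (simp add: lead_coeff_mult)
  have "map_poly of_int P = (map_poly of_rat m * map_poly of_rat h :: 'a poly)"
    unfolding of_rat_poly_hom.hom_mult[symmetric] h[symmetric] map_poly_of_rat_of_int ..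
  moreover have "pge 0 (map_poly of_int P)" by (simp add: pge_0_iff val_ring.of_int_S)
  ultimately show ?thesis
    using monic_factor_integral[of "map_poly of_rat m" "map_poly of_rat h"] m(2) lh by simp
qed

text \<open>A \<open>p\<close>-adic integral equation modulo \<open>m\<close> is approximated by an equation with integer coefficients;
  the remainder modulo \<open>m\<close> then is \<open>p\<close>-integral.\<close>

lemma p_integral_of_padic_equation:
  assumes m: "degree m > 0" "rpoly m \<beta> = 0" and int: "algebraic_int (\<beta> :: complex)"
    and P: "lead_coeff P = 1" "pge 0 P" and dvd: "map_poly of_rat m dvd P \<circ>\<^sub>p map_poly of_rat Y"
  shows "\<exists>D. \<not> p dvd D \<and> algebraic_int (of_nat D * rpoly Y \<beta>)"
proof -
  define M where "M = (map_poly of_rat m :: 'a poly)"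
  define YY where "YY = (map_poly of_rat Y :: 'a poly)"
  define n where "n = degree P"
  have dM: "degree M > 0" using m(1) by (simp add: M_def)
  have n: "n > 0"
  proof (rule Nat.gr0I)
    assume "n = 0"
    hence "P = 1" using P(1) by (auto simp: n_def elim!: degree_eq_zeroE)
    hence "M dvd 1" using dvd by (simp add: M_def)
    thus False using dM by (auto simp: poly_dvd_1)
  qed
  \<comment> \<open>Reduction modulo \<open>M\<close> leaves only \<open>n\<close> powers of
    \<open>Y\<close>, whose denominators \<open>p ^ L\<close> clears. Approximating the coefficients
    of \<open>P\<close> by integers modulo \<open>p ^ L\<close> therefore makes the total error
    \<open>W\<close> integral.\<close>
  have "\<exists>l. pge (- int l) (YY ^ i mod M)" for i by (rule pge_exists)
  then obtain l where l: "\<And>i. pge (- int (l i)) (YY ^ i mod M)" by metis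
  define L where "L = (\<Sum>i<n. l i)"
  have L: "pge (- int L) (YY ^ i mod M)" if "i < n" for i
  proof -
    have "l i \<le> L" unfolding L_def using that by (intro member_le_sum) auto
    thus ?thesis by (intro pge_mono[OF l[of i]]) simp
  qed
  have "\<exists>c. vge (int L) (of_int c - coeff P i)" for i
  proof -
    have "vge 0 (coeff P i)" using P(2) by (simp add: pge_def)
    then obtain c where "coeff P i = of_int c \<or> int L \<le> v (coeff P i - of_int c)"
      using integers_dense[of "coeff P i" "int L"] unfolding vge_def by blast
    hence "vge (int L) (coeff P i - of_int c)" by (auto simp: vge_def)
    thus ?thesis using vge_diff_commute by blast
  qed
  then obtain c where c: "\<And>i. vge (int L) (of_int (c i) - coeff P i)" by metis
  define S where "S = Y ^ n + (\<Sum>i<n. Polynomial.smult (of_int (c i)) (Y ^ i))"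
  define E where "E = S mod m"
  define W where "W = (\<Sum>i<n. Polynomial.smult (of_int (c i) - coeff P i) (YY ^ i mod M))"
  have mapS: "map_poly of_rat S = YY ^ n + (\<Sum>i<n. Polynomial.smult (of_int (c i)) (YY ^ i))"
    by (simp add: S_def of_rat_poly_hom.hom_add of_rat_poly_hom.hom_sum of_rat_hom.map_poly_hom_smult
        of_rat_poly_hom.hom_power YY_def)
  have PYY: "P \<circ>\<^sub>p YY = YY ^ n + (\<Sum>i<n. Polynomial.smult (coeff P i) (YY ^ i))"
    using P(1) unfolding pcompose_as_sum by (simp add: n_def lessThan_Suc_atMost[symmetric] add.commute)
  have "map_poly of_rat S - P \<circ>\<^sub>p YY = (\<Sum>i<n. Polynomial.smult (of_int (c i) - coeff P i) (YY ^ i))"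
    unfolding mapS PYY by (simp add: sum_subtractf smult_diff_left)
  hence "map_poly of_rat S - P \<circ>\<^sub>p YY - W =
      (\<Sum>i<n. Polynomial.smult (of_int (c i) - coeff P i) (YY ^ i - YY ^ i mod M))"
    by (simp add: W_def sum_subtractf smult_diff_right)
  also have "M dvd \<dots>"
  proof (rule dvd_sum)
    fix i
    have "M dvd YY ^ i - YY ^ i mod M" by (rule dvd_minus_mod)
    thus "M dvd Polynomial.smult (of_int (c i) - coeff P i) (YY ^ i - YY ^ i mod M)" by (rule dvd_smult)
  qed
  finally have "M dvd map_poly of_rat S - P \<circ>\<^sub>p YY - W" .
  moreover have "M dvd P \<circ>\<^sub>p YY" using dvd by (simp add: M_def YY_def)
  ultimately have "M dvd (map_poly of_rat S - P \<circ>\<^sub>p YY - W) + P \<circ>\<^sub>p YY" by (rule dvd_add)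
  hence d1: "M dvd map_poly of_rat S - W" by (simp add: algebra_simps)
  have S_eq: "S = S div m * m + E" by (simp add: E_def)
  have "map_poly of_rat S = map_poly of_rat (S div m) * M + map_poly of_rat E"
    unfolding M_def by (subst S_eq) (simp only: of_rat_poly_hom.hom_add of_rat_poly_hom.hom_mult)
  hence "map_poly of_rat E - W = (map_poly of_rat S - W) - map_poly of_rat (S div m) * M" by simp
  hence d2: "M dvd map_poly of_rat E - W" using dvd_diff[OF d1 dvd_triv_right] by (simp only:)
  have "degree E < degree m" unfolding E_def by (rule degree_mod_less_pos[OF m(1)])
  moreover have "degree (YY ^ i mod M) < degree M" for i by (rule degree_mod_less_pos[OF dM])
  hence "degree W < degree M" unfolding W_def
    by (intro degree_sum_less dM order.strict_trans1[OF degree_smult_le])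
  ultimately have "degree (map_poly of_rat E - W) < degree M" by (intro degree_diff_less) (auto simp: M_def)
  \<comment> \<open>\<open>E\<close> and \<open>W\<close> are congruent modulo \<open>M\<close>
    because \<open>P\<close> composed with \<open>Y\<close> is 0 there, and both have smaller
    degree. So a polynomial with rational coefficients inherits the \<open>p\<close>-adic
    integrality of \<open>W\<close>.\<close>
  hence EW: "map_poly of_rat E = W" using d2 by (metis dvd_imp_degree_le leD right_minus_eq)
  have "pge (int L + - int L) (Polynomial.smult (of_int (c i) - coeff P i) (YY ^ i mod M))" if "i < n" for i
    by (intro pge_smult c L that)
  hence "pge 0 W" unfolding W_def by (intro pge_sum) simp
  hence "vge 0 (of_rat (coeff E j) :: 'a)" for j unfolding EW[symmetric] by (simp add: pge_def)
  hence "\<exists>D. \<not> p dvd D \<and> of_nat D * coeff E j \<in> \<int>" for j using vge_of_rat by metis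
  then obtain D where D: "\<And>j. \<not> p dvd D j" "\<And>j. of_nat (D j) * coeff E j \<in> \<int>" by metis
  define d where "d = (\<Prod>j\<le>degree E. D j)"
  have pd: "\<not> p dvd d" using D(1) prime_p by (simp add: d_def prime_dvd_prod_iff)
  have dE: "\<exists>z::int. of_nat d * coeff E j = of_int z" if "j \<le> degree E" for j
  proof -
    have "D j dvd d" unfolding d_def using that by (intro dvd_prodI) auto
    then obtain u where "d = D j * u" by blast
    hence "of_nat d * coeff E j = of_nat u * (of_nat (D j) * coeff E j)" by simp
    also have "\<dots> \<in> \<int>" by (intro Ints_mult D) simp
    finally show ?thesis by (elim Ints_cases) blast
  qed
  have "algebraic_int (of_nat d * rpoly E \<beta>)"
  proof -
    have "of_nat d * rpoly E \<beta> = (\<Sum>j\<le>degree E. of_rat (of_nat d * coeff E j) * \<beta> ^ j)"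
      by (simp add: poly_altdef sum_distrib_left of_rat_mult mult.assoc)
    also have "integral_over \<int> \<dots>"
    proof (intro Ints_subring.integral_over_sum Ints_subring.integral_over_mult Ints_subring.integral_over_power)
      show "integral_over \<int> \<beta>" using int by (simp add: algebraic_int_iff_integral_over)
      fix j assume "j \<in> {..degree E}"
      then obtain z where "of_nat d * coeff E j = of_int z" using dE by auto
      thus "integral_over \<int> (of_rat (of_nat d * coeff E j) :: complex)"
        by (simp only: of_rat_of_int_eq Ints_subring.integral_over_of_int)
    qed
    finally show ?thesis by (simp add: algebraic_int_iff_integral_over)
  qed
  hence "algebraic_int (of_nat (d ^ (n - 1)) * (of_nat d * rpoly E \<beta>))"
    by (rule algebraic_int_mult[OF algebraic_int_of_nat])
  also have "of_nat (d ^ (n - 1)) * (of_nat d * rpoly E \<beta>) = of_nat d ^ n * rpoly E \<beta>"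
    using n by (cases n) (simp_all add: mult_ac)
  finally have E_int: "algebraic_int (of_nat d ^ n * rpoly E \<beta>)" .
  define y where "y = rpoly Y \<beta>"
  have "rpoly S \<beta> = rpoly (S div m * m + E) \<beta>" by (simp flip: S_eq)
  also have "\<dots> = rpoly E \<beta>" using m(2) by (simp add: of_rat_poly_hom.hom_add of_rat_poly_hom.hom_mult)
  finally have E_S: "rpoly E \<beta> = y ^ n + (\<Sum>i<n. of_int (c i) * y ^ i)"
    by (simp add: S_def of_rat_poly_hom.hom_add of_rat_poly_hom.hom_sum of_rat_hom.map_poly_hom_smult
        of_rat_poly_hom.hom_power y_def poly_sum)
  \<comment> \<open>q(d y) is d^n times the integer equation at \<open>y\<close>, so it equals d^n
    E(\<beta>), an algebraic integer. As \<open>q\<close> is monic over Z, \<open>d * y\<close> is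
    an algebraic integer too.\<close>
  define q where "q = monom 1 n + (\<Sum>i<n. monom (of_int (c i) * of_nat d ^ (n - i)) i :: complex poly)"
  have cq: "coeff q i = (if i < n then of_int (c i) * of_nat d ^ (n - i) else if i = n then 1 else 0)" for i
    by (simp add: q_def coeff_sum)
  have "degree q \<le> n" by (rule degree_le) (simp add: cq)
  moreover have "degree q \<ge> n" by (rule le_degree) (simp add: cq)
  ultimately have dq: "degree q = n" by simp
  have "algebraic_int (of_nat d * y)"
  proof (rule algebraic_int_root[OF E_int])
    have "of_nat d ^ (n - i) * (of_nat d * y) ^ i = of_nat d ^ n * y ^ i" if "i < n" for i
      using that by (simp add: power_mult_distrib mult.assoc[symmetric] flip: power_add)
    hence "(\<Sum>i<n. of_int (c i) * (of_nat d ^ (n - i) * (of_nat d * y) ^ i)) =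
        (\<Sum>i<n. of_int (c i) * (of_nat d ^ n * y ^ i))" by (intro sum.cong) auto
    thus "poly q (of_nat d * y) = of_nat d ^ n * rpoly E \<beta>"
      by (simp add: q_def poly_monom poly_sum E_S mult.assoc power_mult_distrib[of _ y n] ring_distribs
          sum_distrib_left mult.left_commute)
    show "\<forall>i. coeff q i \<in> \<int>" by (auto simp: cq)
    show "lead_coeff q = 1" by (simp add: dq cq)
    show "degree q > 0" using n by (simp add: dq)
  qed
  thus ?thesis using pd by (auto simp: y_def)
qed

text \<open>For each irreducible factor \<open>g\<close> over Q_p a monic \<open>R\<close> over Z_p
  is found such that \<open>g\<close> divides \<open>R\<close> composed with \<open>Y\<close>: a
  linear polynomial at a root in Q_p, an equation of Y(\<xi>) at one root \<xi> otherwise. The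
  product of these polynomials enters the preceding lemma.\<close>

lemma p_integral_criterion:
  assumes m: "Factorial_Ring.irreducible m" "lead_coeff m = 1" "rpoly m \<beta> = 0"
    and int: "algebraic_int (\<beta> :: complex)"
    and lin: "\<And>z::'a. rpoly m z = 0 \<Longrightarrow> vge 0 (rpoly Y z)"
    and nonlin: "\<And>g \<xi>. lead_coeff g = 1 \<Longrightarrow> Factorial_Ring.irreducible g \<Longrightarrow> degree g > 1 \<Longrightarrow>
      g dvd map_poly of_rat m \<Longrightarrow> poly (map_poly to_ac g) \<xi> = 0 \<Longrightarrow>
      integral_over (to_ac ` val_ring) (rpoly Y \<xi>)"
  shows "\<exists>D. \<not> p dvd D \<and> algebraic_int (of_nat D * rpoly Y \<beta>)"
proof -
  define M where "M = (map_poly of_rat m :: 'a poly)"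
  define YY where "YY = (map_poly of_rat Y :: 'a poly)"
  have "\<exists>P. lead_coeff P = 1 \<and> pge 0 P \<and> f dvd P \<circ>\<^sub>p YY" if "lead_coeff f = 1" "f dvd M" for f
    using that
  proof (induction rule: monic_factor_induct)
    case one
    show ?case by (intro exI[of _ 1]) (simp add: pge_1)
  next
    case (mult g f)
    then obtain P where P: "lead_coeff P = 1" "pge 0 P" "f dvd P \<circ>\<^sub>p YY" by blast
    have "\<exists>R. lead_coeff R = 1 \<and> pge 0 R \<and> g dvd R \<circ>\<^sub>p YY"
    proof (cases "degree g = 1")
      case True
      then obtain c b where "g = [:c, b:]" by (metis degree1_coeffs)
      hence g: "g = [:c, 1:]" using mult.hyps(1) True by (auto split: if_splits)
      have root: "rpoly m (- c) = 0" using mult.hyps(3) by (auto simp: g M_def elim!: dvdE)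
      define R where "R = [:- rpoly Y (- c), 1:]"
      have "poly (R \<circ>\<^sub>p YY) (- c) = 0" by (simp add: R_def poly_pcompose YY_def)
      hence "g dvd R \<circ>\<^sub>p YY" by (simp add: g poly_eq_0_iff_dvd)
      moreover have "pge 0 R" using lin[OF root] by (auto simp: R_def pge_def coeff_pCons split: nat.splits)
      ultimately show ?thesis by (intro exI[of _ R]) (simp add: R_def)
    next
      case False
      hence d: "degree g > 1" using mult.hyps(2) by (simp add: irreducible_poly_iff_degree)
      obtain \<xi> where \<xi>: "poly (map_poly to_ac g) \<xi> = 0"
        using alg_closed_imp_poly_has_root[of "map_poly to_ac g"] d by auto
      from nonlin[OF mult.hyps(1,2) d _ \<xi>] mult.hyps(3)
      obtain Q where Q: "lead_coeff Q = 1" "\<And>i. coeff Q i \<in> to_ac ` val_ring" "poly Q (rpoly Y \<xi>) = 0"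
        unfolding M_def integral_over_def by blast
      define R where "R = map_poly of_ac Q"
      have QR: "Q = map_poly to_ac R"
      proof (rule poly_eqI)
        fix i
        obtain a where "coeff Q i = to_ac a" using Q(2) by blast
        thus "coeff Q i = coeff (map_poly to_ac R) i" by (simp add: R_def coeff_map_poly)
      qed
      have "lead_coeff R = 1" using Q(1) unfolding QR by simp
      moreover have "coeff R i \<in> val_ring" for i
        using Q(2)[of i] unfolding QR by auto
      hence "pge 0 R" by (simp add: pge_0_iff)
      moreover have "field_hom (to_ac :: 'a \<Rightarrow> _)" ..
      hence "g dvd R \<circ>\<^sub>p YY"
      proof (rule irreducible_dvd_of_common_root[OF _ mult.hyps(2) \<xi>])
        show "poly (map_poly to_ac (R \<circ>\<^sub>p YY)) \<xi> = 0"
          using Q(3) unfolding QR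
          by (simp add: to_ac_hom.map_poly_pcompose poly_pcompose YY_def map_poly_to_ac_of_rat)
      qed
      ultimately show ?thesis by blast
    qed
    then obtain R where R: "lead_coeff R = 1" "pge 0 R" "g dvd R \<circ>\<^sub>p YY" by blast
    show ?case
    proof (intro exI conjI)
      show "lead_coeff (R * P) = 1" using P R by (simp add: lead_coeff_mult)
      show "pge 0 (R * P)" using pge_mult[OF R(2) P(2)] by simp
      show "g * f dvd (R * P) \<circ>\<^sub>p YY" using P R by (simp add: pcompose_mult mult_dvd_mono)
    qed
  qed
  from this[of M] obtain P where "lead_coeff P = 1" "pge 0 P" "M dvd P \<circ>\<^sub>p YY"
    using m(2) by (auto simp: M_def)
  thus ?thesis
    using m(1,3) int by (intro p_integral_of_padic_equation) (auto simp: M_def YY_def irreducible_poly_iff_degree)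
qed

end

section \<open>Local analysis of \<open>\<alpha>\<^sub>p\<close>\<close>

lemma rpoly_binom_poly [simp]:
  fixes x :: "'a::field_char_0" shows "rpoly (binom_poly k) x = (x gchoose k)"
proof -
  have f: "of_rat (fact k) = (fact k :: 'a)" by (metis of_nat_fact of_rat_of_nat_eq)
  have l: "map_poly of_rat [:- of_nat i, 1:] = ([:- of_nat i, 1:] :: 'a poly)" for i
    by (simp add: of_rat_hom.map_poly_pCons_hom of_rat_minus)
  have "map_poly of_rat (binom_poly k) = (binom_poly k :: 'a poly)"
    unfolding binom_poly_def of_rat_hom.map_poly_hom_smult of_rat_poly_hom.hom_prod l
    by (simp add: of_rat_divide f)
  thus ?thesis by simp
qed

text \<open>Of the \<open>k + s\<close> factors \<open>c\<close>, the first \<open>k\<close>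
  multiply the linear factors of the numerator; the remaining \<open>s\<close> are kept to cancel
  the \<open>p\<close>-part of k!.\<close>

lemma gchoose_mult_power:
  fixes x c :: "'a::field_char_0"
  shows "(x gchoose k) * c ^ (k + s) = (\<Prod>i<k. c * x - c * of_nat i) * c ^ s / fact k"
proof -
  have "(\<Prod>i<k. c * x - c * of_nat i) = c ^ k * (\<Prod>i<k. x - of_nat i)"
    by (simp add: prod.distrib flip: right_diff_distrib)
  thus ?thesis by (simp add: gbinomial_prod_rev atLeast0LessThan power_add)
qed

context padic_valued_field
begin

lemma vge_poly_diff:
  assumes "pge 0 f" "vge 0 x" "vge 0 y" "vge k (x - y)"
  shows "vge k (poly f x - poly f y)"
  using assms(1)
proof (induction f)
  case (pCons c f)
  have pf: "pge 0 f" unfolding pge_def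
  proof
    fix i show "vge 0 (coeff f i)" using pCons.prems by (auto simp: pge_def coeff_pCons dest: spec[of _ "Suc i"])
  qed
  have "poly (pCons c f) x - poly (pCons c f) y = x * (poly f x - poly f y) + (x - y) * poly f y"
    by (simp add: algebra_simps)
  also have "vge (0 + k) (x * (poly f x - poly f y)) \<and> vge (k + 0) ((x - y) * poly f y)"
    using pCons.IH[OF pf] vge_poly[OF pf assms(3)] assms by (intro conjI vge_mult)
  hence "vge k (x * (poly f x - poly f y) + (x - y) * poly f y)" by (intro vge_add) auto
  finally show ?case .
qed simp

lemma v_fact_nonneg: "v (fact k) \<ge> 0"
  using v_of_int[of "fact k"] by simp

text \<open>Approximate \<open>x\<close> by an integer n modulo the \<open>p\<close>-part of k!. The
  numerators at \<open>x\<close> and n then agree modulo this power, and the one at n is k! times an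
  integer.\<close>

lemma vge_gchoose:
  assumes "vge 0 x" shows "vge 0 (x gchoose k)"
proof -
  define f where "f = (\<Prod>i<k. [:- of_nat i, 1:] :: 'a poly)"
  have f: "poly f x = fact k * (x gchoose k)" for x
    by (simp add: f_def poly_prod gbinomial_prod_rev atLeast0LessThan)
  have pf: "pge 0 f" unfolding pge_0_iff f_def
    by (intro allI val_ring.coeff_prod_S) (auto simp: coeff_pCons val_ring.of_nat_S split: nat.splits)
  obtain n :: int where n: "x = of_int n \<or> v (fact k) \<le> v (x - of_int n)"
    using integers_dense[of x "v (fact k)"] assms by (auto simp: vge_def)
  hence "vge (v (fact k)) (x - of_int n)" by (auto simp: vge_def)
  hence "vge (v (fact k)) (poly f x - poly f (of_int n))"
    using val_ring.of_int_S[of n] by (intro vge_poly_diff pf assms) (auto simp: val_ring_def)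
  moreover have "vge (v (fact k) + 0) (poly f (of_int n))"
    unfolding f using val_ring.of_int_S[of "int_gchoose n k"]
    by (intro vge_mult vge_v) (simp add: val_ring_def flip: of_int_int_gchoose)
  ultimately have "vge (v (fact k)) (poly f x - poly f (of_int n) + poly f (of_int n))"
    by (intro vge_add) auto
  hence "vge (v (fact k)) (fact k * (x gchoose k))" by (simp add: f)
  thus ?thesis by (cases "(x gchoose k) = 0") (auto simp: vge_def v_mult)
qed

end

text \<open>The data of the definition, with valuations of differences of roots in place of
  congruences. The sum over \<open>w\<close> is k_i. As v(g(n)) is deg g times v(n - y) for a root y
  of \<open>g\<close>, assumption \<open>N\<close> bounds v(n - y) without mentioning y.\<close>

locale padic_alpha = padic_valued_field +
  fixes \<beta> :: complex and m :: "rat poly" and r :: "'a \<Rightarrow> int" and K k N :: nat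
  assumes \<beta>_int: "algebraic_int \<beta>"
    and m_irr: "Factorial_Ring.irreducible m" and m_monic: "lead_coeff m = 1" and m_root: "rpoly m \<beta> = 0"
    and k_pos: "k > 0"
    and sep: "\<And>z w. rpoly m z = 0 \<Longrightarrow> rpoly m w = 0 \<Longrightarrow> z \<noteq> w \<Longrightarrow> v (z - w) < int k"
    and K: "\<And>z. rpoly m z = 0 \<Longrightarrow> (\<Sum>w\<in>{w. rpoly m w = 0} - {z}. v (w - z)) \<le> int K"
    and N: "\<And>g n. lead_coeff g = 1 \<Longrightarrow> Factorial_Ring.irreducible g \<Longrightarrow> degree g > 1 \<Longrightarrow>
      g dvd map_poly of_rat m \<Longrightarrow> v (poly g (of_int n)) \<le> int (degree g * N)"
    and r_ne: "\<And>z. rpoly m z = 0 \<Longrightarrow> of_int (r z) \<noteq> z"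
    and r: "\<And>z. rpoly m z = 0 \<Longrightarrow> v (of_int (r z) - z) =
      int K - (\<Sum>w\<in>{w. rpoly m w = 0} - {z}. v (w - z)) + int k + int (card {w::'a. rpoly m w = 0} * N)"
begin

definition Z :: "'a set" where "Z = {z. rpoly m z = 0}"

definition e :: nat where "e = K + k + card Z * N"

definition H :: "int poly" where "H = (\<Prod>z\<in>Z. [:- r z, 1:])"

definition a :: complex where "a = (\<Prod>z\<in>Z. \<beta> - of_int (r z)) / of_nat p ^ e"

definition Aq :: "rat poly" where "Aq = Polynomial.smult (1 / of_nat p ^ e) (\<Prod>z\<in>Z. [:- of_int (r z), 1:])"

lemma m_integral: "pge 0 (map_poly of_rat m)"
  by (rule integral_min_poly[OF m_irr m_monic m_root \<beta>_int])

lemma finite_Z: "finite Z"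
  using poly_roots_finite[of "map_poly of_rat m :: 'a poly"] m_irr by (auto simp: Z_def)

lemma rpoly_Aq: "rpoly Aq x = (\<Prod>z\<in>Z. x - of_int (r z)) / of_nat p ^ e"
  by (simp add: Aq_def of_rat_hom.map_poly_hom_smult of_rat_poly_hom.hom_prod poly_prod
      of_rat_hom.map_poly_pCons_hom of_rat_minus of_rat_divide of_rat_power divide_inverse mult.commute
      of_rat_inverse)

lemma v_r: "z \<in> Z \<Longrightarrow> v (z - of_int (r z)) = int K - (\<Sum>w\<in>Z - {z}. v (w - z)) + int k + int (card Z * N)"
  using r[of z] v_minus[of "z - of_int (r z)"] by (simp add: Z_def)

lemma v_r_ge: assumes "z \<in> Z" shows "v (z - of_int (r z)) \<ge> int k"
proof -
  have "(\<Sum>w\<in>Z - {z}. v (w - z)) \<le> int K" using K[of z] assms by (simp add: Z_def)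
  moreover have "int (card Z * N) \<ge> 0" by (rule of_nat_0_le_iff)
  ultimately show ?thesis using v_r[OF assms] by linarith
qed

text \<open>\<open>r w\<close> is closer to \<open>w\<close> than any other root is, since v(w - r
  w) is at least \<open>k\<close> and \<open>k\<close> separates the roots. By the ultrametric
  inequality it looks from \<open>z\<close> just like \<open>w\<close>.\<close>

lemma v_r_other:
  assumes "z \<in> Z" "w \<in> Z" "z \<noteq> w"
  shows "z \<noteq> of_int (r w)" "v (z - of_int (r w)) = v (w - z)"
proof -
  have lt: "v (w - z) < int k" using sep[of w z] assms by (auto simp: Z_def)
  have wr: "vge (int k) (w - of_int (r w))" using v_r_ge[OF assms(2)] by (simp add: vge_def)
  show ne: "z \<noteq> of_int (r w)"
    using wr lt assms(3) by (auto simp: vge_def)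
  have 1: "\<not> vge (v (w - z) + 1) (w - z)" using assms(3) by (simp add: vge_def)
  have "\<not> vge (v (w - z) + 1) (z - of_int (r w))"
  proof
    assume *: "vge (v (w - z) + 1) (z - of_int (r w))"
    have "vge (v (w - z) + 1) ((w - of_int (r w)) - (z - of_int (r w)))"
      by (intro vge_diff * vge_mono[OF wr]) (use lt in simp)
    thus False using 1 by simp
  qed
  moreover have "vge (v (w - z)) ((w - of_int (r w)) - (w - z))"
    by (intro vge_diff vge_v vge_mono[OF wr]) (use lt in simp)
  hence "vge (v (w - z)) (z - of_int (r w))" by simp
  ultimately show "v (z - of_int (r w)) = v (w - z)" using ne by (auto simp: vge_def)
qed

lemma z_ne_r: "z \<in> Z \<Longrightarrow> w \<in> Z \<Longrightarrow> z \<noteq> of_int (r w)"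
  using v_r_other(1)[of z w] r_ne[of z] by (cases "z = w") (auto simp: Z_def)

text \<open>The factor at \<open>z\<close> contributes K - k_i + k + qN and the other factors
  contribute k_i, so the total does not depend on \<open>z\<close>. This is the purpose of the
  exponents m_i.\<close>

lemma sum_v_r: "z \<in> Z \<Longrightarrow> (\<Sum>w\<in>Z. v (z - of_int (r w))) = int e"
proof -
  assume z: "z \<in> Z"
  have "(\<Sum>w\<in>Z. v (z - of_int (r w))) = v (z - of_int (r z)) + (\<Sum>w\<in>Z - {z}. v (z - of_int (r w)))"
    using finite_Z z by (simp add: sum.remove)
  also have "(\<Sum>w\<in>Z - {z}. v (z - of_int (r w))) = (\<Sum>w\<in>Z - {z}. v (w - z))"
    using z v_r_other(2)[of z] by (intro sum.cong) auto
  finally show ?thesis using v_r[OF z] by (simp add: e_def)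
qed

lemma rpoly_Aq_unit: "z \<in> Z \<Longrightarrow> rpoly Aq z \<noteq> 0 \<and> v (rpoly Aq z) = 0"
proof -
  assume z: "z \<in> Z"
  hence nz: "(\<Prod>w\<in>Z. z - of_int (r w)) \<noteq> 0" using z_ne_r finite_Z by (auto simp: prod_zero_iff)
  have "v (\<Prod>w\<in>Z. z - of_int (r w)) = int e"
    using z_ne_r[OF z] sum_v_r[OF z] by (subst v_prod) auto
  thus ?thesis using nz by (simp add: rpoly_Aq v_divide)
qed

lemma a_eq: "a = rpoly Aq \<beta>" by (simp add: a_def rpoly_Aq)

text \<open>If \<beta> were an integer \<open>r w\<close>, its conjugate \<open>w\<close> would be
  the same integer, contrary to \<open>r_ne\<close>.\<close>

lemma a_nonzero: "a \<noteq> 0"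
proof
  assume "a = 0"
  then obtain w where w: "w \<in> Z" "\<beta> = of_int (r w)" using finite_Z by (auto simp: a_def)
  have "rpoly [:- of_int (r w), 1:] w = 0"
    by (rule rat_root_transfer[OF m_irr m_root])
      (use w in \<open>auto simp: Z_def of_rat_hom.map_poly_pCons_hom of_rat_minus\<close>)
  hence "w = of_int (r w)" by (simp add: of_rat_hom.map_poly_pCons_hom of_rat_minus)
  thus False using r_ne[of w] w by (simp add: Z_def)
qed

text \<open>If m(n) is highly divisible by \<open>p\<close>, then n is so close to a root
  \<open>z\<close> that each n - r(w) has valuation at least that of z - r(w). By
  \<open>sum_v_r\<close> the product H(n) is then divisible by \<open>p ^ e\<close>.\<close>

lemma a_in_int_valued_image: "a \<in> int_valued_image \<beta>"
proof -
  obtain D m' where D: "D > 0" "Polynomial.smult (of_nat D) m = map_poly of_int m'"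
    by (rule rat_poly_clear_denominators)
  have m'_root: "poly (map_poly of_int m') \<beta> = 0"
    using rpoly_clear_denominators[OF D, of \<beta>] m_root by simp
  have m': "of_nat D * poly (map_poly of_rat m) (of_int n :: 'a) = of_int (poly m' n)" for n
    using rpoly_clear_denominators[OF D, of "of_int n :: 'a"] by (simp add: of_int_hom.poly_map_poly)
  obtain T :: nat where T: "\<And>z w. z \<in> Z \<Longrightarrow> w \<in> Z \<Longrightarrow> v (z - of_int (r w)) \<le> int T"
  proof -
    define T where "T = (\<Sum>z\<in>Z. \<Sum>w\<in>Z. nat (v (z - of_int (r w))))"
    have "v (z - of_int (r w)) \<le> int T" if "z \<in> Z" "w \<in> Z" for z w
    proof -
      have "nat (v (z - of_int (r w))) \<le> (\<Sum>w\<in>Z. nat (v (z - of_int (r w))))"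
        using that finite_Z by (intro member_le_sum) auto
      also have "\<dots> \<le> T" unfolding T_def
        using that finite_Z by (intro member_le_sum[of z Z "\<lambda>z. \<Sum>w\<in>Z. nat (v (z - of_int (r w)))"]) auto
      finally show ?thesis by linarith
    qed
    thus ?thesis by (rule that)
  qed
  obtain t where t: "\<And>x. vge 0 x \<Longrightarrow> vge (int t) (poly (map_poly of_rat m) x) \<Longrightarrow>
      \<exists>z. poly (map_poly of_rat m) z = 0 \<and> vge (int T) (x - z)"
    using near_root[of "map_poly of_rat m" T] m_monic m_integral by auto
  \<comment> \<open>Passing from \<open>m\<close> to the integer polynomial \<open>m'\<close>
    multiplies by \<open>D\<close>, so the threshold \<open>t\<close> from \<open>near_root\<close>
    has to be raised by v(D).\<close>
  define d where "d = nat (v (of_nat D))"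
  have vD: "v (of_nat D) = int d" using v_of_int[of "int D"] D(1) by (simp add: d_def)
  have loc: "int p ^ e dvd poly H n" if "int p ^ (t + d) dvd poly m' n" for n
  proof -
    have "vge (int (t + d)) (of_nat D * poly (map_poly of_rat m) (of_int n))"
      unfolding m' using that by (simp only: vge_of_int_iff)
    hence "vge (int t) (poly (map_poly of_rat m) (of_int n))"
      using vD D(1) by (cases "rpoly m (of_int n :: 'a) = 0") (auto simp: vge_def v_mult)
    moreover have "vge 0 (of_int n)" using val_ring.of_int_S[of n] by (simp add: val_ring_def)
    ultimately obtain z where z: "z \<in> Z" "vge (int T) (of_int n - z)" using t by (auto simp: Z_def)
    have "vge (\<Sum>w\<in>W. v (z - of_int (r w))) (\<Prod>w\<in>W. of_int n - of_int (r w))" if "W \<subseteq> Z" for W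
      using finite_subset[OF that finite_Z] that
    proof (induction W rule: finite_induct)
      case (insert w W)
      have "vge (v (z - of_int (r w))) ((of_int n - z) + (z - of_int (r w)))"
        using T[OF z(1), of w] insert.prems by (intro vge_add vge_v vge_mono[OF z(2)]) auto
      thus ?case using insert by (auto intro!: vge_mult)
    qed simp
    from this[of Z] have "vge (int e) (\<Prod>w\<in>Z. of_int n - of_int (r w))" using sum_v_r[OF z(1)] by simp
    also have "(\<Prod>w\<in>Z. of_int n - of_int (r w)) = (of_int (poly H n) :: 'a)" by (simp add: H_def poly_prod)
    finally show ?thesis by (simp only: vge_of_int_iff)
  qed
  have "poly (map_poly of_int H) \<beta> / of_nat p ^ e \<in> int_valued_image \<beta>"
    by (rule local_in_int_valued_image[OF prime_p m'_root loc])
  also have "poly (map_poly of_int H) \<beta> / of_nat p ^ e = a"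
    by (simp add: H_def a_def of_int_poly_hom.hom_prod poly_prod of_int_hom.map_poly_pCons_hom)
  finally show ?thesis .
qed

text \<open>A polynomial rather than a quotient, so that the inverse of \<open>a\<close> can be
  evaluated at all conjugates and fed to \<open>p_integral_criterion\<close>. At every root of
  \<open>m\<close> it inverts \<open>Aq\<close>.\<close>

definition Bq :: "rat poly" where "Bq = (SOME q. inverse a = rpoly q \<beta>)"

lemma rpoly_Bq: "rpoly Bq \<beta> = inverse a"
proof -
  have "a \<in> number_field \<beta>" unfolding a_def
    by (intro number_field_divide number_field.prod_S number_field.diff_S number_field.of_int_S
        number_field.power_S number_field.of_nat_S number_field_generator)
  hence "\<exists>q. inverse a = rpoly q \<beta>"
    using number_field_repr[OF algebraic_int_imp_algebraic[OF \<beta>_int] number_field_inverse] by blast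
  from someI_ex[OF this] show ?thesis by (simp add: Bq_def)
qed

lemma rpoly_Bq_root:
  fixes x :: "'b::field_char_0"
  assumes "rpoly m x = 0"
  shows "rpoly Bq x = inverse (rpoly Aq x)"
proof -
  have "rpoly (Aq * Bq - 1) x = 0"
    by (rule rat_root_transfer[OF m_irr m_root _ assms])
      (use a_nonzero in \<open>simp add: of_rat_poly_hom.hom_minus of_rat_poly_hom.hom_mult rpoly_Bq flip: a_eq\<close>)
  hence "rpoly Aq x * rpoly Bq x = 1" by (simp add: of_rat_poly_hom.hom_minus of_rat_poly_hom.hom_mult)
  thus ?thesis by (rule inverse_unique[symmetric])
qed

lemma vge_Bq: assumes "rpoly m z = 0" shows "vge 0 (rpoly Bq z)"
  unfolding rpoly_Bq_root[OF assms] using rpoly_Aq_unit[of z] assms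
  by (simp add: Z_def vge_def v_inverse)

text \<open>\<open>Bq\<close> at \<xi> is \<open>p ^ e\<close> divided by the product of the \<xi> -
  r(w). Each factor takes a \<open>p ^ N\<close> and becomes integral by
  \<open>integral_inverse_of_root\<close>. Of the remaining \<open>p ^ (K + k)\<close> one factor
  \<open>p\<close> is split off, possible as \<open>k > 0\<close>; it makes the value not just
  integral but divisible by \<open>p\<close>.\<close>

lemma Bq_nonlinear:
  assumes g: "lead_coeff g = 1" "Factorial_Ring.irreducible g" "degree g > 1" "g dvd map_poly of_rat m"
    and root: "poly (map_poly to_ac g) \<xi> = 0"
  obtains y where "rpoly Bq \<xi> = of_nat p * y" "integral_over (to_ac ` val_ring) y"
proof -
  obtain h where h: "map_poly of_rat m = g * h" using g(4) by blast
  have "rpoly m \<xi> = poly (map_poly to_ac (map_poly of_rat m)) \<xi>" by (simp add: map_poly_to_ac_of_rat)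
  also have "\<dots> = 0" unfolding h using root by (simp add: to_ac_poly_hom.hom_mult)
  finally have m\<xi>: "rpoly m \<xi> = 0" .
  have g_ne: "poly g (of_int n) \<noteq> 0" for n
  proof
    assume "poly g (of_int n) = 0"
    then obtain f where f: "g = [:- of_int n, 1:] * f" by (auto simp: poly_eq_0_iff_dvd elim!: dvdE)
    have "degree [:- of_int n, 1::'a:] = 0 \<or> degree f = 0"
      using f by (rule g(2)[unfolded irreducible_poly_iff_degree, THEN conjunct2, rule_format])
    hence df: "degree f = 0" by simp
    have "degree g \<le> degree [:- of_int n, 1::'a:] + degree f" unfolding f by (rule degree_mult_le)
    thus False using df g(3) by simp
  qed
  define y where "y = of_nat p ^ (K + k - 1) * (\<Prod>w\<in>Z. of_nat p ^ N / (\<xi> - of_int (r w)))"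
  have "integral_over (to_ac ` val_ring) (of_nat p ^ N / (\<xi> - to_ac (of_int (r w))))" for w
    by (rule integral_inverse_of_root[OF g(2,1) root g_ne N[OF g]])
  hence int: "integral_over (to_ac ` val_ring) (of_nat p ^ N / (\<xi> - of_int (r w)))" for w by simp
  have y_int: "integral_over (to_ac ` val_ring) y" unfolding y_def
    by (intro ac.integral_over_mult ac.integral_over_prod int ac.integral_over_base[OF ac.power_S[OF ac.of_nat_S]])
  have "rpoly Bq \<xi> = of_nat p * y"
  proof -
    have "rpoly Bq \<xi> = of_nat p ^ e / (\<Prod>w\<in>Z. \<xi> - of_int (r w))"
      by (simp add: rpoly_Bq_root[OF m\<xi>] rpoly_Aq)
    also have "(of_nat p :: 'a alg_closure) ^ e = of_nat p * of_nat p ^ (K + k - 1) * (of_nat p ^ N) ^ card Z"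
      using k_pos by (simp add: e_def flip: power_Suc power_mult power_add) (simp add: mult.commute add_ac)
    finally show ?thesis by (simp add: y_def prod_dividef)
  qed
  thus ?thesis using y_int by (rule that)
qed

lemma inverse_a_p_integral: "\<exists>D. \<not> p dvd D \<and> algebraic_int (of_nat D * inverse a)"
proof -
  have "integral_over (to_ac ` val_ring) (rpoly Bq \<xi>)"
    if g: "lead_coeff g = 1" "Factorial_Ring.irreducible g" "degree g > 1" "g dvd map_poly of_rat m"
      "poly (map_poly to_ac g) \<xi> = 0" for g \<xi>
  proof -
    obtain y where "rpoly Bq \<xi> = of_nat p * y" "integral_over (to_ac ` val_ring) y"
      by (rule Bq_nonlinear[OF g])
    thus ?thesis by (simp add: ac.integral_over_mult ac.integral_over_base ac.of_nat_S)
  qed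
  from p_integral_criterion[OF m_irr m_monic m_root \<beta>_int vge_Bq this]
  show ?thesis by (simp add: rpoly_Bq)
qed

text \<open>With \<open>s = v (fact l)\<close> take \<open>L = l + s\<close> and
  \<open>M = s\<close>. By \<open>gchoose_mult_power\<close>, \<open>l\<close> of the factors
  \<open>c\<close> make the numerator integral. The \<open>p ^ s\<close> in l! is handled according
  to the conjugate: at a root in Z_p either the binomial coefficient is integral or \<open>p\<close>
  divides \<open>c\<close>, and at the others each factor \<open>inverse a\<close> supplies a
  \<open>p\<close>.\<close>

lemma binomial_p_integral:
  assumes \<delta>: "\<delta> > 0" and c: "c \<in> number_field \<beta>" "algebraic_int c" "algebraic_int (c * (\<beta> / of_nat \<delta>))"
  shows "\<exists>M L D. \<not> p dvd D \<and>
    algebraic_int (of_nat D * ((\<beta> / of_nat \<delta> gchoose l) * c ^ L * inverse a ^ M))"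
proof -
  obtain C where C: "c = rpoly C \<beta>"
    using number_field_repr[OF algebraic_int_imp_algebraic[OF \<beta>_int] c(1)] by blast
  define s where "s = nat (v (fact l))"
  have s: "v (fact l) = int s" using v_fact_nonneg by (simp add: s_def)
  define X1 where "X1 = [:0, 1 / of_nat \<delta> :: rat:]"
  have X1: "rpoly X1 x = x / of_nat \<delta>" for x :: "'b::field_char_0"
    by (simp add: X1_def of_rat_hom.map_poly_pCons_hom of_rat_divide)
  define Y where "Y = (binom_poly l \<circ>\<^sub>p X1) * C ^ (l + s) * Bq ^ s"
  have Y: "rpoly Y x = (x / of_nat \<delta> gchoose l) * rpoly C x ^ (l + s) * rpoly Bq x ^ s" for x :: "'b::field_char_0"
    by (simp add: Y_def of_rat_poly_hom.hom_mult of_rat_poly_hom.hom_power of_rat_hom.map_poly_pcompose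
        poly_pcompose X1)
  have C_int: "algebraic_int (rpoly C x)" if "rpoly m x = 0" for x :: "'b::field_char_0"
    by (rule algebraic_int_transfer[OF m_irr m_root that]) (use c C in simp)
  have CX_int: "algebraic_int (rpoly C x * (x / of_nat \<delta>))" if "rpoly m x = 0" for x :: "'b::field_char_0"
    using algebraic_int_transfer[OF m_irr m_root that, of "C * X1"] c C
    by (simp add: of_rat_poly_hom.hom_mult X1)
  have lin: "vge 0 (rpoly Y z)" if z: "rpoly m z = 0" for z :: 'a
  proof -
    define \<zeta> where "\<zeta> = z / of_nat \<delta>"
    define C' where "C' = rpoly C z"
    have C': "vge 0 C'" "vge 0 (C' * \<zeta>)"
      using algebraic_int_imp_vge[OF C_int[OF z]] algebraic_int_imp_vge[OF CX_int[OF z]] by (auto simp: C'_def \<zeta>_def)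
    hence C'p: "vge 0 (C' ^ n)" for n using val_ring.power_S[of C' n] by (simp add: val_ring_def)
    have B: "vge 0 (rpoly Bq z ^ s)" using vge_Bq[OF z] val_ring.power_S[of "rpoly Bq z" s] by (simp add: val_ring_def)
    have "vge 0 ((\<zeta> gchoose l) * C' ^ (l + s))"
    proof (cases "vge 0 \<zeta>")
      case True
      show ?thesis using vge_mult[OF vge_gchoose[OF True] C'p] by simp
    next
      case False
      \<comment> \<open>\<zeta> is not integral but \<open>C' * \<zeta>\<close> is, so
        \<open>p\<close> divides \<open>C'\<close> and \<open>C' ^ s\<close> cancels the
        \<open>p\<close>-part of l!.\<close>
      hence "vge 1 C'" using C' by (cases "C' = 0") (auto simp: vge_def v_mult)
      hence "vge (int s) (C' ^ s)" by (cases "C' = 0") (auto simp: vge_def v_power mult_le_cancel_left1 power_0_left)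
      moreover have "C' * \<zeta> - C' * of_nat i \<in> val_ring" for i
        using C' by (intro val_ring.diff_S val_ring.mult_S[OF _ val_ring.of_nat_S]) (auto simp: val_ring_def)
      hence "vge 0 (\<Prod>i<l. C' * \<zeta> - C' * of_nat i)"
        using val_ring.prod_S[of "{..<l}" "\<lambda>i. C' * \<zeta> - C' * of_nat i"] by (simp add: val_ring_def)
      ultimately have "vge (0 + int s) ((\<Prod>i<l. C' * \<zeta> - C' * of_nat i) * C' ^ s)" by (intro vge_mult)
      moreover have "vge (- int s) (inverse (fact l))" using s by (simp add: vge_def v_inverse)
      ultimately have "vge (0 + int s + - int s) ((\<Prod>i<l. C' * \<zeta> - C' * of_nat i) * C' ^ s * inverse (fact l))"
        by (rule vge_mult)
      thus ?thesis by (simp add: gchoose_mult_power divide_inverse)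
    qed
    from vge_mult[OF this B] show ?thesis by (simp add: Y \<zeta>_def C'_def)
  qed
  have nonlin: "integral_over (to_ac ` val_ring) (rpoly Y \<xi>)"
    if g: "lead_coeff g = 1" "Factorial_Ring.irreducible g" "degree g > 1" "g dvd map_poly of_rat m"
      and root: "poly (map_poly to_ac g) \<xi> = 0" for g \<xi>
  proof -
    obtain h where h: "map_poly of_rat m = g * h" using g(4) by blast
    have "rpoly m \<xi> = poly (map_poly to_ac (map_poly of_rat m)) \<xi>" by (simp add: map_poly_to_ac_of_rat)
    also have "\<dots> = 0" unfolding h using root by (simp add: to_ac_poly_hom.hom_mult)
    finally have m\<xi>: "rpoly m \<xi> = 0" .
    obtain y where y: "rpoly Bq \<xi> = of_nat p * y" "integral_over (to_ac ` val_ring) y"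
      by (rule Bq_nonlinear[OF g root])
    define \<zeta> where "\<zeta> = \<xi> / of_nat \<delta>"
    define C' where "C' = rpoly C \<xi>"
    have C': "integral_over (to_ac ` val_ring) C'" "integral_over (to_ac ` val_ring) (C' * \<zeta>)"
      using algebraic_int_imp_integral_ac[OF C_int[OF m\<xi>]] algebraic_int_imp_integral_ac[OF CX_int[OF m\<xi>]]
      by (auto simp: C'_def \<zeta>_def)
    have "of_nat p ^ s / fact l \<in> val_ring" using s by (simp add: val_ring_def vge_def v_divide)
    hence f: "to_ac (of_nat p ^ s / fact l) \<in> to_ac ` val_ring" by blast
    have fe: "to_ac (of_nat p ^ s / fact l :: 'a) = of_nat p ^ s / fact l"
    proof -
      have "to_ac (fact l :: 'a) = fact l" by (metis of_nat_fact to_ac_of_nat)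
      thus ?thesis by simp
    qed
    have "rpoly Y \<xi> = (\<Prod>i<l. C' * \<zeta> - C' * of_nat i) * C' ^ s * y ^ s * to_ac (of_nat p ^ s / fact l)"
      unfolding fe using gchoose_mult_power[of \<zeta> l C' s]
      by (simp add: Y y power_mult_distrib flip: \<zeta>_def C'_def)
    moreover have factor: "integral_over (to_ac ` val_ring) (C' * \<zeta> - C' * of_nat i)" for i
      using ac.integral_over_add[OF C'(2) ac.integral_over_minus[OF ac.integral_over_mult[OF C'(1) ac.integral_over_base[OF ac.of_nat_S]]]]
      by simp
    ultimately show ?thesis
      by (simp only:) (intro ac.integral_over_mult ac.integral_over_prod factor ac.integral_over_power C'(1) y(2)
          ac.integral_over_base[OF f])
  qed
  from p_integral_criterion[OF m_irr m_monic m_root \<beta>_int lin nonlin]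
  have "\<exists>D. \<not> p dvd D \<and> algebraic_int (of_nat D * ((\<beta> / of_nat \<delta> gchoose l) * c ^ (l + s) * inverse a ^ s))"
    by (simp add: Y C rpoly_Bq)
  thus ?thesis by blast
qed

end

section \<open>The field of \<open>p\<close>-adic numbers\<close>

locale padic_prime =
  fixes p :: nat
  assumes prime_p: "prime p"
begin

lemma prime_int_p: "prime (int p)" using prime_p by simp

lemma p_gt_1: "p > 1" using prime_p by (rule prime_gt_1_nat)

text \<open>Cross multiplication with the reduced fraction shows that any representation computes
  the valuation.\<close>

lemma rat_val_divide:
  assumes "a \<noteq> 0" "b \<noteq> 0"
  shows "rat_val p (of_int a / of_int b) = int (multiplicity (int p) a) - int (multiplicity (int p) b)"
proof -
  define x where "x = (of_int a / of_int b :: rat)"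
  obtain n d where nd: "quotient_of x = (n, d)" by (cases "quotient_of x")
  hence x: "x = of_int n / of_int d" and d: "d > 0"
    by (auto simp: quotient_of_div quotient_of_denom_pos)
  have "x \<noteq> 0" using assms by (simp add: x_def)
  hence n: "n \<noteq> 0" using x by auto
  have "(of_int (a * d) :: rat) = of_int (n * b)" using x d assms by (simp add: x_def field_simps)
  hence "a * d = n * b" by (simp only: of_int_eq_iff)
  hence "multiplicity (int p) (a * d) = multiplicity (int p) (n * b)" by simp
  hence "multiplicity (int p) a + multiplicity (int p) d = multiplicity (int p) n + multiplicity (int p) b"
    using assms n d prime_int_p by (simp add: prime_elem_multiplicity_mult_distrib)
  thus ?thesis using nd by (simp add: rat_val_def flip: x_def)
qed

lemma rat_fraction:
  obtains a b where "(x::rat) = of_int a / of_int b" "b > 0"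
  by (metis quotient_of_denom_pos quotient_of_div surj_pair)

lemma rat_val_of_int: "n \<noteq> 0 \<Longrightarrow> rat_val p (of_int n) = int (multiplicity (int p) n)"
  using rat_val_divide[of n 1] by simp

lemma rat_val_mult:
  assumes "x \<noteq> 0" "y \<noteq> 0" shows "rat_val p (x * y) = rat_val p x + rat_val p y"
proof -
  obtain a b where x: "x = of_int a / of_int b" "b > 0" by (rule rat_fraction)
  obtain c d where y: "y = of_int c / of_int d" "d > 0" by (rule rat_fraction)
  have nz: "a \<noteq> 0" "c \<noteq> 0" "b \<noteq> 0" "d \<noteq> 0" using assms x y by auto
  have "rat_val p (x * y) = rat_val p (of_int (a * c) / of_int (b * d))" by (simp add: x y)
  also have "\<dots> = int (multiplicity (int p) (a * c)) - int (multiplicity (int p) (b * d))"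
    using nz by (intro rat_val_divide) auto
  also have "\<dots> = rat_val p x + rat_val p y"
    unfolding x(1) y(1) using nz prime_int_p by (simp add: rat_val_divide prime_elem_multiplicity_mult_distrib)
  finally show ?thesis .
qed

lemma rat_val_minus [simp]: "rat_val p (- x) = rat_val p x"
proof -
  have "rat_val p (of_int (-1)) + rat_val p (of_int (-1)) = 0"
    using rat_val_mult[of "-1" "-1"] rat_val_of_int[of 1] by simp
  thus ?thesis using rat_val_mult[of "-1" x] by (cases "x = 0") auto
qed

lemma rat_val_add:
  assumes "x \<noteq> 0" "y \<noteq> 0" "x + y \<noteq> 0" shows "min (rat_val p x) (rat_val p y) \<le> rat_val p (x + y)"
proof -
  obtain a b where x: "x = of_int a / of_int b" "b > 0" by (rule rat_fraction)
  obtain c d where y: "y = of_int c / of_int d" "d > 0" by (rule rat_fraction)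
  have nz: "a \<noteq> 0" "c \<noteq> 0" "b \<noteq> 0" "d \<noteq> 0" using assms x y by auto
  have x': "x = of_int (a * d) / of_int (b * d)" and y': "y = of_int (b * c) / of_int (b * d)"
    using nz by (simp_all add: x y)
  have xy: "x + y = of_int (a * d + b * c) / of_int (b * d)" unfolding x' y' by (simp add: add_divide_distrib)
  have s0: "a * d + b * c \<noteq> 0"
  proof
    assume "a * d + b * c = 0"
    hence "x + y = 0" by (simp only: xy of_int_0 div_0)
    thus False using assms(3) by simp
  qed
  have "min (multiplicity (int p) (a * d)) (multiplicity (int p) (b * c)) \<le> multiplicity (int p) (a * d + b * c)"
  proof (rule multiplicity_geI)
    show "\<not> is_unit (int p)" using p_gt_1 by simp
    show "int p ^ min (multiplicity (int p) (a * d)) (multiplicity (int p) (b * c)) dvd a * d + b * c"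
      by (intro dvd_add multiplicity_dvd') auto
  qed (use s0 in simp_all)
  moreover have "rat_val p x = int (multiplicity (int p) (a * d)) - int (multiplicity (int p) (b * d))"
    unfolding x' using nz by (intro rat_val_divide) auto
  moreover have "rat_val p y = int (multiplicity (int p) (b * c)) - int (multiplicity (int p) (b * d))"
    unfolding y' using nz by (intro rat_val_divide) auto
  moreover have "rat_val p (x + y) = int (multiplicity (int p) (a * d + b * c)) - int (multiplicity (int p) (b * d))"
    unfolding xy using nz s0 by (intro rat_val_divide) auto
  ultimately show ?thesis by linarith
qed

definition rge :: "int \<Rightarrow> rat \<Rightarrow> bool" where "rge k x \<longleftrightarrow> x = 0 \<or> k \<le> rat_val p x"

lemma rge_0 [simp]: "rge k 0" by (simp add: rge_def)
lemma rge_mono: "rge k x \<Longrightarrow> l \<le> k \<Longrightarrow> rge l x" by (auto simp: rge_def)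
lemma rge_add: "rge k x \<Longrightarrow> rge k y \<Longrightarrow> rge k (x + y)"
  using rat_val_add[of x y] by (cases "x = 0"; cases "y = 0"; cases "x + y = 0") (auto simp: rge_def)
lemma rge_minus [simp]: "rge k (- x) \<longleftrightarrow> rge k x" by (simp add: rge_def)
lemma rge_diff: "rge k x \<Longrightarrow> rge k y \<Longrightarrow> rge k (x - y)" using rge_add[of k x "- y"] by simp
lemma rge_mult: "rge k x \<Longrightarrow> rge l y \<Longrightarrow> rge (k + l) (x * y)"
  by (cases "x = 0"; cases "y = 0") (auto simp: rge_def rat_val_mult)
lemma rge_rat_val: "rge (rat_val p x) x" by (simp add: rge_def)
lemma rge_of_int_iff: "rge (int k) (of_int n) \<longleftrightarrow> int p ^ k dvd n"
proof (cases "n = 0")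
  case False
  have "\<not> is_unit (int p)" using p_gt_1 by simp
  hence "int p ^ k dvd n \<longleftrightarrow> k \<le> multiplicity (int p) n"
    by (rule power_dvd_iff_le_multiplicity[OF False])
  thus ?thesis using False by (simp add: rge_def rat_val_of_int)
qed simp

lemma rat_val_perturb:
  assumes "x \<noteq> 0" "rge (rat_val p x + 1) (y - x)" shows "y \<noteq> 0" "rat_val p y = rat_val p x"
proof -
  have nx: "\<not> rge (rat_val p x + 1) x" using assms(1) by (simp add: rge_def)
  have ny: "\<not> rge (rat_val p x + 1) y"
  proof
    assume "rge (rat_val p x + 1) y"
    from rge_diff[OF this assms(2)] show False using nx by simp
  qed
  show "y \<noteq> 0" using ny by (auto simp: rge_def)
  have "rge (rat_val p x) ((y - x) + x)" by (intro rge_add rge_mono[OF assms(2)] rge_rat_val) simp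
  thus "rat_val p y = rat_val p x" using ny by (auto simp: rge_def)
qed

lemma rat_abs_less_iff: "rat_abs p x < real p powi (- k) \<longleftrightarrow> rge (k + 1) x"
proof (cases "x = 0")
  case True
  thus ?thesis using p_gt_1 by (simp add: rat_abs_def)
next
  case False
  have "rat_abs p x < real p powi (- k) \<longleftrightarrow> - rat_val p x < - k"
  proof -
    have "(real p powi i < real p powi j) = (i < j)" for i j
      using power_int_strict_increasing[of i j "real p"] power_int_increasing[of j i "real p"] p_gt_1
      by (cases "i < j") (auto simp: not_less)
    thus ?thesis using False by (simp add: rat_abs_def)
  qed
  thus ?thesis using False by (auto simp: rge_def)
qed

text \<open>Real bounds are traded for powers of \<open>p\<close>. The form with two indices serves
  Cauchy sequences directly and null sequences through an \<open>f\<close> that ignores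
  \<open>j\<close>.\<close>

lemma eventually_small_iff:
  "(\<forall>e>0. \<exists>M. \<forall>i\<ge>M. \<forall>j\<ge>M. rat_abs p (f i j) < e) \<longleftrightarrow> (\<forall>k::nat. \<exists>M. \<forall>i\<ge>M. \<forall>j\<ge>M. rge (int k) (f i j))"
proof
  assume L: "\<forall>e>0. \<exists>M. \<forall>i\<ge>M. \<forall>j\<ge>M. rat_abs p (f i j) < e"
  show "\<forall>k::nat. \<exists>M. \<forall>i\<ge>M. \<forall>j\<ge>M. rge (int k) (f i j)"
  proof
    fix k :: nat
    have "real p powi (- int k) > 0" using p_gt_1 by (simp add: zero_less_power_int)
    from L[rule_format, OF this] obtain M where M: "\<forall>i\<ge>M. \<forall>j\<ge>M. rge (int k + 1) (f i j)"
      unfolding rat_abs_less_iff ..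
    show "\<exists>M. \<forall>i\<ge>M. \<forall>j\<ge>M. rge (int k) (f i j)"
    proof (intro exI[of _ M] allI impI)
      fix i j assume "i \<ge> M" "j \<ge> M"
      with M have "rge (int k + 1) (f i j)" by simp
      thus "rge (int k) (f i j)" by (rule rge_mono) simp
    qed
  qed
next
  assume R: "\<forall>k::nat. \<exists>M. \<forall>i\<ge>M. \<forall>j\<ge>M. rge (int k) (f i j)"
  show "\<forall>e>0. \<exists>M. \<forall>i\<ge>M. \<forall>j\<ge>M. rat_abs p (f i j) < e"
  proof (intro allI impI)
    fix e :: real assume "e > 0"
    then obtain k where "(1 / real p) ^ k < e" using real_arch_pow_inv[of e "1 / real p"] p_gt_1 by auto
    hence k: "real p powi (- int k) < e"
      by (simp add: power_int_minus power_one_over inverse_eq_divide)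
    from R[rule_format, of "Suc k"] obtain M where M: "\<forall>i\<ge>M. \<forall>j\<ge>M. rge (int (Suc k)) (f i j)" ..
    show "\<exists>M. \<forall>i\<ge>M. \<forall>j\<ge>M. rat_abs p (f i j) < e"
    proof (intro exI[of _ M] allI impI)
      fix i j assume "i \<ge> M" "j \<ge> M"
      with M have "rge (int k + 1) (f i j)" by (simp add: add.commute)
      hence "rat_abs p (f i j) < real p powi (- int k)" by (simp only: rat_abs_less_iff)
      thus "rat_abs p (f i j) < e" using k by simp
    qed
  qed
qed

section \<open>Cauchy sequences, null sequences and their valuations\<close>

lemma padic_cauchy_iff: "s \<in> padic_cauchy p \<longleftrightarrow> (\<forall>k::nat. \<exists>M. \<forall>i\<ge>M. \<forall>j\<ge>M. rge (int k) (s i - s j))"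
  unfolding padic_cauchy_def mem_Collect_eq by (rule eventually_small_iff)

lemma padic_null_iff: "s \<in> padic_null p \<longleftrightarrow> (\<forall>k::nat. \<exists>M. \<forall>i\<ge>M. rge (int k) (s i))"
proof -
  have "s \<in> padic_null p \<longleftrightarrow> (\<forall>e>0. \<exists>M. \<forall>i\<ge>M. \<forall>j\<ge>M. rat_abs p (s i) < e)"
    unfolding padic_null_def mem_Collect_eq by (metis order_refl)
  also have "\<dots> \<longleftrightarrow> (\<forall>k::nat. \<exists>M. \<forall>i\<ge>M. \<forall>j\<ge>M. rge (int k) (s i))" by (rule eventually_small_iff)
  also have "\<dots> \<longleftrightarrow> (\<forall>k::nat. \<exists>M. \<forall>i\<ge>M. rge (int k) (s i))" by (metis order_refl)
  finally show ?thesis .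
qed

lemma cauchy_bounded:
  assumes "s \<in> padic_cauchy p"
  obtains B :: nat and M where "\<And>i. i \<ge> M \<Longrightarrow> rge (- int B) (s i)"
proof -
  obtain M where M: "\<And>i j. i \<ge> M \<Longrightarrow> j \<ge> M \<Longrightarrow> rge (int 0) (s i - s j)"
    using assms unfolding padic_cauchy_iff by blast
  define B where "B = nat \<bar>rat_val p (s M)\<bar>"
  have "rge (- int B) (s i)" if "i \<ge> M" for i
  proof -
    have "rge (- int B) ((s i - s M) + s M)"
      by (intro rge_add rge_mono[OF M[OF that order_refl]] rge_mono[OF rge_rat_val]) (auto simp: B_def)
    thus ?thesis by simp
  qed
  thus ?thesis by (rule that)
qed

lemma cauchy_const: "(\<lambda>n. x) \<in> padic_cauchy p" by (simp add: padic_cauchy_iff)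

lemma cauchy_add: assumes "s \<in> padic_cauchy p" "t \<in> padic_cauchy p" shows "(\<lambda>n. s n + t n) \<in> padic_cauchy p"
  unfolding padic_cauchy_iff
proof
  fix k
  obtain M where M: "\<And>i j. i \<ge> M \<Longrightarrow> j \<ge> M \<Longrightarrow> rge (int k) (s i - s j)"
    using assms(1) unfolding padic_cauchy_iff by blast
  obtain N where N: "\<And>i j. i \<ge> N \<Longrightarrow> j \<ge> N \<Longrightarrow> rge (int k) (t i - t j)"
    using assms(2) unfolding padic_cauchy_iff by blast
  have "rge (int k) (s i + t i - (s j + t j))" if "i \<ge> max M N" "j \<ge> max M N" for i j
    using rge_add[OF M[of i j] N[of i j]] that by (simp add: algebra_simps)
  thus "\<exists>M. \<forall>i\<ge>M. \<forall>j\<ge>M. rge (int k) (s i + t i - (s j + t j))" by blast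
qed

lemma cauchy_minus: "s \<in> padic_cauchy p \<Longrightarrow> (\<lambda>n. - s n) \<in> padic_cauchy p"
proof -
  have "rge k (- x - - y) \<longleftrightarrow> rge k (x - y)" for k x y
    using rge_minus[of k "x - y"] by simp
  thus "s \<in> padic_cauchy p \<Longrightarrow> ?thesis" unfolding padic_cauchy_iff by simp
qed

lemma cauchy_mult: assumes "s \<in> padic_cauchy p" "t \<in> padic_cauchy p" shows "(\<lambda>n. s n * t n) \<in> padic_cauchy p"
  unfolding padic_cauchy_iff
proof
  fix k :: nat
  obtain B M1 where B: "\<And>i. i \<ge> M1 \<Longrightarrow> rge (- int B) (s i)" using cauchy_bounded[OF assms(1)] by blast
  obtain C N1 where C: "\<And>i. i \<ge> N1 \<Longrightarrow> rge (- int C) (t i)" using cauchy_bounded[OF assms(2)] by blast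
  obtain M where M: "\<And>i j. i \<ge> M \<Longrightarrow> j \<ge> M \<Longrightarrow> rge (int (k + C)) (s i - s j)"
    using assms(1) unfolding padic_cauchy_iff by blast
  obtain N where N: "\<And>i j. i \<ge> N \<Longrightarrow> j \<ge> N \<Longrightarrow> rge (int (k + B)) (t i - t j)"
    using assms(2) unfolding padic_cauchy_iff by blast
  define L where "L = max (max M N) (max M1 N1)"
  have "rge (int k) (s i * t i - s j * t j)" if "i \<ge> L" "j \<ge> L" for i j
  proof -
    have "rge (- int B + int (k + B)) (s i * (t i - t j))" by (intro rge_mult B N) (use that in \<open>auto simp: L_def\<close>)
    moreover have "rge (int (k + C) + - int C) ((s i - s j) * t j)" by (intro rge_mult C M) (use that in \<open>auto simp: L_def\<close>)
    ultimately have "rge (int k) (s i * (t i - t j) + (s i - s j) * t j)" by (intro rge_add) auto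
    thus ?thesis by (simp add: algebra_simps)
  qed
  thus "\<exists>M. \<forall>i\<ge>M. \<forall>j\<ge>M. rge (int k) (s i * t i - s j * t j)" by blast
qed

lemma null_imp_cauchy: assumes "s \<in> padic_null p" shows "s \<in> padic_cauchy p"
  unfolding padic_cauchy_iff
proof
  fix k
  obtain M where "\<And>i. i \<ge> M \<Longrightarrow> rge (int k) (s i)" using assms unfolding padic_null_iff by blast
  thus "\<exists>M. \<forall>i\<ge>M. \<forall>j\<ge>M. rge (int k) (s i - s j)" by (blast intro: rge_diff)
qed

lemma null_zero: "(\<lambda>n. 0) \<in> padic_null p" by (simp add: padic_null_iff)

lemma null_add: assumes "s \<in> padic_null p" "t \<in> padic_null p" shows "(\<lambda>n. s n + t n) \<in> padic_null p"
  unfolding padic_null_iff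
proof
  fix k
  obtain M where M: "\<And>i. i \<ge> M \<Longrightarrow> rge (int k) (s i)" using assms(1) unfolding padic_null_iff by blast
  obtain N where N: "\<And>i. i \<ge> N \<Longrightarrow> rge (int k) (t i)" using assms(2) unfolding padic_null_iff by blast
  have "rge (int k) (s i + t i)" if "i \<ge> max M N" for i using M[of i] N[of i] that by (intro rge_add) auto
  thus "\<exists>M. \<forall>i\<ge>M. rge (int k) (s i + t i)" by blast
qed

lemma null_minus: "s \<in> padic_null p \<Longrightarrow> (\<lambda>n. - s n) \<in> padic_null p" by (simp add: padic_null_iff)

lemma null_mult: assumes "s \<in> padic_cauchy p" "t \<in> padic_null p" shows "(\<lambda>n. s n * t n) \<in> padic_null p"
  unfolding padic_null_iff
proof
  fix k :: nat
  obtain B M where B: "\<And>i. i \<ge> M \<Longrightarrow> rge (- int B) (s i)" using cauchy_bounded[OF assms(1)] by blast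
  obtain N where N: "\<And>i. i \<ge> N \<Longrightarrow> rge (int (k + B)) (t i)" using assms(2) unfolding padic_null_iff by blast
  have "rge (int k) (s i * t i)" if "i \<ge> max M N" for i
    using rge_mult[OF B[of i] N[of i]] that by simp
  thus "\<exists>M. \<forall>i\<ge>M. rge (int k) (s i * t i)" by blast
qed

definition has_val :: "(nat \<Rightarrow> rat) \<Rightarrow> int \<Rightarrow> bool" where
  "has_val s k \<longleftrightarrow> (\<exists>M. \<forall>n\<ge>M. s n \<noteq> 0 \<and> rat_val p (s n) = k)"

lemma has_val_perturb:
  assumes "has_val s k" "(\<lambda>n. t n - s n) \<in> padic_null p" shows "has_val t k"
proof -
  obtain M where M: "\<And>n. n \<ge> M \<Longrightarrow> s n \<noteq> 0 \<and> rat_val p (s n) = k" using assms(1) unfolding has_val_def by blast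
  obtain N where N: "\<And>n. n \<ge> N \<Longrightarrow> rge (int (nat (k + 1))) (t n - s n)" using assms(2) unfolding padic_null_iff by blast
  have "t n \<noteq> 0 \<and> rat_val p (t n) = k" if "n \<ge> max M N" for n
    using rat_val_perturb[of "s n" "t n"] M[of n] rge_mono[OF N[of n], of "k + 1"] that by auto
  thus ?thesis unfolding has_val_def by blast
qed

text \<open>A sequence that is not null has valuation below some \<open>k0\<close> infinitely often.
  Once all differences have valuation at least \<open>k0\<close>, a single such term determines the
  valuation of all the others.\<close>

lemma cauchy_has_val:
  assumes "s \<in> padic_cauchy p" "s \<notin> padic_null p" shows "\<exists>k. has_val s k"
proof -
  obtain k0 :: nat where k0: "\<And>M. \<exists>n\<ge>M. \<not> rge (int k0) (s n)" using assms(2) unfolding padic_null_iff by blast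
  obtain M where M: "\<And>i j. i \<ge> M \<Longrightarrow> j \<ge> M \<Longrightarrow> rge (int k0) (s i - s j)"
    using assms(1) unfolding padic_cauchy_iff by blast
  obtain n0 where n0: "n0 \<ge> M" "\<not> rge (int k0) (s n0)" using k0 by blast
  hence s0: "s n0 \<noteq> 0" "rat_val p (s n0) < int k0" by (auto simp: rge_def)
  have "s n \<noteq> 0 \<and> rat_val p (s n) = rat_val p (s n0)" if "n \<ge> M" for n
    using rat_val_perturb[OF s0(1), of "s n"] rge_mono[OF M[OF that n0(1)], of "rat_val p (s n0) + 1"] s0(2) by auto
  thus ?thesis unfolding has_val_def by blast
qed

lemma has_val_unique: "has_val s k \<Longrightarrow> has_val s l \<Longrightarrow> k = l"
  unfolding has_val_def by (metis nat_le_linear)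

lemma has_val_not_null: "has_val s k \<Longrightarrow> s \<notin> padic_null p"
proof
  assume "has_val s k" "s \<in> padic_null p"
  then obtain M N where "\<And>n. n \<ge> M \<Longrightarrow> s n \<noteq> 0 \<and> rat_val p (s n) = k"
    "\<And>n. n \<ge> N \<Longrightarrow> rge (int (nat (k + 1))) (s n)" unfolding has_val_def padic_null_iff by blast
  from this(1)[of "max M N"] this(2)[of "max M N"] show False by (auto simp: rge_def split: if_splits)
qed

lemma cauchy_inverse:
  assumes "s \<in> padic_cauchy p" "has_val s k" shows "(\<lambda>n. inverse (s n)) \<in> padic_cauchy p"
  unfolding padic_cauchy_iff
proof
  fix l :: nat
  obtain M where M: "\<And>n. n \<ge> M \<Longrightarrow> s n \<noteq> 0 \<and> rat_val p (s n) = k" using assms(2) unfolding has_val_def by blast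
  \<comment> \<open>The difference of inverses is the difference divided by
    \<open>s i * s j\<close>, which has valuation \<open>2 * k\<close>.\<close>
  obtain N where N: "\<And>i j. i \<ge> N \<Longrightarrow> j \<ge> N \<Longrightarrow> rge (int (nat (int l + 2 * k))) (s i - s j)"
    using assms(1) unfolding padic_cauchy_iff by blast
  have inv: "rge (- k) (inverse (s n))" if "n \<ge> M" for n
    using rat_val_mult[of "s n" "inverse (s n)"] M[OF that] rat_val_of_int[of 1] by (simp add: rge_def)
  have "rge (int l) (inverse (s i) - inverse (s j))" if "i \<ge> max M N" "j \<ge> max M N" for i j
  proof -
    have "rge (int l + 2 * k + (- k + - k)) ((s j - s i) * (inverse (s i) * inverse (s j)))"
      by (intro rge_mult inv rge_mono[OF N]) (use that in auto)
    also have "(s j - s i) * (inverse (s i) * inverse (s j)) = inverse (s i) - inverse (s j)"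
      using M[of i] M[of j] that by (simp add: field_simps)
    finally show ?thesis by simp
  qed
  thus "\<exists>M. \<forall>i\<ge>M. \<forall>j\<ge>M. rge (int l) (inverse (s i) - inverse (s j))" by blast
qed

section \<open>The quotient ring and its field structure\<close>

lemma cauchy_ring_simps [simp]:
  "carrier (cauchy_ring p) = padic_cauchy p" "\<one>\<^bsub>cauchy_ring p\<^esub> = (\<lambda>n. 1)" "\<zero>\<^bsub>cauchy_ring p\<^esub> = (\<lambda>n. 0)"
  "s \<otimes>\<^bsub>cauchy_ring p\<^esub> t = (\<lambda>n. s n * t n)" "s \<oplus>\<^bsub>cauchy_ring p\<^esub> t = (\<lambda>n. s n + t n)"
  by (simp_all add: cauchy_ring_def)

lemma cring_cauchy_ring: "cring (cauchy_ring p)"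
proof (rule cringI)
  show "abelian_group (cauchy_ring p)"
  proof (rule abelian_groupI)
    fix s assume "s \<in> carrier (cauchy_ring p)"
    thus "\<exists>t\<in>carrier (cauchy_ring p). t \<oplus>\<^bsub>cauchy_ring p\<^esub> s = \<zero>\<^bsub>cauchy_ring p\<^esub>"
      by (intro bexI[of _ "\<lambda>n. - s n"]) (auto intro: cauchy_minus)
  qed (auto simp: cauchy_add cauchy_const algebra_simps)
  show "Group.comm_monoid (cauchy_ring p)"
    by (rule comm_monoidI) (auto simp: cauchy_mult cauchy_const algebra_simps)
qed (auto simp: algebra_simps)

lemma ideal_padic_null: "ideal (padic_null p) (cauchy_ring p)"
proof (rule idealI)
  interpret cring "cauchy_ring p" by (rule cring_cauchy_ring)
  show "ring (cauchy_ring p)" ..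
  show "subgroup (padic_null p) (add_monoid (cauchy_ring p))"
  proof (rule add.subgroupI)
    show "padic_null p \<subseteq> carrier (cauchy_ring p)" by (auto intro: null_imp_cauchy)
    show "padic_null p \<noteq> {}" using null_zero by blast
    fix s t assume s: "s \<in> padic_null p" "t \<in> padic_null p"
    show "s \<oplus>\<^bsub>cauchy_ring p\<^esub> t \<in> padic_null p" using s by (simp add: null_add)
    have "\<ominus>\<^bsub>cauchy_ring p\<^esub> s = (\<lambda>n. - s n)"
      using s null_imp_cauchy cauchy_minus by (intro minus_equality) auto
    thus "\<ominus>\<^bsub>cauchy_ring p\<^esub> s \<in> padic_null p" using s by (simp add: null_minus)
  qed
  fix s t assume st: "s \<in> padic_null p" "t \<in> carrier (cauchy_ring p)"
  show "t \<otimes>\<^bsub>cauchy_ring p\<^esub> s \<in> padic_null p" using null_mult[of t s] st by simp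
  thus "s \<otimes>\<^bsub>cauchy_ring p\<^esub> t \<in> padic_null p" by (simp add: mult.commute)
qed

definition cls :: "(nat \<Rightarrow> rat) \<Rightarrow> padic" where
  "cls s = padic_null p +>\<^bsub>cauchy_ring p\<^esub> s"

lemma cls_mem_iff: "t \<in> cls s \<longleftrightarrow> (\<lambda>n. t n - s n) \<in> padic_null p"
proof
  assume "t \<in> cls s"
  then obtain h where "h \<in> padic_null p" "t = (\<lambda>n. h n + s n)"
    by (auto simp: cls_def a_r_coset_def')
  thus "(\<lambda>n. t n - s n) \<in> padic_null p" by simp
next
  assume "(\<lambda>n. t n - s n) \<in> padic_null p"
  moreover have "t = (\<lambda>n. (t n - s n) + s n)" by simp
  ultimately show "t \<in> cls s" unfolding cls_def a_r_coset_def' by (intro UN_I) auto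
qed

lemma cls_self: "s \<in> cls s" by (simp add: cls_mem_iff null_zero)

lemma cls_eq_iff: "cls s = cls t \<longleftrightarrow> (\<lambda>n. s n - t n) \<in> padic_null p"
proof
  assume "cls s = cls t"
  hence "s \<in> cls t" using cls_self by blast
  thus "(\<lambda>n. s n - t n) \<in> padic_null p" by (simp add: cls_mem_iff)
next
  assume st: "(\<lambda>n. s n - t n) \<in> padic_null p"
  have "u \<in> cls s \<longleftrightarrow> u \<in> cls t" for u
    using null_add[OF _ st, of "\<lambda>n. u n - s n"] null_add[OF _ null_minus[OF st], of "\<lambda>n. u n - t n"]
    by (auto simp: cls_mem_iff)
  thus "cls s = cls t" by blast
qed

lemma carrier_Qp: "carrier (Qp p) = cls ` padic_cauchy p"
  by (auto simp: Qp_def FactRing_def A_RCOSETS_def' cls_def)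

lemma Qp_mult: "s \<in> padic_cauchy p \<Longrightarrow> t \<in> padic_cauchy p \<Longrightarrow> cls s \<otimes>\<^bsub>Qp p\<^esub> cls t = cls (\<lambda>n. s n * t n)"
  using ideal.rcoset_mult_add[OF ideal_padic_null, of s t] by (simp add: Qp_def FactRing_def cls_def)

lemma Qp_add: "s \<in> padic_cauchy p \<Longrightarrow> t \<in> padic_cauchy p \<Longrightarrow> cls s \<oplus>\<^bsub>Qp p\<^esub> cls t = cls (\<lambda>n. s n + t n)"
  using ideal.a_rcos_sum[OF ideal_padic_null, of s t] by (simp add: Qp_def FactRing_def cls_def)

lemma Qp_zero: "\<zero>\<^bsub>Qp p\<^esub> = cls (\<lambda>n. 0)"
proof -
  have "padic_null p = cls (\<lambda>n. 0)" by (auto simp: cls_mem_iff)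
  thus ?thesis by (simp add: Qp_def FactRing_def)
qed

lemma Qp_one: "\<one>\<^bsub>Qp p\<^esub> = cls (\<lambda>n. 1)" by (simp add: Qp_def FactRing_def cls_def)

lemma Qp_of_rat_cls: "Qp_of_rat p x = cls (\<lambda>n. x)" by (simp add: Qp_of_rat_def cls_def)

lemma field_Qp: "field (Qp p)"
proof -
  have cring: "cring (Qp p)" unfolding Qp_def
    by (rule ideal.quotient_is_cring[OF ideal_padic_null cring_cauchy_ring])
  have "Units (Qp p) = carrier (Qp p) - {\<zero>\<^bsub>Qp p\<^esub>}"
  proof (intro equalityI subsetI)
    fix A assume A: "A \<in> carrier (Qp p) - {\<zero>\<^bsub>Qp p\<^esub>}"
    then obtain s where s: "s \<in> padic_cauchy p" "A = cls s" by (auto simp: carrier_Qp)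
    hence "s \<notin> padic_null p" using A cls_eq_iff[of s "\<lambda>n. 0"] by (auto simp: Qp_zero)
    then obtain k where k: "has_val s k" using cauchy_has_val s(1) by blast
    note inv = cauchy_inverse[OF s(1) k]
    \<comment> \<open>Early terms may be 0, with inverse 0. The product with the termwise inverse
      then differs from 1 only before \<open>M\<close>, by a null sequence.\<close>
    obtain M where "\<And>n. n \<ge> M \<Longrightarrow> s n \<noteq> 0" using k unfolding has_val_def by blast
    hence "(\<lambda>n. inverse (s n) * s n - 1) \<in> padic_null p"
      unfolding padic_null_iff by (intro allI exI[of _ M]) auto
    hence "cls (\<lambda>n. inverse (s n)) \<otimes>\<^bsub>Qp p\<^esub> A = \<one>\<^bsub>Qp p\<^esub>" "A \<otimes>\<^bsub>Qp p\<^esub> cls (\<lambda>n. inverse (s n)) = \<one>\<^bsub>Qp p\<^esub>"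
      using inv s by (simp_all add: Qp_mult Qp_one cls_eq_iff mult.commute)
    moreover have "cls (\<lambda>n. inverse (s n)) \<in> carrier (Qp p)" using inv by (simp add: carrier_Qp)
    ultimately show "A \<in> Units (Qp p)" using A unfolding Units_def by blast
  next
    fix A assume A: "A \<in> Units (Qp p)"
    have "\<one>\<^bsub>Qp p\<^esub> \<noteq> \<zero>\<^bsub>Qp p\<^esub>"
    proof
      assume "\<one>\<^bsub>Qp p\<^esub> = \<zero>\<^bsub>Qp p\<^esub>"
      hence "(\<lambda>n. 1) \<in> padic_null p" using cls_eq_iff[of "\<lambda>n. 1" "\<lambda>n. 0"] by (simp add: Qp_one Qp_zero)
      moreover have "has_val (\<lambda>n. 1) 0" using rat_val_of_int[of 1] by (simp add: has_val_def)
      ultimately show False using has_val_not_null by blast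
    qed
    moreover have "\<one>\<^bsub>Qp p\<^esub> = \<zero>\<^bsub>Qp p\<^esub>" if "A = \<zero>\<^bsub>Qp p\<^esub>"
    proof -
      obtain B where B: "B \<in> carrier (Qp p)" "B \<otimes>\<^bsub>Qp p\<^esub> A = \<one>\<^bsub>Qp p\<^esub>"
        using A unfolding Units_def by blast
      then obtain t where "t \<in> padic_cauchy p" "B = cls t" by (auto simp: carrier_Qp)
      thus ?thesis using B(2) by (simp add: that Qp_zero Qp_mult cauchy_const)
    qed
    ultimately show "A \<in> carrier (Qp p) - {\<zero>\<^bsub>Qp p\<^esub>}" using A by (auto simp: Units_def)
  qed
  thus ?thesis by (rule cring.cring_fieldI[OF cring])
qed

lemma Qp_val_cls: assumes "has_val s k" shows "Qp_val p (cls s) = k"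
  unfolding Qp_val_def
proof (rule the_equality)
  have "has_val t k" if "t \<in> cls s" for t using has_val_perturb[OF assms] that by (simp add: cls_mem_iff)
  thus "\<forall>t\<in>cls s. \<exists>M. \<forall>n\<ge>M. t n \<noteq> 0 \<and> rat_val p (t n) = k" by (simp add: has_val_def)
  fix l assume "\<forall>t\<in>cls s. \<exists>M. \<forall>n\<ge>M. t n \<noteq> 0 \<and> rat_val p (t n) = l"
  hence "has_val s l" using cls_self by (simp add: has_val_def)
  thus "l = k" using has_val_unique assms by blast
qed

lemma nonzero_Qp:
  assumes "A \<in> carrier (Qp p)" "A \<noteq> \<zero>\<^bsub>Qp p\<^esub>"
  obtains s where "s \<in> padic_cauchy p" "A = cls s" "has_val s (Qp_val p A)"
proof -
  obtain s where s: "s \<in> padic_cauchy p" "A = cls s" using assms(1) by (auto simp: carrier_Qp)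
  hence "s \<notin> padic_null p" using assms(2) cls_eq_iff[of s "\<lambda>n. 0"] by (auto simp: Qp_zero)
  then obtain k where k: "has_val s k" using cauchy_has_val s(1) by blast
  hence "has_val s (Qp_val p A)" using Qp_val_cls[OF k] s by simp
  thus ?thesis using s by (rule that[rotated 2])
qed

lemma cls_nonzero: "has_val s k \<Longrightarrow> cls s \<noteq> \<zero>\<^bsub>Qp p\<^esub>"
  using has_val_not_null[of s k] cls_eq_iff[of s "\<lambda>n. 0"] by (auto simp: Qp_zero)

end

section \<open>The \<open>p\<close>-adic numbers as a type\<close>

text \<open>A type cannot depend on a prime that varies inside a statement. It is enough, though, to
  establish the local property for a single prime, chosen as a counterexample if there is one.\<close>

definition test_prime :: nat where
  "test_prime = (if \<exists>p. prime p \<and> \<not> local_property p then SOME p. prime p \<and> \<not> local_property p else 2)"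

lemma prime_test_prime: "prime test_prime"
proof (cases "\<exists>p. prime p \<and> \<not> local_property p")
  case True
  from someI_ex[OF this] True show ?thesis by (simp add: test_prime_def)
next
  case False
  show ?thesis unfolding test_prime_def if_not_P[OF False] by (rule two_is_prime_nat)
qed

lemma local_property_of_test_prime:
  assumes "local_property test_prime" "prime p" shows "local_property p"
proof (rule ccontr)
  assume "\<not> local_property p"
  hence ex: "\<exists>p. prime p \<and> \<not> local_property p" using assms(2) by blast
  from someI_ex[OF this] ex have "\<not> local_property test_prime" by (simp add: test_prime_def)
  thus False using assms(1) by blast
qed

interpretation tp: padic_prime test_prime
  by unfold_locales (rule prime_test_prime)

abbreviation "QQ \<equiv> Qp test_prime"

lemma cring_QQ: "cring QQ"
  using tp.field_Qp by (simp add: Ring.field_def domain_def)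

typedef qp = "carrier QQ"
  using tp.carrier_Qp tp.cauchy_const by blast

lemma Rep_qp_carrier [simp]: "Rep_qp x \<in> carrier QQ" by (rule Rep_qp)

lemma Rep_qp_eq_iff [simp]: "Rep_qp x = Rep_qp y \<longleftrightarrow> x = y" by (simp add: Rep_qp_inject)

lemma Rep_Abs_qp [simp]: "A \<in> carrier QQ \<Longrightarrow> Rep_qp (Abs_qp A) = A" by (rule Abs_qp_inverse)

instantiation qp :: field
begin

definition zero_qp :: qp where "0 = Abs_qp \<zero>\<^bsub>QQ\<^esub>"
definition one_qp :: qp where "1 = Abs_qp \<one>\<^bsub>QQ\<^esub>"
definition plus_qp :: "qp \<Rightarrow> qp \<Rightarrow> qp" where "x + y = Abs_qp (Rep_qp x \<oplus>\<^bsub>QQ\<^esub> Rep_qp y)"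
definition times_qp :: "qp \<Rightarrow> qp \<Rightarrow> qp" where "x * y = Abs_qp (Rep_qp x \<otimes>\<^bsub>QQ\<^esub> Rep_qp y)"
definition uminus_qp :: "qp \<Rightarrow> qp" where "- x = Abs_qp (\<ominus>\<^bsub>QQ\<^esub> Rep_qp x)"
definition minus_qp :: "qp \<Rightarrow> qp \<Rightarrow> qp" where "x - y = Abs_qp (Rep_qp x \<ominus>\<^bsub>QQ\<^esub> Rep_qp y)"
definition inverse_qp :: "qp \<Rightarrow> qp" where
  "inverse x = (if Rep_qp x = \<zero>\<^bsub>QQ\<^esub> then Abs_qp \<zero>\<^bsub>QQ\<^esub> else Abs_qp (inv\<^bsub>QQ\<^esub> Rep_qp x))"
definition divide_qp :: "qp \<Rightarrow> qp \<Rightarrow> qp" where "x div y = x * inverse (y :: qp)"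

instance
proof
  interpret cring QQ by (rule cring_QQ)
  note defs = zero_qp_def one_qp_def plus_qp_def times_qp_def uminus_qp_def minus_qp_def
  fix x y z :: qp
  show "x * y * z = x * (y * z)" by (simp add: defs m_assoc)
  show "x * y = y * x" by (simp add: defs m_comm)
  show "1 * x = x" by (simp add: defs Rep_qp_inverse)
  show "x + y + z = x + (y + z)" by (simp add: defs a_assoc)
  show "x + y = y + x" by (simp add: defs a_comm)
  show "0 + x = x" by (simp add: defs Rep_qp_inverse)
  show "- x + x = 0" by (simp add: defs l_neg)
  show "x - y = x + - y" by (simp add: defs a_minus_def)
  show "(x + y) * z = x * z + y * z" by (simp add: defs l_distr)
  have "\<zero>\<^bsub>QQ\<^esub> \<noteq> \<one>\<^bsub>QQ\<^esub>" using domain.zero_not_one[OF field.axioms(1)[OF tp.field_Qp]] .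
  thus "(0::qp) \<noteq> 1" by (simp add: defs Abs_qp_inject)
  show "inverse (0::qp) = 0" by (simp add: inverse_qp_def zero_qp_def)
  show "x div y = x * inverse y" by (simp add: divide_qp_def)
  assume "x \<noteq> 0"
  hence x: "Rep_qp x \<noteq> \<zero>\<^bsub>QQ\<^esub>" by (metis Rep_qp_inverse zero_qp_def)
  hence u: "Rep_qp x \<in> Units QQ" using field.field_Units[OF tp.field_Qp] by simp
  thus "inverse x * x = 1" using x by (simp add: inverse_qp_def defs)
qed

end

lemma Rep_qp_simps:
  "Rep_qp 0 = \<zero>\<^bsub>QQ\<^esub>" "Rep_qp 1 = \<one>\<^bsub>QQ\<^esub>" "Rep_qp (x + y) = Rep_qp x \<oplus>\<^bsub>QQ\<^esub> Rep_qp y"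
  "Rep_qp (x * y) = Rep_qp x \<otimes>\<^bsub>QQ\<^esub> Rep_qp y" "Rep_qp (- x) = \<ominus>\<^bsub>QQ\<^esub> Rep_qp x"
  "Rep_qp (x - y) = Rep_qp x \<ominus>\<^bsub>QQ\<^esub> Rep_qp y"
proof -
  interpret cring QQ by (rule cring_QQ)
  show "Rep_qp 0 = \<zero>\<^bsub>QQ\<^esub>" "Rep_qp 1 = \<one>\<^bsub>QQ\<^esub>" "Rep_qp (x + y) = Rep_qp x \<oplus>\<^bsub>QQ\<^esub> Rep_qp y"
    "Rep_qp (x * y) = Rep_qp x \<otimes>\<^bsub>QQ\<^esub> Rep_qp y" "Rep_qp (- x) = \<ominus>\<^bsub>QQ\<^esub> Rep_qp x"
    "Rep_qp (x - y) = Rep_qp x \<ominus>\<^bsub>QQ\<^esub> Rep_qp y"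
    by (simp_all add: zero_qp_def one_qp_def plus_qp_def times_qp_def uminus_qp_def minus_qp_def)
qed

lemma cls_carrier: "s \<in> padic_cauchy test_prime \<Longrightarrow> tp.cls s \<in> carrier QQ"
  by (simp add: tp.carrier_Qp)

definition qp_class :: "(nat \<Rightarrow> rat) \<Rightarrow> qp" where "qp_class s = Abs_qp (tp.cls s)"

lemma Rep_qp_class: "s \<in> padic_cauchy test_prime \<Longrightarrow> Rep_qp (qp_class s) = tp.cls s"
  by (simp add: qp_class_def tp.carrier_Qp)

lemma qp_cases:
  obtains s where "s \<in> padic_cauchy test_prime" "x = qp_class s"
proof -
  have "Rep_qp x \<in> tp.cls ` padic_cauchy test_prime" using Rep_qp_carrier by (simp only: tp.carrier_Qp)
  then obtain s where "s \<in> padic_cauchy test_prime" "Rep_qp x = tp.cls s" by blast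
  thus ?thesis using that by (metis Rep_qp_inverse qp_class_def)
qed

lemma qp_class_eq_iff:
  assumes "s \<in> padic_cauchy test_prime" "t \<in> padic_cauchy test_prime"
  shows "qp_class s = qp_class t \<longleftrightarrow> (\<lambda>n. s n - t n) \<in> padic_null test_prime"
  unfolding qp_class_def Abs_qp_inject[OF cls_carrier[OF assms(1)] cls_carrier[OF assms(2)]] tp.cls_eq_iff ..

lemma qp_class_add:
  assumes "s \<in> padic_cauchy test_prime" "t \<in> padic_cauchy test_prime"
  shows "qp_class s + qp_class t = qp_class (\<lambda>n. s n + t n)"
  by (simp only: plus_qp_def Rep_qp_class[OF assms(1)] Rep_qp_class[OF assms(2)] tp.Qp_add[OF assms])
    (simp only: qp_class_def)

lemma qp_class_mult:
  assumes "s \<in> padic_cauchy test_prime" "t \<in> padic_cauchy test_prime"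
  shows "qp_class s * qp_class t = qp_class (\<lambda>n. s n * t n)"
  by (simp only: times_qp_def Rep_qp_class[OF assms(1)] Rep_qp_class[OF assms(2)] tp.Qp_mult[OF assms])
    (simp only: qp_class_def)

lemma qp_class_0: "qp_class (\<lambda>n. 0) = 0" by (simp add: qp_class_def zero_qp_def tp.Qp_zero)
lemma qp_class_1: "qp_class (\<lambda>n. 1) = 1" by (simp add: qp_class_def one_qp_def tp.Qp_one)

lemma qp_class_minus:
  assumes "s \<in> padic_cauchy test_prime"
  shows "- qp_class s = qp_class (\<lambda>n. - s n)"
  using qp_class_add[OF assms tp.cauchy_minus[OF assms]]
  by (simp add: qp_class_0 add_eq_0_iff)

lemma qp_class_diff:
  assumes "s \<in> padic_cauchy test_prime" "t \<in> padic_cauchy test_prime"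
  shows "qp_class s - qp_class t = qp_class (\<lambda>n. s n - t n)"
  unfolding diff_conv_add_uminus qp_class_minus[OF assms(2)]
  by (rule qp_class_add[OF assms(1) tp.cauchy_minus[OF assms(2)]])

lemma qp_class_of_nat: "qp_class (\<lambda>_. of_nat n) = of_nat n"
proof (induction n)
  case (Suc n)
  have "qp_class (\<lambda>_. of_nat (Suc n)) = qp_class (\<lambda>_. 1) + qp_class (\<lambda>_. of_nat n)"
    by (subst qp_class_add) (auto simp: tp.cauchy_const)
  thus ?case using Suc by (simp add: qp_class_1)
qed (simp add: qp_class_0)

instance qp :: field_char_0
proof
  show "inj (of_nat :: nat \<Rightarrow> qp)"
  proof (rule injI)
    fix m n assume "(of_nat m :: qp) = of_nat n"
    hence "(\<lambda>_. of_nat m - of_nat n) \<in> padic_null test_prime"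
      using qp_class_eq_iff[OF tp.cauchy_const tp.cauchy_const] by (simp flip: qp_class_of_nat)
    moreover have "tp.has_val (\<lambda>_. x) (rat_val test_prime x)" if "x \<noteq> 0" for x
      using that by (simp add: tp.has_val_def)
    ultimately have "(of_nat m - of_nat n :: rat) = 0" using tp.has_val_not_null by blast
    thus "m = n" by simp
  qed
qed

lemma qp_class_of_int: "qp_class (\<lambda>_. of_int n) = of_int n"
proof (cases n)
  case (nonneg k)
  thus ?thesis using qp_class_of_nat[of k] by simp
next
  case (neg k)
  have "qp_class (\<lambda>_. of_int n) = - qp_class (\<lambda>_. of_nat (Suc k))"
    by (subst qp_class_minus) (auto simp: tp.cauchy_const neg)
  thus ?thesis by (simp add: qp_class_of_nat neg del: of_nat_Suc)
qed

lemma qp_class_of_rat: "qp_class (\<lambda>_. x) = of_rat x"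
proof -
  obtain a b where x: "x = of_int a / of_int b" "b > 0" by (rule tp.rat_fraction)
  have "qp_class (\<lambda>_. x) * of_int b = of_int a"
    unfolding qp_class_of_int[symmetric]
    by (subst qp_class_mult) (use x in \<open>auto simp: tp.cauchy_const\<close>)
  moreover have "(of_int b :: qp) \<noteq> 0" using x(2) by simp
  ultimately have "qp_class (\<lambda>_. x) = of_int a / of_int b" by (simp add: eq_divide_eq)
  thus ?thesis by (simp add: x(1) of_rat_divide)
qed

lemma Rep_qp_of_rat: "Rep_qp (of_rat x) = Qp_of_rat test_prime x"
  by (simp flip: qp_class_of_rat add: Rep_qp_class tp.cauchy_const tp.Qp_of_rat_cls)

section \<open>The valuation on the type and its completeness\<close>

definition qp_val :: "qp \<Rightarrow> int" where "qp_val x = Qp_val test_prime (Rep_qp x)"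

lemma qp_class_nonzero_iff:
  assumes "s \<in> padic_cauchy test_prime"
  shows "qp_class s \<noteq> 0 \<longleftrightarrow> (\<exists>k. tp.has_val s k)"
  using qp_class_eq_iff[OF assms tp.cauchy_const[of 0]] tp.cauchy_has_val[OF assms] tp.has_val_not_null[of s]
  by (auto simp: qp_class_0)

lemma qp_val_class: "s \<in> padic_cauchy test_prime \<Longrightarrow> tp.has_val s k \<Longrightarrow> qp_val (qp_class s) = k"
  by (simp add: qp_val_def Rep_qp_class tp.Qp_val_cls)

lemma qp_nonzero_repr:
  assumes "x \<noteq> 0"
  shows "\<exists>s M. s \<in> padic_cauchy test_prime \<and> x = qp_class s \<and>
    (\<forall>n\<ge>M. s n \<noteq> 0 \<and> rat_val test_prime (s n) = qp_val x)"
proof -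
  obtain s where s: "s \<in> padic_cauchy test_prime" "x = qp_class s" by (rule qp_cases)
  then obtain k where k: "tp.has_val s k" using assms qp_class_nonzero_iff by blast
  hence "k = qp_val x" using qp_val_class s by simp
  thus ?thesis using s k unfolding tp.has_val_def by blast
qed

lemma qp_val_eqI:
  assumes "s \<in> padic_cauchy test_prime" "\<And>n. n \<ge> M \<Longrightarrow> s n \<noteq> 0 \<and> rat_val test_prime (s n) = k"
  shows "qp_val (qp_class s) = k"
  using assms by (intro qp_val_class) (auto simp: tp.has_val_def)

lemma qp_vge_class:
  assumes "s \<in> padic_cauchy test_prime" "\<And>n. n \<ge> M \<Longrightarrow> tp.rge k (s n)"
  shows "qp_class s = 0 \<or> k \<le> qp_val (qp_class s)"
proof (cases "qp_class s = 0")
  case False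
  then obtain l where "tp.has_val s l" using qp_class_nonzero_iff assms(1) by blast
  hence l: "qp_val (qp_class s) = l" and "\<exists>N. \<forall>n\<ge>N. s n \<noteq> 0 \<and> rat_val test_prime (s n) = l"
    using qp_val_class assms(1) by (auto simp: tp.has_val_def)
  then obtain N where N: "\<And>n. n \<ge> N \<Longrightarrow> s n \<noteq> 0 \<and> rat_val test_prime (s n) = l" by blast
  show ?thesis using assms(2)[of "max M N"] N[of "max M N"] l by (auto simp: tp.rge_def)
qed simp

lemma qp_class_rge:
  assumes "s \<in> padic_cauchy test_prime" "qp_class s = 0 \<or> k \<le> qp_val (qp_class s)"
  shows "\<exists>M. \<forall>n\<ge>M. tp.rge k (s n)"
proof (cases "qp_class s = 0")
  case True
  hence "s \<in> padic_null test_prime"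
    using qp_class_eq_iff[OF assms(1) tp.cauchy_const[of 0]] by (simp add: qp_class_0)
  then obtain M where "\<forall>n\<ge>M. tp.rge (int (nat k)) (s n)" unfolding tp.padic_null_iff by blast
  thus ?thesis by (intro exI[of _ M]) (auto intro: tp.rge_mono)
next
  case False
  then obtain l where "tp.has_val s l" using qp_class_nonzero_iff assms(1) by blast
  moreover from this have "qp_val (qp_class s) = l" using qp_val_class assms(1) by blast
  ultimately show ?thesis using assms(2) False unfolding tp.has_val_def tp.rge_def by metis
qed

text \<open>A late term of a representing sequence is a fraction a / b with \<open>b\<close> prime
  to the prime and agrees with \<open>x\<close> to the required order. With c an inverse of b modulo
  the prime power, the integer c a approximates the fraction.\<close>

lemma qp_integers_dense:
  assumes "x = 0 \<or> 0 \<le> qp_val x"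
  shows "\<exists>n::int. x = of_int n \<or> k \<le> qp_val (x - of_int n)"
proof -
  define K where "K = nat k"
  obtain s where s: "s \<in> padic_cauchy test_prime" "x = qp_class s" by (rule qp_cases)
  have "\<exists>M. \<forall>n\<ge>M. tp.rge 0 (s n)" by (rule qp_class_rge[OF s(1)]) (use assms s(2) in simp)
  then obtain M where M: "\<And>n. n \<ge> M \<Longrightarrow> tp.rge 0 (s n)" by blast
  obtain N where N: "\<And>i j. i \<ge> N \<Longrightarrow> j \<ge> N \<Longrightarrow> tp.rge (int K) (s i - s j)"
    using s(1) unfolding tp.padic_cauchy_iff by blast
  define L where "L = max M N"
  obtain n :: int where n: "tp.rge (int K) (s L - of_int n)"
  proof -
    obtain a b where ab: "quotient_of (s L) = (a, b)" by (cases "quotient_of (s L)")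
    hence sL: "s L = of_int a / of_int b" "b > 0" "Rings.coprime a b"
      by (auto simp: quotient_of_div quotient_of_denom_pos quotient_of_coprime)
    have pb: "\<not> int test_prime dvd b"
    proof
      assume pb: "int test_prime dvd b"
      hence "\<not> int test_prime dvd a" using sL(3) tp.prime_int_p
        by (metis coprime_common_divisor not_prime_unit)
      hence "a \<noteq> 0" "multiplicity (int test_prime) a = 0" by (auto simp: not_dvd_imp_multiplicity_0)
      moreover have "multiplicity (int test_prime) b > 0"
        using pb sL(2) tp.prime_int_p by (simp add: prime_multiplicity_gt_zero_iff)
      ultimately show False using M[of L] sL tp.rat_val_divide[of a b] by (simp add: tp.rge_def L_def)
    qed
    have "Rings.coprime (int test_prime) b" by (rule prime_imp_coprime[OF tp.prime_int_p pb])
    hence "Rings.coprime b (int test_prime ^ K)" by (simp add: coprime_commute)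
    then obtain c where "[b * c = 1] (mod int test_prime ^ K)" using cong_solve_coprime_int by blast
    hence "[b * c * a = 1 * a] (mod int test_prime ^ K)" by (rule cong_scalar_right)
    hence dvd: "int test_prime ^ K dvd a - b * (c * a)"
      by (simp add: cong_iff_dvd_diff dvd_diff_commute mult.assoc)
    have eq: "s L - of_int (c * a) = of_int (a - b * (c * a)) / of_int b"
      using sL by (simp add: field_simps)
    have "tp.rge (int K) (s L - of_int (c * a))"
    proof (cases "a - b * (c * a) = 0")
      case True
      thus ?thesis by (simp only: eq True) simp
    next
      case False
      have "multiplicity (int test_prime) b = 0" using pb by (simp add: not_dvd_imp_multiplicity_0)
      hence "rat_val test_prime (s L - of_int (c * a)) = int (multiplicity (int test_prime) (a - b * (c * a)))"
        unfolding eq using tp.rat_val_divide[OF False, of b] sL(2) by simp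
      moreover have "K \<le> multiplicity (int test_prime) (a - b * (c * a))"
        using dvd False tp.prime_int_p by (intro multiplicity_geI) (auto simp: not_prime_unit)
      ultimately show ?thesis by (simp add: tp.rge_def)
    qed
    thus thesis by (rule that)
  qed
  define t where "t = (\<lambda>m. s m - of_int n)"
  have t: "t \<in> padic_cauchy test_prime"
    using tp.cauchy_add[OF s(1) tp.cauchy_const[of "- of_int n"]] by (simp add: t_def)
  have "tp.rge k (t m)" if "m \<ge> L" for m
  proof -
    have "tp.rge (int K) ((s m - s L) + (s L - of_int n))"
      using that by (intro tp.rge_add n N) (auto simp: L_def)
    hence "tp.rge (int K) (t m)" by (simp add: t_def)
    thus ?thesis by (rule tp.rge_mono) (simp add: K_def)
  qed
  from qp_vge_class[OF t this] have "qp_class t = 0 \<or> k \<le> qp_val (qp_class t)" .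
  moreover have "qp_class t = x - of_int n"
    unfolding s(2) t_def qp_class_of_int[symmetric] by (rule qp_class_diff[OF s(1) tp.cauchy_const, symmetric])
  ultimately show ?thesis by auto
qed

text \<open>A diagonal argument: a late term of a representative of \<open>s n\<close> is a rational
  \<open>x n\<close> within order \<open>n\<close> of \<open>s n\<close>. These rationals form a
  Cauchy sequence whose class is the limit.\<close>

lemma qp_complete:
  assumes "\<And>n. s (Suc n) = s n \<or> int n \<le> qp_val (s (Suc n) - s n)"
  shows "\<exists>l. \<forall>n. l = s n \<or> int n \<le> qp_val (l - s n)"
proof -
  define a where "a n = (SOME t. t \<in> padic_cauchy test_prime \<and> s n = qp_class t)" for n
  have a: "a n \<in> padic_cauchy test_prime" "s n = qp_class (a n)" for n
  proof -
    have "\<exists>t. t \<in> padic_cauchy test_prime \<and> s n = qp_class t" using qp_cases by metis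
    from someI_ex[OF this] show "a n \<in> padic_cauchy test_prime" "s n = qp_class (a n)"
      by (simp_all add: a_def)
  qed
  have "\<exists>x. \<exists>M. \<forall>i\<ge>M. tp.rge (int n) (x - a n i)" for n
  proof -
    obtain M where "\<And>i j. i \<ge> M \<Longrightarrow> j \<ge> M \<Longrightarrow> tp.rge (int n) (a n i - a n j)"
      using a(1)[of n] unfolding tp.padic_cauchy_iff by blast
    thus ?thesis by (intro exI[of _ "a n M"] exI[of _ M]) auto
  qed
  then obtain x where x: "\<And>n. \<exists>M. \<forall>i\<ge>M. tp.rge (int n) (x n - a n i)" by metis
  have close: "tp.rge (int n) (x (Suc n) - x n)" for n
  proof -
    have d: "qp_class (\<lambda>i. a (Suc n) i - a n i) = s (Suc n) - s n"
      unfolding a(2) by (rule qp_class_diff[OF a(1) a(1), symmetric])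
    have c: "(\<lambda>i. a (Suc n) i - a n i) \<in> padic_cauchy test_prime"
      using tp.cauchy_add[OF a(1) tp.cauchy_minus[OF a(1)]] by simp
    obtain M1 where M1: "\<And>i. i \<ge> M1 \<Longrightarrow> tp.rge (int n) (a (Suc n) i - a n i)"
      using qp_class_rge[OF c, of "int n"] assms[of n] unfolding d by auto
    obtain M2 where M2: "\<And>i. i \<ge> M2 \<Longrightarrow> tp.rge (int n) (x n - a n i)" using x by blast
    obtain M3 where M3: "\<And>i. i \<ge> M3 \<Longrightarrow> tp.rge (int (Suc n)) (x (Suc n) - a (Suc n) i)" using x by blast
    define i where "i = max M1 (max M2 M3)"
    have "tp.rge (int n) ((x (Suc n) - a (Suc n) i) + (a (Suc n) i - a n i) - (x n - a n i))"
      by (intro tp.rge_diff tp.rge_add tp.rge_mono[OF M3] M1 M2) (auto simp: i_def)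
    thus ?thesis by simp
  qed
  have tail: "tp.rge (int n) (x m - x n)" if "m \<ge> n" for m n
    using that
  proof (induction m rule: dec_induct)
    case (step m)
    have "tp.rge (int n) ((x (Suc m) - x m) + (x m - x n))"
      using step by (intro tp.rge_add tp.rge_mono[OF close[of m]]) auto
    thus ?case by simp
  qed simp
  have xc: "x \<in> padic_cauchy test_prime"
    unfolding tp.padic_cauchy_iff
  proof (intro allI exI impI)
    fix k i j :: nat assume "k \<le> i" "k \<le> j"
    from tp.rge_diff[OF tail[OF this(1)] tail[OF this(2)]] show "tp.rge (int k) (x i - x j)" by simp
  qed
  have "qp_class x = s n \<or> int n \<le> qp_val (qp_class x - s n)" for n
  proof -
    have d: "qp_class (\<lambda>i. x i - a n i) = qp_class x - s n"
      unfolding a(2) by (rule qp_class_diff[OF xc a(1), symmetric])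
    have c: "(\<lambda>i. x i - a n i) \<in> padic_cauchy test_prime"
      using tp.cauchy_add[OF xc tp.cauchy_minus[OF a(1)]] by simp
    obtain M where M: "\<And>i. i \<ge> M \<Longrightarrow> tp.rge (int n) (x n - a n i)" using x by blast
    have "tp.rge (int n) (x i - a n i)" if "i \<ge> max M n" for i
      using tp.rge_add[OF tail[of n i] M[of i]] that by simp
    hence "qp_class (\<lambda>i. x i - a n i) = 0 \<or> int n \<le> qp_val (qp_class (\<lambda>i. x i - a n i))"
      by (rule qp_vge_class[OF c])
    thus ?thesis unfolding d by auto
  qed
  thus ?thesis by blast
qed

interpretation qp: padic_valued_field test_prime qp_val
proof
  show "prime test_prime" by (rule prime_test_prime)
  show "qp_val (x * y) = qp_val x + qp_val y" if "x \<noteq> 0" "y \<noteq> 0" for x y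
  proof -
    obtain s M where s: "s \<in> padic_cauchy test_prime" "x = qp_class s"
      "\<And>n. n \<ge> M \<Longrightarrow> s n \<noteq> 0 \<and> rat_val test_prime (s n) = qp_val x" using qp_nonzero_repr[OF \<open>x \<noteq> 0\<close>] by blast
    obtain t N where t: "t \<in> padic_cauchy test_prime" "y = qp_class t"
      "\<And>n. n \<ge> N \<Longrightarrow> t n \<noteq> 0 \<and> rat_val test_prime (t n) = qp_val y" using qp_nonzero_repr[OF \<open>y \<noteq> 0\<close>] by blast
    have "x * y = qp_class (\<lambda>n. s n * t n)" by (simp add: s(2) t(2) qp_class_mult s(1) t(1))
    moreover have "qp_val (qp_class (\<lambda>n. s n * t n)) = qp_val x + qp_val y"
    proof (rule qp_val_eqI[OF tp.cauchy_mult[OF s(1) t(1)]])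
      fix n assume "n \<ge> max M N"
      thus "s n * t n \<noteq> 0 \<and> rat_val test_prime (s n * t n) = qp_val x + qp_val y"
        using s(3)[of n] t(3)[of n] tp.rat_val_mult[of "s n" "t n"] by simp
    qed
    ultimately show ?thesis by simp
  qed
  show "min (qp_val x) (qp_val y) \<le> qp_val (x + y)" if "x \<noteq> 0" "y \<noteq> 0" "x + y \<noteq> 0" for x y
  proof -
    obtain s M where s: "s \<in> padic_cauchy test_prime" "x = qp_class s"
      "\<And>n. n \<ge> M \<Longrightarrow> s n \<noteq> 0 \<and> rat_val test_prime (s n) = qp_val x" using qp_nonzero_repr[OF \<open>x \<noteq> 0\<close>] by blast
    obtain t N where t: "t \<in> padic_cauchy test_prime" "y = qp_class t"
      "\<And>n. n \<ge> N \<Longrightarrow> t n \<noteq> 0 \<and> rat_val test_prime (t n) = qp_val y" using qp_nonzero_repr[OF \<open>y \<noteq> 0\<close>] by blast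
    have xy: "x + y = qp_class (\<lambda>n. s n + t n)" by (simp add: s(2) t(2) qp_class_add s(1) t(1))
    have "qp_class (\<lambda>n. s n + t n) = 0 \<or> min (qp_val x) (qp_val y) \<le> qp_val (qp_class (\<lambda>n. s n + t n))"
    proof (rule qp_vge_class[OF tp.cauchy_add[OF s(1) t(1)]])
      fix n assume "n \<ge> max M N"
      thus "tp.rge (min (qp_val x) (qp_val y)) (s n + t n)"
        using s(3)[of n] t(3)[of n] by (intro tp.rge_add) (auto simp: tp.rge_def)
    qed
    thus ?thesis using that(3) by (simp flip: xy)
  qed
  show "qp_val (of_int n) = int (multiplicity (int test_prime) n)" if "n \<noteq> 0" for n
    unfolding qp_class_of_int[symmetric]
    by (rule qp_val_eqI[OF tp.cauchy_const]) (use that in \<open>auto simp: tp.rat_val_of_int\<close>)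
qed (fact qp_integers_dense qp_complete)+

section \<open>Coefficient lists over a field given as a type\<close>

text \<open>A dictionary between polynomials over a field type and coefficient lists over the image
  of that field in a ring given as a record. It is used twice: for Q_p itself and for Q_p inside its
  algebraic closure.\<close>

locale typed_subfield = domain R for R (structure) +
  fixes \<phi> :: "'f::field \<Rightarrow> 'a"
  assumes \<phi>_carrier [simp, intro]: "\<phi> x \<in> carrier R"
    and \<phi>_1: "\<phi> 1 = \<one>"
    and \<phi>_add: "\<phi> (x + y) = \<phi> x \<oplus> \<phi> y"
    and \<phi>_mult: "\<phi> (x * y) = \<phi> x \<otimes> \<phi> y"
    and subfield_range: "subfield (range \<phi>) R"
begin

lemma \<phi>_0: "\<phi> 0 = \<zero>"
proof -
  have "\<phi> 0 \<oplus> \<phi> 0 = \<phi> 0" using \<phi>_add[of 0 0] by simp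
  thus ?thesis using add.l_cancel_one[of "\<phi> 0" "\<phi> 0"] by simp
qed

lemma \<phi>_minus: "\<phi> (- x) = \<ominus> \<phi> x"
  using \<phi>_add[of "- x" x] by (intro minus_equality[symmetric]) (auto simp: \<phi>_0)

lemma \<phi>_eq_iff [simp]: "\<phi> x = \<phi> y \<longleftrightarrow> x = y"
proof
  assume eq: "\<phi> x = \<phi> y"
  show "x = y"
  proof (rule ccontr)
    assume "x \<noteq> y"
    hence "\<phi> ((x + - y) * inverse (x + - y)) = \<one>" by (simp add: \<phi>_1)
    moreover have "\<phi> (x + - y) = \<zero>" using eq by (simp only: \<phi>_add \<phi>_minus r_neg \<phi>_carrier)
    ultimately show False by (simp add: \<phi>_mult)
  qed
qed simp

lemma \<phi>_sum: "finite I \<Longrightarrow> \<phi> (\<Sum>i\<in>I. f i) = (\<Oplus>i\<in>I. \<phi> (f i))"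
  by (induction I rule: finite_induct) (auto simp: \<phi>_0 \<phi>_add)

lemma subring_range: "subring (range \<phi>) R" by (rule subfieldE(1)[OF subfield_range])

definition list_of :: "'f poly \<Rightarrow> 'a list" where "list_of f = map \<phi> (rev (coeffs f))"

lemma list_of_0 [simp]: "list_of 0 = []" by (simp add: list_of_def)

lemma list_of_eq_Nil_iff [simp]: "list_of f = [] \<longleftrightarrow> f = 0" by (simp add: list_of_def)

lemma set_list_of: "set (list_of f) \<subseteq> range \<phi>" "set (list_of f) \<subseteq> carrier R"
  by (auto simp: list_of_def)

lemma length_list_of: "f \<noteq> 0 \<Longrightarrow> length (list_of f) = Suc (Polynomial.degree f)"
  by (simp add: list_of_def length_coeffs_degree)

lemma hd_list_of: "f \<noteq> 0 \<Longrightarrow> hd (list_of f) = \<phi> (Polynomial.lead_coeff f)"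
  by (simp add: list_of_def hd_map hd_rev last_coeffs_eq_coeff_degree)

lemma degree_list_of [simp]: "Polynomials.degree (list_of f) = Polynomial.degree f"
  by (cases "f = 0") (auto simp: length_list_of)

lemma coeff_list_of: "coeff (list_of f) i = \<phi> (Polynomial.coeff f i)"
proof (cases "f = 0 \<or> Polynomial.degree f < i")
  case True
  thus ?thesis
  proof
    assume "Polynomial.degree f < i"
    thus ?thesis using coeff_degree[of "list_of f" i] by (cases "f = 0") (auto simp: \<phi>_0 coeff_eq_0 length_list_of)
  qed (simp add: \<phi>_0)
next
  case False
  hence "i < length (list_of f)" by (simp add: length_list_of)
  from coeff_nth[OF this] show ?thesis using False
    by (simp add: list_of_def rev_nth length_coeffs_degree nth_coeffs_coeff)
qed

lemma polynomial_list_of: "polynomial (range \<phi>) (list_of f)" "polynomial (carrier R) (list_of f)"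
  using set_list_of[of f] hd_list_of[of f] \<phi>_eq_iff[of "Polynomial.lead_coeff f" 0]
  by (cases "f = 0"; simp add: polynomial_def \<phi>_0 del: \<phi>_eq_iff)+

lemma list_of_carrier: "list_of f \<in> carrier ((range \<phi>)[X])" "list_of f \<in> carrier (poly_ring R)"
  using polynomial_list_of by (simp_all add: univ_poly_carrier)

lemma list_of_inject [simp]: "list_of f = list_of g \<longleftrightarrow> f = g"
proof
  assume "list_of f = list_of g"
  hence "Polynomial.coeff f i = Polynomial.coeff g i" for i
    using coeff_list_of[of f i] coeff_list_of[of g i] by simp
  thus "f = g" by (rule poly_eqI)
qed simp

lemma list_of_cases:
  assumes "l \<in> carrier ((range \<phi>)[X])"
  obtains f where "l = list_of f"
proof -
  have pl: "polynomial (range \<phi>) l" using assms by (simp add: univ_poly_carrier)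
  hence "set l \<subseteq> range \<phi>" by (auto simp: polynomial_def)
  hence "l \<in> lists (range \<phi>)" by auto
  then obtain xs where xs: "l = map \<phi> xs" by (auto simp: lists_image)
  have "xs = rev (coeffs (Poly (rev xs)))"
  proof (cases "xs = []")
    case False
    hence "hd xs \<noteq> 0" using pl by (auto simp: polynomial_def xs hd_map \<phi>_0)
    thus ?thesis using False by (cases xs) auto
  qed simp
  thus thesis using that[of "Poly (rev xs)"] xs by (simp add: list_of_def)
qed

lemma list_of_mult: "list_of (f * g) = poly_mult (list_of f) (list_of g)"
proof -
  have "coeff (poly_mult (list_of f) (list_of g)) i = coeff (list_of (f * g)) i" for i
    by (simp add: poly_mult_coeff[OF set_list_of(2) set_list_of(2)] coeff_list_of coeff_mult \<phi>_sum \<phi>_mult)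
  thus ?thesis
    using coeff_iff_polynomial_cond[OF polynomial_list_of(2)
        poly_mult_closed[OF carrier_is_subring polynomial_list_of(2) polynomial_list_of(2)]] by auto
qed

lemma eval_list_of_carrier [simp]: "y \<in> carrier R \<Longrightarrow> eval (list_of f) y \<in> carrier R"
  by (rule eval_in_carrier[OF set_list_of(2)])

lemma eval_list_of_pCons:
  assumes "y \<in> carrier R"
  shows "eval (list_of (pCons c f)) y = eval (list_of f) y \<otimes> y \<oplus> \<phi> c"
proof (cases "f = 0 \<and> c = 0")
  case False
  hence "list_of (pCons c f) = list_of f @ [\<phi> c]" by (auto simp: list_of_def cCons_def)
  thus ?thesis using eval_append_aux[OF set_list_of(2) _ assms] by simp
qed (use assms in \<open>simp add: \<phi>_0\<close>)

lemma eval_list_of_add: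
  assumes y: "y \<in> carrier R"
  shows "eval (list_of (f + g)) y = eval (list_of f) y \<oplus> eval (list_of g) y"
proof (induction f g rule: poly_induct2)
  case (pCons a f b g)
  let ?u = "eval (list_of f) y" and ?w = "eval (list_of g) y"
  have u: "?u \<in> carrier R" and w: "?w \<in> carrier R" using y by simp_all
  have "(?u \<oplus> ?w) \<otimes> y \<oplus> (\<phi> a \<oplus> \<phi> b) = (?u \<otimes> y \<oplus> \<phi> a) \<oplus> (?w \<otimes> y \<oplus> \<phi> b)"
    using u w y by (simp add: l_distr a_ac)
  thus ?case by (simp only: add_pCons eval_list_of_pCons[OF y] pCons.IH \<phi>_add)
qed simp

lemma eval_list_of_mult:
  assumes y: "y \<in> carrier R"
  shows "eval (list_of (f * g)) y = eval (list_of f) y \<otimes> eval (list_of g) y"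
  using ring_hom_mult[OF eval_is_hom[OF carrier_is_subring y] list_of_carrier(2) list_of_carrier(2)]
  by (simp add: list_of_mult univ_poly_mult)

lemma eval_list_of_pcompose:
  assumes y: "y \<in> carrier R"
  shows "eval (list_of (f \<circ>\<^sub>p g)) y = eval (list_of f) (eval (list_of g) y)"
proof (induction f)
  case (pCons a f)
  have w: "eval (list_of g) y \<in> carrier R" using y by simp
  have c: "eval (list_of [:a:]) y = \<phi> a" using eval_list_of_pCons[OF y, of a 0] y by simp
  show ?case
    using y w by (simp add: pcompose_pCons eval_list_of_add eval_list_of_mult c eval_list_of_pCons[OF w] pCons.IH
        m_comm a_comm)
qed simp

lemma eval_list_of_base: "eval (list_of f) (\<phi> x) = \<phi> (poly f x)"
  by (induction f) (simp_all add: \<phi>_0 eval_list_of_pCons \<phi>_add \<phi>_mult m_comm a_comm)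

lemma const_term_list_of: "const_term (list_of f) = \<phi> (poly f 0)"
  using eval_list_of_base[of f 0] by (simp add: const_term_def \<phi>_0)

lemma list_of_Units_iff: "list_of f \<in> Units ((range \<phi>)[X]) \<longleftrightarrow> f \<noteq> 0 \<and> Polynomial.degree f = 0"
  using univ_poly_units'[OF subfield_range, of "list_of f"] list_of_carrier(1)[of f]
  by (cases "f = 0") (auto simp: length_list_of)

lemma pirreducible_list_of_iff:
  "pirreducible (range \<phi>) (list_of f) \<longleftrightarrow> Factorial_Ring.irreducible f"
proof
  assume irr: "Factorial_Ring.irreducible f"
  show "pirreducible (range \<phi>) (list_of f)"
  proof (rule pirreducibleI[OF subring_range list_of_carrier(1)])
    show "list_of f \<noteq> []" using irr by auto
    show "list_of f \<notin> Units ((range \<phi>)[X])"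
      using irr by (simp add: list_of_Units_iff irreducible_poly_iff_degree)
    fix q r
    assume "q \<in> carrier ((range \<phi>)[X])" "r \<in> carrier ((range \<phi>)[X])" and f: "list_of f = q \<otimes>\<^bsub>(range \<phi>)[X]\<^esub> r"
    then obtain g h where gh: "q = list_of g" "r = list_of h" using list_of_cases by metis
    have "f = g * h" using f by (simp add: gh univ_poly_mult flip: list_of_mult)
    moreover from this have "g \<noteq> 0" "h \<noteq> 0" using irr by auto
    ultimately show "q \<in> Units ((range \<phi>)[X]) \<or> r \<in> Units ((range \<phi>)[X])"
      using irr by (auto simp: gh list_of_Units_iff irreducible_poly_iff_degree)
  qed
next
  assume irr: "pirreducible (range \<phi>) (list_of f)"
  note irr = pirreducibleE[OF subring_range list_of_carrier(1) irr]
  have f: "f \<noteq> 0" using irr(1) by simp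
  hence "Polynomial.degree f > 0" using irr(2) by (simp add: list_of_Units_iff)
  moreover have "Polynomial.degree g = 0 \<or> Polynomial.degree h = 0" if "f = g * h" for g h
    using irr(3)[OF list_of_carrier(1) list_of_carrier(1), of g h]
    by (auto simp: that univ_poly_mult list_of_mult list_of_Units_iff)
  ultimately show "Factorial_Ring.irreducible f" by (simp add: irreducible_poly_iff_degree)
qed

text \<open>By uniqueness of the minimal polynomial, exhibiting one monic irreducible annihilator
  computes \<open>Irr\<close>.\<close>

lemma Irr_eq_list_of:
  assumes "y \<in> carrier R" "Factorial_Ring.irreducible f" "Polynomial.lead_coeff f = 1" "eval (list_of f) y = \<zero>"
  shows "Irr (range \<phi>) y = list_of f"
proof -
  have f0: "f \<noteq> 0" using assms(2) by auto
  have alg: "(algebraic over (range \<phi>)) y"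
    using f0 by (intro algebraicI[OF list_of_carrier(1) _ assms(4)]) simp
  have f: "list_of f \<in> carrier ((range \<phi>)[X]) \<and> pirreducible (range \<phi>) (list_of f) \<and>
    eval (list_of f) y = \<zero> \<and> hd (list_of f) = \<one>"
    using list_of_carrier(1) assms f0 by (simp add: pirreducible_list_of_iff hd_list_of \<phi>_1)
  have "\<exists>!p. p \<in> carrier ((range \<phi>)[X]) \<and> pirreducible (range \<phi>) p \<and> eval p y = \<zero> \<and> hd p = \<one>"
    using minimal_polynomial_is_unique[OF subfield_range assms(1) alg] by blast
  from the1_equality[OF this f] show ?thesis by (simp only: Irr_def)
qed

end

section \<open>The \<open>p\<close>-adic roots of the minimal polynomial\<close>

text \<open>Some monic irreducible factor of a monic integer equation vanishes at \<beta>, and two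
  such polynomials divide each other; so the description in the definition does denote.\<close>

lemma rat_min_poly:
  assumes "algebraic_int \<beta>"
  shows "Polynomial.lead_coeff (rat_min_poly \<beta>) = 1" "Factorial_Ring.irreducible (rat_min_poly \<beta>)"
    "rpoly (rat_min_poly \<beta>) \<beta> = 0"
proof -
  define Q where "Q m \<longleftrightarrow> Polynomial.lead_coeff m = 1 \<and> Factorial_Ring.irreducible m \<and> rpoly m \<beta> = 0" for m
  obtain P where P: "poly (map_poly of_int P) \<beta> = 0" "Polynomial.lead_coeff P = 1"
    using assms by (auto simp: algebraic_int_altdef_ipoly)
  have "Polynomial.lead_coeff (map_poly of_int P :: rat poly) = 1" using P(2) by simp
  from this dvd_refl have "rpoly (map_poly of_int P) \<beta> = 0 \<longrightarrow> (\<exists>m. Q m)"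
  proof (induction rule: monic_factor_induct)
    case (mult g f)
    thus ?case by (auto simp: Q_def of_rat_poly_hom.hom_mult)
  qed simp
  hence "\<exists>m. Q m" using P(1) by (simp add: map_poly_of_rat_of_int)
  moreover have "m = m'" if "Q m" "Q m'" for m m'
  proof (rule poly_dvd_antisym)
    have h: "field_hom (of_rat :: rat \<Rightarrow> complex)" ..
    show "m dvd m'" "m' dvd m" using that irreducible_dvd_of_common_root[OF h] by (auto simp: Q_def)
  qed (use that in \<open>simp add: Q_def\<close>)
  ultimately have "\<exists>!m. Q m" by blast
  from theI'[OF this] have "Q (rat_min_poly \<beta>)" unfolding rat_min_poly_def Q_def .
  thus "Polynomial.lead_coeff (rat_min_poly \<beta>) = 1" "Factorial_Ring.irreducible (rat_min_poly \<beta>)"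
    "rpoly (rat_min_poly \<beta>) \<beta> = 0" by (simp_all add: Q_def)
qed

lemma range_Rep_qp: "range Rep_qp = carrier QQ"
  by (rule type_definition.Rep_range[OF type_definition_qp])

interpretation tq: typed_subfield QQ Rep_qp
proof (intro typed_subfield.intro typed_subfield_axioms.intro)
  show "domain QQ" by (rule field.axioms(1)[OF tp.field_Qp])
  show "subfield (range Rep_qp) QQ"
    unfolding range_Rep_qp by (rule field.carrier_is_subfield[OF tp.field_Qp])
qed (simp_all add: Rep_qp_simps)

section \<open>Q_p inside its algebraic closure\<close>

abbreviation "QB \<equiv> Qp_bar test_prime"
abbreviation "incl x \<equiv> Qp_incl test_prime (Rep_qp x)"

lemma algebraic_closure_QB: "algebraic_closure QB (Qp_incl test_prime ` carrier QQ)"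
  unfolding Qp_bar_def Qp_incl_def by (rule field.alg_closureE(1)[OF tp.field_Qp])

lemma Qp_incl_hom: "Qp_incl test_prime \<in> Ring.ring_hom QQ QB"
  unfolding Qp_bar_def Qp_incl_def by (rule field.alg_closureE(2)[OF tp.field_Qp])

lemma range_incl: "range (\<lambda>x. incl x) = Qp_incl test_prime ` carrier QQ"
  by (simp flip: range_Rep_qp add: image_image)

interpretation tb: typed_subfield QB "\<lambda>x. incl x"
proof (intro typed_subfield.intro typed_subfield_axioms.intro)
  show "domain QB" by (rule field.axioms(1)[OF algebraic_closure.axioms(1)[OF algebraic_closure_QB]])
  show "subfield (range (\<lambda>x. incl x)) QB"
    unfolding range_incl by (rule algebraic_closure.axioms(2)[OF algebraic_closure_QB])
qed (simp_all add: Rep_qp_simps ring_hom_closed[OF Qp_incl_hom] ring_hom_one[OF Qp_incl_hom]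
    ring_hom_add[OF Qp_incl_hom] ring_hom_mult[OF Qp_incl_hom])

lemma map_Qp_incl_list_of: "map (Qp_incl test_prime) (tq.list_of f) = tb.list_of f"
  by (simp add: tq.list_of_def tb.list_of_def)

lemma QB_root:
  assumes "Polynomial.degree f > 0"
  shows "\<exists>y\<in>carrier QB. ring.eval QB (tb.list_of f) y = \<zero>\<^bsub>QB\<^esub>"
proof -
  have "ring.splitted QB (tb.list_of f)"
    using algebraic_closure.roots_over_subfield[OF algebraic_closure_QB] tb.list_of_carrier(1)[of f]
    by (simp add: range_incl)
  hence "size (ring.roots QB (tb.list_of f)) = Polynomial.degree f"
    using tb.degree_list_of[of f] by (simp only: tb.splitted_def)
  hence "ring.roots QB (tb.list_of f) \<noteq> {#}" using assms by auto
  then obtain y where "y \<in># ring.roots QB (tb.list_of f)" by auto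
  thus ?thesis unfolding tb.roots_mem_iff_is_root[OF tb.list_of_carrier(2)] tb.is_root_def by blast
qed

text \<open>The minimal polynomial of \<open>z - y\<close> is \<open>\<plusminus>g(z - X)\<close>, with constant term \<open>\<plusminus>g(z)\<close>.\<close>

lemma Qp_bar_val_diff:
  assumes y: "y \<in> carrier QB" and irr: "Factorial_Ring.irreducible g" and lc: "Polynomial.lead_coeff g = 1"
    and root: "ring.eval QB (tb.list_of g) y = \<zero>\<^bsub>QB\<^esub>"
  shows "Qp_bar_val test_prime (incl z \<ominus>\<^bsub>QB\<^esub> y) = of_int (qp_val (poly g z)) / of_nat (Polynomial.degree g)"
proof -
  \<comment> \<open>The sign makes \<open>f\<close> monic; being 1 or -1 it changes no
    valuation.\<close>
  define s where "s = ((-1) ^ Polynomial.degree g :: qp)"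
  define f where "f = [:s:] * (g \<circ>\<^sub>p [:z, -1:])"
  define t where "t = incl z \<ominus>\<^bsub>QB\<^esub> y"
  have s: "s = 1 \<or> s = -1" by (auto simp: s_def minus_one_power_iff)
  have t: "t \<in> carrier QB" using y by (simp add: t_def)
  have "incl z \<oplus>\<^bsub>QB\<^esub> \<ominus>\<^bsub>QB\<^esub> t = y"
    using y by (simp add: t_def tb.minus_eq tb.minus_add tb.r_neg2)
  moreover have "ring.eval QB (tb.list_of [:z, -1:]) t = incl z \<oplus>\<^bsub>QB\<^esub> \<ominus>\<^bsub>QB\<^esub> t"
    using t by (simp add: tb.eval_list_of_pCons tb.\<phi>_minus tb.\<phi>_1 tb.l_minus tb.a_comm)
  ultimately have "ring.eval QB (tb.list_of [:z, -1:]) t = y" by simp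
  hence "ring.eval QB (tb.list_of f) t = \<zero>\<^bsub>QB\<^esub>"
    using t root by (simp only: f_def tb.eval_list_of_mult[OF t] tb.eval_list_of_pcompose[OF t])
      (simp add: tb.r_null)
  moreover have "Factorial_Ring.irreducible f"
    using irreducible_smult[OF irreducible_pcompose_linear[OF irr, of "-1" z], of s] s by (auto simp: f_def)
  moreover have "Polynomial.lead_coeff f = 1"
  proof -
    have "Polynomial.lead_coeff (g \<circ>\<^sub>p [:z, -1:]) = s" by (subst lead_coeff_comp) (simp_all add: lc s_def)
    hence "Polynomial.lead_coeff f = s * s" unfolding f_def lead_coeff_mult by simp
    thus ?thesis using s by auto
  qed
  ultimately have Irr: "ring.Irr QB (Qp_incl test_prime ` carrier QQ) t = tb.list_of f"
    using tb.Irr_eq_list_of[OF t] by (simp add: range_incl)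
  have "inj_on (Qp_incl test_prime) (carrier QQ)"
  proof (rule inj_onI)
    fix A B assume AB: "A \<in> carrier QQ" "B \<in> carrier QQ" "Qp_incl test_prime A = Qp_incl test_prime B"
    then obtain x y where "A = Rep_qp x" "B = Rep_qp y" using range_Rep_qp by (metis rangeE)
    thus "A = B" using AB tb.\<phi>_eq_iff by simp
  qed
  hence "inv_into (carrier QQ) (Qp_incl test_prime) (incl c) = Rep_qp c" for c by simp
  moreover have "qp_val (poly f 0) = qp_val (poly g z)"
    using s by (auto simp: f_def poly_pcompose)
  moreover have "Polynomial.degree f = Polynomial.degree g"
    using s by (auto simp: f_def degree_pcompose)
  ultimately show ?thesis
    unfolding Qp_bar_val_def Let_def t_def[symmetric] Irr tb.const_term_list_of tb.degree_list_of
    by (simp add: qp_val_def)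
qed

lemma Zp_eq: "Zp test_prime = Rep_qp ` {x. qp.vge 0 x}"
proof -
  have "A \<in> Zp test_prime \<longleftrightarrow> (\<exists>x. A = Rep_qp x \<and> qp.vge 0 x)" for A
  proof (cases "A \<in> carrier QQ")
    case True
    then obtain x where "A = Rep_qp x" using range_Rep_qp by blast
    thus ?thesis using Rep_qp_eq_iff[of x 0]
      by (auto simp: Zp_def qp.vge_def qp_val_def Rep_qp_simps simp del: Rep_qp_eq_iff)
  qed (auto simp: Zp_def)
  thus ?thesis by auto
qed

lemma Zp_cong_Rep: "Zp_cong test_prime k (Rep_qp x) (Rep_qp y) \<longleftrightarrow> qp.vge (int k) (x - y)"
proof -
  have pk: "Qp_of_rat test_prime (of_nat test_prime ^ k) = Rep_qp (of_nat test_prime ^ k)"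
    by (simp flip: Rep_qp_of_rat add: of_rat_power)
  have "Zp_cong test_prime k (Rep_qp x) (Rep_qp y) \<longleftrightarrow>
      (\<exists>w. qp.vge 0 w \<and> x - y = of_nat test_prime ^ k * w)"
    by (simp add: Zp_cong_def Zp_eq pk flip: Rep_qp_simps)
  also have "\<dots> \<longleftrightarrow> qp.vge (int k) (x - y)"
  proof
    assume "\<exists>w. qp.vge 0 w \<and> x - y = of_nat test_prime ^ k * w"
    thus "qp.vge (int k) (x - y)" by auto
  next
    assume "qp.vge (int k) (x - y)"
    hence "qp.vge 0 ((x - y) / of_nat test_prime ^ k)" by simp
    thus "\<exists>w. qp.vge 0 w \<and> x - y = of_nat test_prime ^ k * w"
      by (intro exI[of _ "(x - y) / of_nat test_prime ^ k"]) simp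
  qed
  finally show ?thesis .
qed

lemma padic_min_poly_eq: "padic_min_poly test_prime \<beta> = tq.list_of (map_poly of_rat (rat_min_poly \<beta>))"
  by (simp add: padic_min_poly_def tq.list_of_def of_rat_hom.coeffs_map_poly_hom rev_map Rep_qp_of_rat)

text \<open>Each of them is a root of the minimal polynomial in the closure. Finiteness lets the
  \<open>Max\<close> in \<open>approx_exp\<close> bound the contribution of each root.\<close>

lemma finite_nonlinear_roots:
  assumes "algebraic_int \<beta>" shows "finite (nonlinear_roots test_prime \<beta>)"
proof (rule finite_subset)
  define M where "M = (map_poly of_rat (rat_min_poly \<beta>) :: qp poly)"
  have M: "M \<noteq> 0" using rat_min_poly(2)[OF assms] by (auto simp: M_def)
  show "finite {y. ring.is_root QB (tb.list_of M) y}"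
    by (rule tb.finite_number_of_roots[OF tb.list_of_carrier(2)])
  show "nonlinear_roots test_prime \<beta> \<subseteq> {y. ring.is_root QB (tb.list_of M) y}"
  proof
    fix y assume "y \<in> nonlinear_roots test_prime \<beta>"
    then obtain l where y: "y \<in> carrier QB" and l: "l \<in> carrier (poly_ring QQ)"
      "l pdivides\<^bsub>QQ\<^esub> tq.list_of M" "ring.eval QB (map (Qp_incl test_prime) l) y = \<zero>\<^bsub>QB\<^esub>"
      by (auto simp: nonlinear_roots_def padic_min_poly_eq M_def)
    obtain l' where l': "l' \<in> carrier (poly_ring QQ)" "tq.list_of M = l \<otimes>\<^bsub>poly_ring QQ\<^esub> l'"
      using l(2) by (auto simp: pdivides_def factor_def)
    obtain g where g: "l = tq.list_of g" using tq.list_of_cases l(1) by (metis range_Rep_qp)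
    obtain h where h: "l' = tq.list_of h" using tq.list_of_cases l'(1) by (metis range_Rep_qp)
    have "M = g * h" using l'(2) by (simp add: g h univ_poly_mult flip: tq.list_of_mult)
    moreover have "ring.eval QB (tb.list_of g) y = \<zero>\<^bsub>QB\<^esub>" using l(3) by (simp add: g map_Qp_incl_list_of)
    ultimately show "y \<in> {y. ring.is_root QB (tb.list_of M) y}"
      using y M by (simp add: tb.is_root_def tb.eval_list_of_mult)
  qed
qed

text \<open>For any root y of \<open>g\<close> in the closure, v(z - y) is v(g(z)) divided by deg g.
  It is one of the numbers over which the supremum and maximum in \<open>approx_exp\<close> are
  taken.\<close>

lemma qp_val_le_approx_exp:
  assumes \<beta>: "algebraic_int \<beta>"
    and g: "Polynomial.lead_coeff g = 1" "Factorial_Ring.irreducible g" "Polynomial.degree g > 1"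
      "g dvd map_poly of_rat (rat_min_poly \<beta>)"
    and z: "qp.vge 0 z"
  shows "qp_val (poly g z) \<le> int (Polynomial.degree g * approx_exp test_prime \<beta>)"
proof -
  define M where "M = (map_poly of_rat (rat_min_poly \<beta>) :: qp poly)"
  define d where "d = real (Polynomial.degree g)"
  note m = rat_min_poly[OF \<beta>]
  obtain h where h: "M = g * h" using g(4) by (auto simp: M_def)
  have "Polynomial.lead_coeff M = 1" using m(1) by (simp add: M_def)
  hence lch: "Polynomial.lead_coeff h = 1" using g(1) by (simp add: h lead_coeff_mult)
  have "qp.pge 0 M" unfolding M_def by (rule qp.integral_min_poly[OF m(2,1,3) \<beta>])
  hence "qp.pge 0 g" using qp.monic_factor_integral g(1) lch by (simp add: h)
  then obtain B where B: "\<And>z. qp.vge 0 z \<Longrightarrow> \<not> qp.vge (int B) (poly g z)"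
    using qp.irreducible_bounded_on_val_ring g by blast
  obtain y where y: "y \<in> carrier QB" "ring.eval QB (tb.list_of g) y = \<zero>\<^bsub>QB\<^esub>"
    using QB_root[of g] g(3) by auto
  have "tq.list_of g pdivides\<^bsub>QQ\<^esub> padic_min_poly test_prime \<beta>"
    unfolding padic_min_poly_eq M_def[symmetric] h pdivides_def factor_def
    using tq.list_of_carrier(2) by (auto simp: tq.list_of_mult univ_poly_mult)
  moreover have "pirreducible\<^bsub>QQ\<^esub> (carrier QQ) (tq.list_of g)"
    using tq.pirreducible_list_of_iff[of g] g(2) by (simp add: range_Rep_qp)
  moreover have "Polynomials.degree (tq.list_of g) > 1" unfolding tq.degree_list_of by (rule g(3))
  ultimately have yn: "y \<in> nonlinear_roots test_prime \<beta>"
    using y tq.list_of_carrier(2)[of g] unfolding nonlinear_roots_def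
    by (auto simp: map_Qp_incl_list_of intro!: bexI[of _ "tq.list_of g"])
  define val where "val y A = Qp_bar_val test_prime (Qp_incl test_prime A \<ominus>\<^bsub>QB\<^esub> y)" for y A
  have val: "val y (Rep_qp x) = of_int (qp_val (poly g x)) / d" for x
    unfolding val_def d_def by (rule Qp_bar_val_diff[OF y(1) g(2,1) y(2)])
  have d: "d > 0" using g(3) by (simp add: d_def)
  \<comment> \<open>The supremum of reals is an upper bound only for a bounded set; the bound comes
    from \<open>irreducible_bounded_on_val_ring\<close>.\<close>
  have "bdd_above (val y ` Zp test_prime)"
  proof (rule bdd_aboveI2)
    fix A assume "A \<in> Zp test_prime"
    then obtain x where x: "A = Rep_qp x" "qp.vge 0 x" by (auto simp: Zp_eq)
    hence "qp_val (poly g x) \<le> int B" using B[OF x(2)] by (auto simp: qp.vge_def)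
    thus "val y A \<le> real B / d" using d unfolding x(1) val by (intro divide_right_mono) auto
  qed
  hence "val y (Rep_qp z) \<le> (SUP A\<in>Zp test_prime. val y A)"
    using z by (intro cSUP_upper) (auto simp: Zp_eq)
  also have "\<dots> \<le> Max ((\<lambda>y. SUP A\<in>Zp test_prime. val y A) ` nonlinear_roots test_prime \<beta>)"
    using yn finite_nonlinear_roots[OF \<beta>] by (intro Max_ge) auto
  also have "\<dots> \<le> of_nat (approx_exp test_prime \<beta>)"
    using yn by (auto simp: approx_exp_def val_def intro: order_trans[OF le_of_int_ceiling])
  finally have "of_int (qp_val (poly g z)) \<le> d * approx_exp test_prime \<beta>"
    using d unfolding val by (simp add: divide_le_eq mult.commute)
  hence "real_of_int (qp_val (poly g z)) \<le> real_of_int (int (Polynomial.degree g * approx_exp test_prime \<beta>))"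
    by (simp add: d_def)
  thus ?thesis by (simp only: of_int_le_iff)
qed

text \<open>Every quantity of the definition is carried along the bijection \<open>Rep_qp\<close>.
  Since the minimal polynomial is monic and integral, all its roots in Q_p lie in Z_p, so the roots
  considered on both sides correspond.\<close>

lemma padic_alpha_of_admissible_choice:
  assumes \<beta>: "algebraic_int \<beta>" and adm: "admissible_choice test_prime \<beta> r"
  shows "\<exists>m K k N. padic_alpha test_prime qp_val \<beta> m (\<lambda>z. r (Rep_qp z)) K k N \<and>
    alpha_p test_prime \<beta> r = padic_alpha.a test_prime \<beta> m (\<lambda>z. r (Rep_qp z)) K k N"
proof -
  define m where "m = rat_min_poly \<beta>"
  define Z where "Z = {z :: qp. rpoly m z = 0}"
  define K where "K = max_root_exp test_prime \<beta>"
  define k where "k = sep_exp test_prime \<beta>"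
  define N where "N = approx_exp test_prime \<beta>"
  note m = rat_min_poly[OF \<beta>, folded m_def]
  have mM: "qp.pge 0 (map_poly of_rat m)" by (rule qp.integral_min_poly[OF m(2,1,3) \<beta>])
  have finZ: "finite Z"
    using poly_roots_finite[of "map_poly of_rat m :: qp poly"] m(2) by (auto simp: Z_def)
  have Zint: "qp.vge 0 z" if "z \<in> Z" for z
    using qp.integral_monic_root_in_val_ring[OF mM, of z] m(1) that by (simp add: Z_def)
  have roots: "Zp_roots test_prime \<beta> = Rep_qp ` Z"
  proof -
    have "ring.eval QQ (padic_min_poly test_prime \<beta>) (Rep_qp x) = \<zero>\<^bsub>QQ\<^esub> \<longleftrightarrow> x \<in> Z" for x
      using tq.\<phi>_eq_iff[of "rpoly m x" 0]
      by (simp add: padic_min_poly_eq tq.eval_list_of_base Z_def m_def flip: tq.\<phi>_0)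
    thus ?thesis using Zint by (auto simp: Zp_roots_def Zp_eq)
  qed
  have inj: "inj_on Rep_qp A" for A by (rule inj_onI) simp
  have card: "card (Zp_roots test_prime \<beta>) = card Z" unfolding roots by (rule card_image[OF inj])
  have root_exp: "root_exp test_prime \<beta> (Rep_qp z) = (\<Sum>w\<in>Z - {z}. qp_val (w - z))" for z
  proof -
    have "Rep_qp ` Z - {Rep_qp z} = Rep_qp ` (Z - {z})" by auto
    thus ?thesis by (simp add: root_exp_def roots sum.reindex[OF inj] qp_val_def Rep_qp_simps)
  qed
  have nonneg: "0 \<le> (\<Sum>w\<in>Z - {z}. qp_val (w - z))" if "z \<in> Z" for z
    using qp.vge_diff[OF Zint Zint[OF that]] by (intro sum_nonneg) (auto simp: qp.vge_def)
  have K_ge: "(\<Sum>w\<in>Z - {z}. qp_val (w - z)) \<le> K" if "z \<in> Z" for z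
    using that finZ by (auto simp: K_def max_root_exp_def roots image_image root_exp intro!: Max_ge)
  have K_nonneg: "K \<ge> 0"
  proof (cases "Z = {}")
    case False
    then obtain z where "z \<in> Z" by blast
    from nonneg[OF this] K_ge[OF this] show ?thesis by simp
  qed (simp add: K_def max_root_exp_def roots)
  \<comment> \<open>One more than the sum of all valuations of differences separates the roots, so
    the \<open>LEAST\<close> in \<open>sep_exp\<close> is attained.\<close>
  have "\<exists>k>0. \<forall>z\<in>Z. \<forall>w\<in>Z. z \<noteq> w \<longrightarrow> \<not> qp.vge (int k) (z - w)"
  proof (intro exI conjI ballI impI)
    let ?k = "Suc (\<Sum>z\<in>Z. \<Sum>w\<in>Z. nat (qp_val (z - w)))"
    show "?k > 0" by simp
    fix z w assume zw: "z \<in> Z" "w \<in> Z" "z \<noteq> w"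
    have "nat (qp_val (z - w)) \<le> (\<Sum>w\<in>Z. nat (qp_val (z - w)))"
      using zw finZ by (intro member_le_sum) auto
    also have "\<dots> \<le> (\<Sum>z\<in>Z. \<Sum>w\<in>Z. nat (qp_val (z - w)))"
      using zw finZ by (intro member_le_sum[of z Z "\<lambda>z. \<Sum>w\<in>Z. nat (qp_val (z - w))"]) auto
    also have "\<dots> < ?k" by (rule lessI)
    finally have "nat (qp_val (z - w)) < ?k" .
    moreover have "x < int n" if "nat x < n" for x n using that by linarith
    ultimately have "qp_val (z - w) < int ?k" by blast
    thus "\<not> qp.vge (int ?k) (z - w)" using zw(3) by (simp add: qp.vge_def del: of_nat_Suc)
  qed
  from LeastI_ex[OF this] have "k > 0 \<and> (\<forall>z\<in>Z. \<forall>w\<in>Z. z \<noteq> w \<longrightarrow> \<not> qp.vge (int k) (z - w))"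
    by (simp add: k_def sep_exp_def roots Zp_cong_Rep)
  hence k: "k > 0" "\<And>z w. z \<in> Z \<Longrightarrow> w \<in> Z \<Longrightarrow> z \<noteq> w \<Longrightarrow> qp_val (z - w) < int k"
    by (auto simp: qp.vge_def not_le)
  \<comment> \<open>Congruence modulo the power \<open>e\<close> but not \<open>e + 1\<close> says
    that the valuation is exactly \<open>e\<close>, and in particular that the integer differs from
    the root.\<close>
  have r: "of_int (r (Rep_qp z)) \<noteq> z \<and> qp_val (of_int (r (Rep_qp z)) - z) =
      K - (\<Sum>w\<in>Z - {z}. qp_val (w - z)) + int k + int (card Z * N)" if z: "z \<in> Z" for z
  proof -
    define e where "e = nat (K - (\<Sum>w\<in>Z - {z}. qp_val (w - z))) + k + card Z * N"
    have "Qp_of_rat test_prime (of_int n) = Rep_qp (of_int n)" for n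
      using Rep_qp_of_rat[of "of_int n"] by simp
    hence "qp.vge (int e) (of_int (r (Rep_qp z)) - z) \<and> \<not> qp.vge (int (e + 1)) (of_int (r (Rep_qp z)) - z)"
      using adm z by (simp only: admissible_choice_def Let_def roots ball_simps card[unfolded roots] root_exp
          Zp_cong_Rep e_def simp_thms flip: K_def k_def N_def)
    thus ?thesis using K_ge[OF z] by (auto simp: qp.vge_def e_def)
  qed
  interpret pa: padic_alpha test_prime qp_val \<beta> m "\<lambda>z. r (Rep_qp z)" "nat K" k N
  proof unfold_locales
    show "qp_val (poly g (of_int n)) \<le> int (Polynomial.degree g * N)"
      if "Polynomial.lead_coeff g = 1" "Factorial_Ring.irreducible g" "Polynomial.degree g > 1"
        "g dvd map_poly of_rat m" for g n
      unfolding N_def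
    proof (rule qp_val_le_approx_exp[OF \<beta> that(1-3)])
      show "g dvd map_poly of_rat (rat_min_poly \<beta>)" using that(4) by (simp add: m_def)
      show "qp.vge 0 (of_int n)" using qp.vge_of_int_iff[of 0 n] by simp
    qed
  qed (use \<beta> m k K_ge K_nonneg r in \<open>auto simp: Z_def\<close>)
  have "alpha_p test_prime \<beta> r = pa.a"
    by (simp add: alpha_p_def pa.a_def pa.e_def pa.Z_def roots prod.reindex[OF inj] card_image[OF inj]
        flip: K_def k_def N_def Z_def)
  thus ?thesis using pa.padic_alpha_axioms by blast
qed

lemma local_property_test_prime: "local_property test_prime"
  unfolding local_property_def
proof (intro allI impI conjI)
  fix \<beta> r assume "algebraic_int \<beta>" "admissible_choice test_prime \<beta> r"
  then obtain m K k N where pa: "padic_alpha test_prime qp_val \<beta> m (\<lambda>z. r (Rep_qp z)) K k N"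
    and a: "alpha_p test_prime \<beta> r = padic_alpha.a test_prime \<beta> m (\<lambda>z. r (Rep_qp z)) K k N"
    using padic_alpha_of_admissible_choice by blast
  show "alpha_p test_prime \<beta> r \<noteq> 0" unfolding a by (rule padic_alpha.a_nonzero[OF pa])
  show "alpha_p test_prime \<beta> r \<in> int_valued_image \<beta>"
    unfolding a by (rule padic_alpha.a_in_int_valued_image[OF pa])
  show "\<exists>D. \<not> test_prime dvd D \<and> algebraic_int (of_nat D * inverse (alpha_p test_prime \<beta> r))"
    unfolding a by (rule padic_alpha.inverse_a_p_integral[OF pa])
  fix \<delta> l :: nat and c assume "\<delta> > 0" "c \<in> number_field \<beta>" "algebraic_int c" "algebraic_int (c * (\<beta> / of_nat \<delta>))"
  thus "\<exists>M L D. \<not> test_prime dvd D \<and> algebraic_int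
      (of_nat D * ((\<beta> / of_nat \<delta> gchoose l) * c ^ L * inverse (alpha_p test_prime \<beta> r) ^ M))"
    unfolding a by (rule padic_alpha.binomial_p_integral[OF pa])
qed

theorem theorem1p5:
  fixes \<alpha> :: complex
  assumes "algebraic \<alpha>" and "\<alpha> \<notin> \<nat>"
  shows "(\<forall>r :: nat \<Rightarrow> padic \<Rightarrow> int.
            (\<forall>p. prime p \<longrightarrow> admissible_choice p (integral_part \<alpha>) (r p)) \<longrightarrow>
            binomial_semiring \<alpha> =
              integers_adjoin \<alpha> ({\<alpha>} \<union> {alpha_p p (integral_part \<alpha>) (r p) | p. prime p})) \<and>
         (algebraic_int \<alpha> \<longrightarrow>
          (\<forall>r :: nat \<Rightarrow> padic \<Rightarrow> int.
            (\<forall>p. prime p \<longrightarrow> admissible_choice p \<alpha> (r p)) \<longrightarrow>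
            binomial_semiring \<alpha> = integers_adjoin \<alpha> {alpha_p p \<alpha> (r p) | p. prime p}))"
  by (rule main_of_local[OF local_property_of_test_prime[OF local_property_test_prime] assms])

end
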